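(* The assignment $\theta_i\mapsto\theta_i$, $i\in I$, gives a twisted bialgebra isomorphism $\mathfrak{f}\simeq(\mathbf{f}_{v,t},\odot,r_1)$; that is, it extends to an isomorphism of $\mathbb{Q}(v,t)$-algebras $\phi:\mathfrak{f}\to(\mathbf{f}_{v,t},\odot)$ satisfying $(\phi\otimes\phi)\circ r=r_1\circ\phi$.
   Context: **Datum.** $I$ is a finite set and $\Omega=(\Omega_{ij})_{i,j\in I}$ an integer matrix such that (a) $\Omega_{ii}\in\mathbb{Z}_{>0}$ and $\Omega_{ij}\in\mathbb{Z}_{\le0}$ for $i\neq j$; (b) $\frac{\Omega_{ij}+\Omega_{ji}}{\Omega_{ii}}\in\mathbb{Z}_{\le0}$ for $i\ne j$; (c) $\gcd_i(\Omega_{ii})=1$. Bilinear forms on $\mathbb{Z}^I$: $\langle i,j\rangle=\Omega_{ij}$, $[i,j]=2\delta_{ij}\Omega_{ii}-\Omega_{ij}$, $i\cdot j=\langle i,j\rangle+\langle j,i\rangle$. For indeterminates $v,t$ put $v_i=v^{i\cdot i/2}$. **The algebra $\mathfrak{f}$.** ${}'\mathfrak{f}$ is the free unital associative $\mathbb{Q}(v,t)$-algebra on $\theta_i$ ($i\in I$), $\mathbb{N}^I$-graded with $|\theta_i|=i$. ${}'\mathfrak{f}\otimes{}'\mathfrak{f}$ has multiplication $(x_1\otimes x_2)(y_1\otimes y_2)=v^{-|y_1|\cdot|x_2|}t^{\langle|y_1|,|x_2|\rangle-\langle|x_2|,|y_1|\rangle}x_1y_1\otimes x_2y_2$ on homogeneous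 elements, and $r:{}'\mathfrak{f}\to{}'\mathfrak{f}\otimes{}'\mathfrak{f}$ is the algebra homomorphism with $r(\theta_i)=\theta_i\otimes1+1\otimes\theta_i$. There is a unique (symmetric) $\mathbb{Q}(v,t)$-valued bilinear form $(,)$ on ${}'\mathfrak{f}$ with $(1,1)=1$, $(\theta_i,\theta_j)=\delta_{ij}(1-v_i^{-2})^{-1}$, $(x,y'y'')=(r(x),y'\otimes y'')$, $(x'x'',y)=(x'\otimes x'',r(y))$, where $(x_1\otimes x_2,y_1\otimes y_2)=t^{2[|x_1|,|x_2|]}(x_1,y_1)(x_2,y_2)$ for homogeneous elements. Its radical $\mathfrak{I}$ is a two-sided ideal; $\mathfrak{f}={}'\mathfrak{f}/\mathfrak{I}$, and $r$ induces an algebra homomorphism $r:\mathfrak{f}\to\mathfrak{f}\otimes\mathfrak{f}$ (with the same twisted multiplication on $\mathfrak{f}\otimes\mathfrak{f}$). **Lusztig's algebra.** $(\mathbf{f},\circ,\widetilde r_1)$ is the $\mathbb{Q}(v)$-algebra, with multiplication $\circ$ and comultiplication $\widetilde r_1$, obtained by the same construction over $\mathbb{Q}(v)$ with $t$ replaced by $1$ (Lusztig's algebra of the Cartan datum $(I,\cdot)$). $\mathbf{f}_{v,t}=\mathbf{f}\otimes_{\mathbb{Q}(v)}\mathbb{Q}(v,t)$, with $\circ,\widetilde r_1$ extended linearly. **Deformation.** On $\mathbf{f}_{v,t}$: $x\odot y=t^{[|x|,|y|]}x\circ y$ for homogeneous $x,y$. On $\mathbf{f}_{v,t}\otimes\mathbf{f}_{v,t}$: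 $(x_1\otimes x_2)\odot(y_1\otimes y_2)=v^{-|y_1|\cdot|x_2|}t^{\langle|y_1|,|x_2|\rangle-\langle|x_2|,|y_1|\rangle}(x_1\odot y_1)\otimes(x_2\odot y_2)$. Define $r_1(x)=\sum t^{-[|x_1|,|x_2|]}x_1\otimes x_2$ if $\widetilde r_1(x)=\sum x_1\otimes x_2$ with $x_1,x_2$ homogeneous; $r_1$ is an algebra homomorphism for $\odot$. *)

theory Defs
  imports
    "HOL-Library.Poly_Mapping"
    "HOL-Computational_Algebra.Fraction_Field"
    "HOL-Computational_Algebra.Polynomial"
    "HOL-Algebra.QuotRing"
    "HOL-Algebra.Module"
begin

section \<open>The datum and its bilinear forms\<close>

definition datum :: "('i::finite \<Rightarrow> 'i \<Rightarrow> int) \<Rightarrow> bool" where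
  "datum \<Omega> \<longleftrightarrow>
     (\<forall>i. \<Omega> i i > 0) \<and>
     (\<forall>i j. i \<noteq> j \<longrightarrow> \<Omega> i j \<le> 0) \<and>
     (\<forall>i j. i \<noteq> j \<longrightarrow> \<Omega> i i dvd (\<Omega> i j + \<Omega> j i) \<and> (\<Omega> i j + \<Omega> j i) div \<Omega> i i \<le> 0) \<and>
     Gcd {\<Omega> i i |i. True} = 1"

definition basis_vec :: "'i \<Rightarrow> 'i \<Rightarrow> int" where
  "basis_vec i = (\<lambda>j. if j = i then 1 else 0)"

definition angle :: "('i::finite \<Rightarrow> 'i \<Rightarrow> int) \<Rightarrow> ('i \<Rightarrow> int) \<Rightarrow> ('i \<Rightarrow> int) \<Rightarrow> int" where
  "angle \<Omega> \<mu> \<nu> = (\<Sum>i\<in>UNIV. \<Sum>j\<in>UNIV. \<mu> i * \<nu> j * \<Omega> i j)"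

definition bracket :: "('i::finite \<Rightarrow> 'i \<Rightarrow> int) \<Rightarrow> ('i \<Rightarrow> int) \<Rightarrow> ('i \<Rightarrow> int) \<Rightarrow> int" where
  "bracket \<Omega> \<mu> \<nu> =
     (\<Sum>i\<in>UNIV. \<Sum>j\<in>UNIV. \<mu> i * \<nu> j * (2 * (if i = j then \<Omega> i i else 0) - \<Omega> i j))"

definition dot :: "('i::finite \<Rightarrow> 'i \<Rightarrow> int) \<Rightarrow> ('i \<Rightarrow> int) \<Rightarrow> ('i \<Rightarrow> int) \<Rightarrow> int" where
  "dot \<Omega> \<mu> \<nu> = angle \<Omega> \<mu> \<nu> + angle \<Omega> \<nu> \<mu>"

definition v_at :: "('i::finite \<Rightarrow> 'i \<Rightarrow> int) \<Rightarrow> 'k::field \<Rightarrow> 'i \<Rightarrow> 'k" where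
  "v_at \<Omega> v i = v powi (dot \<Omega> (basis_vec i) (basis_vec i) div 2)"

text \<open>Degrees lie in \<open>'i \<Rightarrow> nat\<close>; the forms see them through this inclusion.\<close>

definition to_Z :: "('i \<Rightarrow> nat) \<Rightarrow> ('i \<Rightarrow> int)" where
  "to_Z \<nu> = (\<lambda>i. int (\<nu> i))"

definition deg :: "'i list \<Rightarrow> ('i \<Rightarrow> nat)" where
  "deg w = (\<lambda>i. count_list w i)"

abbreviation zdeg :: "'i list \<Rightarrow> ('i \<Rightarrow> int)" where
  "zdeg w \<equiv> to_Z (deg w)"


section \<open>Vector spaces as module records\<close>

text \<open>
  Scalars form a field type. Vector spaces and algebras are \<open>module\<close> records; where only
  the vector space matters, the ring fields \<open>mult\<close> and \<open>one\<close> are left unspecified.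
\<close>

definition scale :: "'k::field \<Rightarrow> ('b \<Rightarrow>\<^sub>0 'k) \<Rightarrow> ('b \<Rightarrow>\<^sub>0 'k)" where
  "scale c x = Poly_Mapping.map ((*) c) x"

definition free_space :: "'b set \<Rightarrow> ('k::field, 'b \<Rightarrow>\<^sub>0 'k) module" where
  "free_space S =
     \<lparr>carrier = {z. Poly_Mapping.keys z \<subseteq> S}, mult = undefined, one = undefined,
      zero = 0, add = (+), smult = scale\<rparr>"

definition quot_space :: "('k, 'a, 'm) module_scheme \<Rightarrow> 'a set \<Rightarrow> ('k, 'a set) module"
    (infixl \<open>QuotM\<close> 65) where
  "M QuotM N =
     ring.extend (M Quot N) (module.fields (\<lambda>c X. \<Union>x\<in>X. N +>\<^bsub>M\<^esub> (c \<odot>\<^bsub>M\<^esub> x)))"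

definition restrict_scalars ::
    "('k \<Rightarrow> 'l) \<Rightarrow> ('l, 'a, 'm) module_scheme \<Rightarrow> ('k, 'a) module" where
  "restrict_scalars emb M =
     ring.extend (ring.truncate M) (module.fields (\<lambda>c x. emb c \<odot>\<^bsub>M\<^esub> x))"

definition field_module :: "('l::field, 'l) module" where
  "field_module =
     \<lparr>carrier = UNIV, mult = (*), one = 1, zero = 0, add = (+), smult = (*)\<rparr>"


section \<open>Tensor products\<close>

text \<open>
  The tensor product is the free space on pairs modulo the bilinearity relations, so its
  elements are cosets of formal linear combinations of pairs.
\<close>

definition tensor_relators ::
    "('k::field, 'a, 'm) module_scheme \<Rightarrow> ('k, 'b, 'n) module_scheme \<Rightarrow> ('a \<times> 'b \<Rightarrow>\<^sub>0 'k) set" where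
  "tensor_relators V W =
     {Poly_Mapping.single (x \<oplus>\<^bsub>V\<^esub> x', y) 1 - Poly_Mapping.single (x, y) 1
        - Poly_Mapping.single (x', y) 1 |x x' y.
        x \<in> carrier V \<and> x' \<in> carrier V \<and> y \<in> carrier W} \<union>
     {Poly_Mapping.single (x, y \<oplus>\<^bsub>W\<^esub> y') 1 - Poly_Mapping.single (x, y) 1
        - Poly_Mapping.single (x, y') 1 |x y y'.
        x \<in> carrier V \<and> y \<in> carrier W \<and> y' \<in> carrier W} \<union>
     {Poly_Mapping.single (c \<odot>\<^bsub>V\<^esub> x, y) 1 - Poly_Mapping.single (x, y) c |c x y.
        x \<in> carrier V \<and> y \<in> carrier W} \<union>
     {Poly_Mapping.single (x, c \<odot>\<^bsub>W\<^esub> y) 1 - Poly_Mapping.single (x, y) c |c x y.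
        x \<in> carrier V \<and> y \<in> carrier W}"

definition tensor_kernel ::
    "('k::field, 'a, 'm) module_scheme \<Rightarrow> ('k, 'b, 'n) module_scheme \<Rightarrow> ('a \<times> 'b \<Rightarrow>\<^sub>0 'k) set" where
  "tensor_kernel V W = Modules.module.span scale (tensor_relators V W)"

definition tensor ::
    "('k::field, 'a, 'm) module_scheme \<Rightarrow> ('k, 'b, 'n) module_scheme
       \<Rightarrow> ('k, ('a \<times> 'b \<Rightarrow>\<^sub>0 'k) set) module" where
  "tensor V W = free_space (carrier V \<times> carrier W) QuotM tensor_kernel V W"

definition pure ::
    "('k::field, 'a, 'm) module_scheme \<Rightarrow> ('k, 'b, 'n) module_scheme
       \<Rightarrow> 'a \<Rightarrow> 'b \<Rightarrow> ('a \<times> 'b \<Rightarrow>\<^sub>0 'k) set" where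
  "pure V W x y =
     tensor_kernel V W +>\<^bsub>free_space (carrier V \<times> carrier W)\<^esub> Poly_Mapping.single (x, y) 1"

text \<open>
  The linear map on a tensor product induced by a bilinear map \<open>\<beta>\<close> into \<open>U\<close>; all
  representatives of a coset give the same value, which \<open>the_elem\<close> extracts.
\<close>

definition tensor_lift ::
    "('k::field, 'u, 'm) module_scheme \<Rightarrow> ('a \<Rightarrow> 'b \<Rightarrow> 'u) \<Rightarrow> ('a \<times> 'b \<Rightarrow>\<^sub>0 'k) set \<Rightarrow> 'u" where
  "tensor_lift U \<beta> X =
     the_elem ((\<lambda>z. \<Oplus>\<^bsub>U\<^esub>p\<in>Poly_Mapping.keys z. Poly_Mapping.lookup z p \<odot>\<^bsub>U\<^esub> \<beta> (fst p) (snd p)) ` X)"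

definition tensor_map ::
    "('k::field, 'c, 'm) module_scheme \<Rightarrow> ('k, 'd, 'n) module_scheme
       \<Rightarrow> ('a \<Rightarrow> 'c) \<Rightarrow> ('b \<Rightarrow> 'd) \<Rightarrow> ('a \<times> 'b \<Rightarrow>\<^sub>0 'k) set \<Rightarrow> ('c \<times> 'd \<Rightarrow>\<^sub>0 'k) set" where
  "tensor_map V' W' f g = tensor_lift (tensor V' W') (\<lambda>x y. pure V' W' (f x) (g y))"


section \<open>Extension of scalars of an algebra\<close>

text \<open>For a field embedding \<open>emb\<close> of \<open>'k\<close> into \<open>'l\<close>, this is \<open>A \<otimes> 'l\<close> as an \<open>'l\<close>-algebra.\<close>

definition ext_pure ::
    "('k::field \<Rightarrow> 'l::field) \<Rightarrow> ('k, 'a, 'm) module_scheme \<Rightarrow> 'a \<Rightarrow> 'l \<Rightarrow> ('a \<times> 'l \<Rightarrow>\<^sub>0 'k) set" where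
  "ext_pure emb A = pure A (restrict_scalars emb field_module)"

definition ext_alg ::
    "('k::field \<Rightarrow> 'l::field) \<Rightarrow> ('k, 'a, 'm) module_scheme \<Rightarrow> ('l, ('a \<times> 'l \<Rightarrow>\<^sub>0 'k) set) module" where
  "ext_alg emb A = (let T = tensor A (restrict_scalars emb field_module) in
     \<lparr>carrier = carrier T,
      mult = (\<lambda>X Y. tensor_lift T
                (\<lambda>x c. tensor_lift T (\<lambda>y d. ext_pure emb A (x \<otimes>\<^bsub>A\<^esub> y) (c * d)) Y) X),
      one = ext_pure emb A \<one>\<^bsub>A\<^esub> 1,
      zero = \<zero>\<^bsub>T\<^esub>,
      add = (\<oplus>\<^bsub>T\<^esub>),
      smult = (\<lambda>c. tensor_lift T (\<lambda>x d. ext_pure emb A x (c * d)))\<rparr>)"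

text \<open>The linear extension of a comultiplication from \<open>A\<close> to \<open>B = ext_alg emb A\<close>.\<close>

definition ext_comult ::
    "('k::field \<Rightarrow> 'l::field) \<Rightarrow> ('k, 'a, 'm) module_scheme \<Rightarrow> ('a \<Rightarrow> ('a \<times> 'a \<Rightarrow>\<^sub>0 'k) set)
       \<Rightarrow> ('a \<times> 'l \<Rightarrow>\<^sub>0 'k) set
       \<Rightarrow> (('a \<times> 'l \<Rightarrow>\<^sub>0 'k) set \<times> ('a \<times> 'l \<Rightarrow>\<^sub>0 'k) set \<Rightarrow>\<^sub>0 'l) set" where
  "ext_comult emb A \<Delta> =
     (let B = ext_alg emb A; T = tensor B B; TK = restrict_scalars emb T in
        tensor_lift TK
          (\<lambda>x c. c \<odot>\<^bsub>T\<^esub>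
             tensor_lift TK (\<lambda>a b. pure B B (ext_pure emb A a 1) (ext_pure emb A b 1)) (\<Delta> x)))"


section \<open>Gradings\<close>

text \<open>
  A grading is the family \<open>G\<close> of its homogeneous parts, and \<open>component M G x \<nu>\<close> is the part
  of \<open>x\<close> in degree \<open>\<nu>\<close>. Given \<open>\<beta>\<close> bilinear, \<open>graded_rescale\<close> is the bilinear map taking
  homogeneous \<open>x, y\<close> to \<open>c |x| |y|\<close> times \<open>\<beta> x y\<close>.
\<close>

definition component ::
    "('k, 'a, 'm) module_scheme \<Rightarrow> ('d \<Rightarrow> 'a set) \<Rightarrow> 'a \<Rightarrow> 'd \<Rightarrow> 'a" where
  "component M G x =
     (THE d. (\<forall>\<nu>. d \<nu> \<in> G \<nu>) \<and> finite {\<nu>. d \<nu> \<noteq> \<zero>\<^bsub>M\<^esub>} \<and>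
             x = (\<Oplus>\<^bsub>M\<^esub>\<nu>\<in>{\<nu>. d \<nu> \<noteq> \<zero>\<^bsub>M\<^esub>}. d \<nu>))"

definition degrees ::
    "('k, 'a, 'm) module_scheme \<Rightarrow> ('d \<Rightarrow> 'a set) \<Rightarrow> 'a \<Rightarrow> 'd set" where
  "degrees M G x = {\<nu>. component M G x \<nu> \<noteq> \<zero>\<^bsub>M\<^esub>}"

definition graded_rescale ::
    "('k, 'a, 'm) module_scheme \<Rightarrow> ('d \<Rightarrow> 'a set) \<Rightarrow> ('k, 'u, 'n) module_scheme
       \<Rightarrow> ('d \<Rightarrow> 'd \<Rightarrow> 'k) \<Rightarrow> ('a \<Rightarrow> 'a \<Rightarrow> 'u) \<Rightarrow> 'a \<Rightarrow> 'a \<Rightarrow> 'u" where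
  "graded_rescale M G U c \<beta> x y =
     (\<Oplus>\<^bsub>U\<^esub>p\<in>degrees M G x \<times> degrees M G y.
        c (fst p) (snd p) \<odot>\<^bsub>U\<^esub> \<beta> (component M G x (fst p)) (component M G y (snd p)))"

definition ext_grading ::
    "('k::field \<Rightarrow> 'l::field) \<Rightarrow> ('k, 'a, 'm) module_scheme \<Rightarrow> ('d \<Rightarrow> 'a set)
       \<Rightarrow> 'd \<Rightarrow> ('a \<times> 'l \<Rightarrow>\<^sub>0 'k) set set" where
  "ext_grading emb A G \<nu> =
     {X \<in> carrier (ext_alg emb A). \<exists>z\<in>X. Poly_Mapping.keys z \<subseteq> G \<nu> \<times> UNIV}"


section \<open>The free algebra, its comultiplication and its form\<close>

text \<open>
  The free algebra has the words as basis, its tensor square the pairs of words; a pair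
  \<open>(u, w)\<close> stands for the tensor of the two words. Words are homogeneous.
\<close>

definition word :: "'i list \<Rightarrow> ('i list \<Rightarrow>\<^sub>0 'k::field)" where
  "word w = Poly_Mapping.single w 1"

definition free_mult ::
    "('i list \<Rightarrow>\<^sub>0 'k::field) \<Rightarrow> ('i list \<Rightarrow>\<^sub>0 'k) \<Rightarrow> ('i list \<Rightarrow>\<^sub>0 'k)" where
  "free_mult x y =
     (\<Sum>u\<in>Poly_Mapping.keys x. \<Sum>w\<in>Poly_Mapping.keys y. Poly_Mapping.single (u @ w) (Poly_Mapping.lookup x u * Poly_Mapping.lookup y w))"

definition free_alg :: "('k::field, 'i list \<Rightarrow>\<^sub>0 'k) module" where
  "free_alg =
     \<lparr>carrier = UNIV, mult = free_mult, one = word [], zero = 0, add = (+), smult = scale\<rparr>"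

definition free_tensor ::
    "('i list \<Rightarrow>\<^sub>0 'k::field) \<Rightarrow> ('i list \<Rightarrow>\<^sub>0 'k) \<Rightarrow> ('i list \<times> 'i list \<Rightarrow>\<^sub>0 'k)" where
  "free_tensor x y =
     (\<Sum>u\<in>Poly_Mapping.keys x. \<Sum>w\<in>Poly_Mapping.keys y. Poly_Mapping.single (u, w) (Poly_Mapping.lookup x u * Poly_Mapping.lookup y w))"

definition twisted_mult ::
    "('i::finite \<Rightarrow> 'i \<Rightarrow> int) \<Rightarrow> 'k::field \<Rightarrow> 'k
       \<Rightarrow> ('i list \<times> 'i list \<Rightarrow>\<^sub>0 'k) \<Rightarrow> ('i list \<times> 'i list \<Rightarrow>\<^sub>0 'k) \<Rightarrow> ('i list \<times> 'i list \<Rightarrow>\<^sub>0 'k)" where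
  "twisted_mult \<Omega> v t X Y =
     (\<Sum>(x1, x2)\<in>Poly_Mapping.keys X. \<Sum>(y1, y2)\<in>Poly_Mapping.keys Y.
        Poly_Mapping.single (x1 @ y1, x2 @ y2)
          (Poly_Mapping.lookup X (x1, x2) * Poly_Mapping.lookup Y (y1, y2)
           * v powi (- dot \<Omega> (zdeg y1) (zdeg x2))
           * t powi (angle \<Omega> (zdeg y1) (zdeg x2) - angle \<Omega> (zdeg x2) (zdeg y1))))"

primrec comult_word ::
    "('i::finite \<Rightarrow> 'i \<Rightarrow> int) \<Rightarrow> 'k::field \<Rightarrow> 'k \<Rightarrow> 'i list \<Rightarrow> ('i list \<times> 'i list \<Rightarrow>\<^sub>0 'k)" where
  "comult_word \<Omega> v t [] = free_tensor (word []) (word [])"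
| "comult_word \<Omega> v t (i # w) =
     twisted_mult \<Omega> v t
       (free_tensor (word [i]) (word []) + free_tensor (word []) (word [i]))
       (comult_word \<Omega> v t w)"

definition free_comult ::
    "('i::finite \<Rightarrow> 'i \<Rightarrow> int) \<Rightarrow> 'k::field \<Rightarrow> 'k \<Rightarrow> ('i list \<Rightarrow>\<^sub>0 'k) \<Rightarrow> ('i list \<times> 'i list \<Rightarrow>\<^sub>0 'k)" where
  "free_comult \<Omega> v t x = (\<Sum>w\<in>Poly_Mapping.keys x. scale (Poly_Mapping.lookup x w) (comult_word \<Omega> v t w))"

definition tensor_form ::
    "('i::finite \<Rightarrow> 'i \<Rightarrow> int) \<Rightarrow> 'k::field \<Rightarrow> (('i list \<Rightarrow>\<^sub>0 'k) \<Rightarrow> ('i list \<Rightarrow>\<^sub>0 'k) \<Rightarrow> 'k)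
       \<Rightarrow> ('i list \<times> 'i list \<Rightarrow>\<^sub>0 'k) \<Rightarrow> ('i list \<times> 'i list \<Rightarrow>\<^sub>0 'k) \<Rightarrow> 'k" where
  "tensor_form \<Omega> t B X Y =
     (\<Sum>(x1, x2)\<in>Poly_Mapping.keys X. \<Sum>(y1, y2)\<in>Poly_Mapping.keys Y.
        Poly_Mapping.lookup X (x1, x2) * Poly_Mapping.lookup Y (y1, y2)
        * t powi (2 * bracket \<Omega> (zdeg x1) (zdeg x2))
        * B (word x1) (word y1) * B (word x2) (word y2))"

definition is_form ::
    "('i::finite \<Rightarrow> 'i \<Rightarrow> int) \<Rightarrow> 'k::field \<Rightarrow> 'k \<Rightarrow> (('i list \<Rightarrow>\<^sub>0 'k) \<Rightarrow> ('i list \<Rightarrow>\<^sub>0 'k) \<Rightarrow> 'k) \<Rightarrow> bool" where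
  "is_form \<Omega> v t B \<longleftrightarrow>
     (\<forall>y. Vector_Spaces.linear scale (*) (\<lambda>x. B x y)) \<and>
     (\<forall>x. Vector_Spaces.linear scale (*) (B x)) \<and>
     (\<forall>x y. B x y = B y x) \<and>
     B (word []) (word []) = 1 \<and>
     (\<forall>i j. B (word [i]) (word [j]) = (if i = j then inverse (1 - v_at \<Omega> v i powi (-2)) else 0)) \<and>
     (\<forall>x y' y''. B x (free_mult y' y'')
        = tensor_form \<Omega> t B (free_comult \<Omega> v t x) (free_tensor y' y'')) \<and>
     (\<forall>x' x'' y. B (free_mult x' x'') y
        = tensor_form \<Omega> t B (free_tensor x' x'') (free_comult \<Omega> v t y))"

definition the_form ::
    "('i::finite \<Rightarrow> 'i \<Rightarrow> int) \<Rightarrow> 'k::field \<Rightarrow> 'k \<Rightarrow> ('i list \<Rightarrow>\<^sub>0 'k) \<Rightarrow> ('i list \<Rightarrow>\<^sub>0 'k) \<Rightarrow> 'k" where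
  "the_form \<Omega> v t = (THE B. is_form \<Omega> v t B)"

definition radical :: "('i::finite \<Rightarrow> 'i \<Rightarrow> int) \<Rightarrow> 'k::field \<Rightarrow> 'k \<Rightarrow> ('i list \<Rightarrow>\<^sub>0 'k) set" where
  "radical \<Omega> v t = {x. \<forall>y. the_form \<Omega> v t x y = 0}"


section \<open>The quotient by the radical\<close>

definition falg ::
    "('i::finite \<Rightarrow> 'i \<Rightarrow> int) \<Rightarrow> 'k::field \<Rightarrow> 'k \<Rightarrow> ('k, ('i list \<Rightarrow>\<^sub>0 'k) set) module" where
  "falg \<Omega> v t = free_alg QuotM radical \<Omega> v t"

definition fclass ::
    "('i::finite \<Rightarrow> 'i \<Rightarrow> int) \<Rightarrow> 'k::field \<Rightarrow> 'k \<Rightarrow> ('i list \<Rightarrow>\<^sub>0 'k) \<Rightarrow> ('i list \<Rightarrow>\<^sub>0 'k) set" where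
  "fclass \<Omega> v t x = radical \<Omega> v t +>\<^bsub>free_alg\<^esub> x"

definition ftheta ::
    "('i::finite \<Rightarrow> 'i \<Rightarrow> int) \<Rightarrow> 'k::field \<Rightarrow> 'k \<Rightarrow> 'i \<Rightarrow> ('i list \<Rightarrow>\<^sub>0 'k) set" where
  "ftheta \<Omega> v t i = fclass \<Omega> v t (word [i])"

definition fgrading ::
    "('i::finite \<Rightarrow> 'i \<Rightarrow> int) \<Rightarrow> 'k::field \<Rightarrow> 'k \<Rightarrow> ('i \<Rightarrow> nat) \<Rightarrow> ('i list \<Rightarrow>\<^sub>0 'k) set set" where
  "fgrading \<Omega> v t \<nu> = fclass \<Omega> v t ` {x. \<forall>w\<in>Poly_Mapping.keys x. deg w = \<nu>}"

text \<open>As in \<open>tensor_lift\<close>, \<open>the_elem\<close> extracts the common value on all representatives.\<close>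

definition fcomult ::
    "('i::finite \<Rightarrow> 'i \<Rightarrow> int) \<Rightarrow> 'k::field \<Rightarrow> 'k \<Rightarrow> ('i list \<Rightarrow>\<^sub>0 'k) set
       \<Rightarrow> (('i list \<Rightarrow>\<^sub>0 'k) set \<times> ('i list \<Rightarrow>\<^sub>0 'k) set \<Rightarrow>\<^sub>0 'k) set" where
  "fcomult \<Omega> v t X = (let F = falg \<Omega> v t; T = tensor F F in
     the_elem ((\<lambda>x. \<Oplus>\<^bsub>T\<^esub>p\<in>Poly_Mapping.keys (free_comult \<Omega> v t x).
        Poly_Mapping.lookup (free_comult \<Omega> v t x) p \<odot>\<^bsub>T\<^esub>
          pure F F (fclass \<Omega> v t (word (fst p))) (fclass \<Omega> v t (word (snd p)))) ` X))"


section \<open>The two-parameter algebra, Lusztig's algebra and its deformation\<close>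

type_synonym Qv = "rat poly fract"

text \<open>\<open>\<rat>(v, t)\<close> is realized as the field of rational functions in \<open>t\<close> over \<open>\<rat>(v)\<close>.\<close>

type_synonym Qvt = "rat poly fract poly fract"

definition Qv_v :: Qv where "Qv_v = Fraction_Field.Fract [:0, 1:] 1"

definition Qvt_of :: "Qv \<Rightarrow> Qvt" where "Qvt_of c = Fraction_Field.Fract [:c:] 1"

definition Qvt_v :: Qvt where "Qvt_v = Qvt_of Qv_v"

definition Qvt_t :: Qvt where "Qvt_t = Fraction_Field.Fract [:0, 1:] 1"

definition frak_f :: "('i::finite \<Rightarrow> 'i \<Rightarrow> int) \<Rightarrow> (Qvt, ('i list \<Rightarrow>\<^sub>0 Qvt) set) module" where
  "frak_f \<Omega> = falg \<Omega> Qvt_v Qvt_t"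

definition frak_theta :: "('i::finite \<Rightarrow> 'i \<Rightarrow> int) \<Rightarrow> 'i \<Rightarrow> ('i list \<Rightarrow>\<^sub>0 Qvt) set" where
  "frak_theta \<Omega> = ftheta \<Omega> Qvt_v Qvt_t"

definition frak_r ::
    "('i::finite \<Rightarrow> 'i \<Rightarrow> int) \<Rightarrow> ('i list \<Rightarrow>\<^sub>0 Qvt) set
       \<Rightarrow> (('i list \<Rightarrow>\<^sub>0 Qvt) set \<times> ('i list \<Rightarrow>\<^sub>0 Qvt) set \<Rightarrow>\<^sub>0 Qvt) set" where
  "frak_r \<Omega> = fcomult \<Omega> Qvt_v Qvt_t"

definition lusztig_f :: "('i::finite \<Rightarrow> 'i \<Rightarrow> int) \<Rightarrow> (Qv, ('i list \<Rightarrow>\<^sub>0 Qv) set) module" where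
  "lusztig_f \<Omega> = falg \<Omega> Qv_v 1"

type_synonym 'i fvt = "(('i list \<Rightarrow>\<^sub>0 Qv) set \<times> Qvt \<Rightarrow>\<^sub>0 Qv) set"

definition lusztig_fvt :: "('i::finite \<Rightarrow> 'i \<Rightarrow> int) \<Rightarrow> (Qvt, 'i fvt) module" where
  "lusztig_fvt \<Omega> = ext_alg Qvt_of (lusztig_f \<Omega>)"

definition fvt_theta :: "('i::finite \<Rightarrow> 'i \<Rightarrow> int) \<Rightarrow> 'i \<Rightarrow> 'i fvt" where
  "fvt_theta \<Omega> i = ext_pure Qvt_of (lusztig_f \<Omega>) (ftheta \<Omega> Qv_v 1 i) 1"

definition fvt_grading :: "('i::finite \<Rightarrow> 'i \<Rightarrow> int) \<Rightarrow> ('i \<Rightarrow> nat) \<Rightarrow> 'i fvt set" where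
  "fvt_grading \<Omega> = ext_grading Qvt_of (lusztig_f \<Omega>) (fgrading \<Omega> Qv_v 1)"

definition fvt_tilde_r1 :: "('i::finite \<Rightarrow> 'i \<Rightarrow> int) \<Rightarrow> 'i fvt \<Rightarrow> ('i fvt \<times> 'i fvt \<Rightarrow>\<^sub>0 Qvt) set" where
  "fvt_tilde_r1 \<Omega> = ext_comult Qvt_of (lusztig_f \<Omega>) (fcomult \<Omega> Qv_v 1)"

definition odot :: "('i::finite \<Rightarrow> 'i \<Rightarrow> int) \<Rightarrow> 'i fvt \<Rightarrow> 'i fvt \<Rightarrow> 'i fvt" where
  "odot \<Omega> = graded_rescale (lusztig_fvt \<Omega>) (fvt_grading \<Omega>) (lusztig_fvt \<Omega>)
     (\<lambda>\<mu> \<nu>. Qvt_t powi (bracket \<Omega> (to_Z \<mu>) (to_Z \<nu>))) (\<otimes>\<^bsub>lusztig_fvt \<Omega>\<^esub>)"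

definition deformed_f :: "('i::finite \<Rightarrow> 'i \<Rightarrow> int) \<Rightarrow> (Qvt, 'i fvt) module" where
  "deformed_f \<Omega> = (lusztig_fvt \<Omega>)\<lparr>mult := odot \<Omega>\<rparr>"

definition deformed_r1 :: "('i::finite \<Rightarrow> 'i \<Rightarrow> int) \<Rightarrow> 'i fvt \<Rightarrow> ('i fvt \<times> 'i fvt \<Rightarrow>\<^sub>0 Qvt) set" where
  "deformed_r1 \<Omega> x =
     (let A = lusztig_fvt \<Omega>; T = tensor A A in
        tensor_lift T
          (graded_rescale A (fvt_grading \<Omega>) T
             (\<lambda>\<mu> \<nu>. Qvt_t powi (- bracket \<Omega> (to_Z \<mu>) (to_Z \<nu>))) (pure A A))
          (fvt_tilde_r1 \<Omega> x))"

end

theory Submission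
  imports Defs
begin

text \<open>
  For a word \<open>w = i\<^sub>1 ... i\<^sub>n\<close> let \<open>\<tau> w\<close> be the sum of the \<open>[i\<^sub>a, i\<^sub>b]\<close> over \<open>a < b\<close>. The product of the
  generators along \<open>w\<close> for the deformed multiplication is \<open>t\<close> to the power \<open>\<tau> w\<close> times the
  undeformed one, so the diagonal map \<open>w \<mapsto> t powi \<tau> w \<cdot> w\<close> of the free algebra intertwines the two
  multiplications. As \<open>[i, j] - [j, i] = \<langle>j, i\<rangle> - \<langle>i, j\<rangle>\<close>, it also intertwines the two comultiplications,
  and it pulls the form for \<open>t = 1\<close> back to the form for \<open>t\<close>. Hence it matches the radicals and
  descends to the quotients. Two facts of linear algebra complete the argument: the radical of a
  form commutes with extension of scalars, and the radical of the tensor square of a form is the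
  kernel of the projection to the tensor square of the quotient. Both follow from one criterion
  for the vanishing of a tensor.
\<close>

section \<open>Linear extension from a basis\<close>

text \<open>The statement takes the form by description, so nothing is known about a radical until a
  form has been exhibited and proved unique. It is built by hand on words for \<open>t = 1\<close>,
  by a recursion that peels one letter from the second argument; the rescaling then produces it for
  every nonzero \<open>t\<close>, so the hard part of existence is done only once.

  The rescaling works because words remember the order of their letters: on words the exponent
  \<open>bracket\<close> is a coboundary, which it need not be on degrees. The exponents of
  \<open>t\<close> on the two sides of an identity often agree only where degrees match; elsewhere
  the form vanishes. This is why orthogonality of words of different degrees recurs throughout.

  The two algebras start over different fields. The extended algebra is therefore rewritten as the
  free algebra over the larger field modulo the radical for parameter 1. Source and target are then
  quotients of one and the same free algebra, and the rescaling is an automorphism of its underlying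
  space.\<close>

definition lin_ext ::
    "('k::field \<Rightarrow> 'e::ab_group_add \<Rightarrow> 'e) \<Rightarrow> ('b \<Rightarrow> 'e) \<Rightarrow> ('b \<Rightarrow>\<^sub>0 'k) \<Rightarrow> 'e" where
  "lin_ext s f z = (\<Sum>p\<in>Poly_Mapping.keys z. s (Poly_Mapping.lookup z p) (f p))"

lemma lookup_scale [simp]: "Poly_Mapping.lookup (scale c x) p = c * Poly_Mapping.lookup x p"
  by (simp add: scale_def Poly_Mapping.map.rep_eq when_def)

lemma vector_space_scale: "vector_space scale"
  by unfold_locales (auto intro!: poly_mapping_eqI simp: lookup_add algebra_simps)

interpretation sc: vector_space scale by (rule vector_space_scale)

lemma vector_space_times: "vector_space ((*) :: 'k::field \<Rightarrow> 'k \<Rightarrow> 'k)"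
  by unfold_locales (auto simp: algebra_simps)

lemma scale_single [simp]: "scale c (Poly_Mapping.single p d) = Poly_Mapping.single p (c * d)"
  by (auto intro!: poly_mapping_eqI simp: lookup_single when_def)

lemma keys_scale: "Poly_Mapping.keys (scale c x) \<subseteq> Poly_Mapping.keys x"
  by (auto simp: in_keys_iff)

lemma lin_ext_superset:
  assumes "vector_space s" "finite A" "Poly_Mapping.keys z \<subseteq> A"
  shows "lin_ext s f z = (\<Sum>p\<in>A. s (Poly_Mapping.lookup z p) (f p))"
proof -
  interpret vector_space s by fact
  show ?thesis unfolding lin_ext_def
    by (rule sum.mono_neutral_left) (use assms in \<open>auto simp: in_keys_iff\<close>)
qed

lemma linear_lin_ext:
  assumes "vector_space s"
  shows "Vector_Spaces.linear scale s (lin_ext s f)"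
proof -
  interpret vs: vector_space s by fact
  have add: "lin_ext s f (x + y) = lin_ext s f x + lin_ext s f y" for x y
  proof -
    let ?A = "Poly_Mapping.keys x \<union> Poly_Mapping.keys y"
    have "Poly_Mapping.keys (x + y) \<subseteq> ?A" by (rule keys_add)
    then show ?thesis
      using assms by (simp add: lin_ext_superset[of s ?A] lookup_add vs.scale_left_distrib sum.distrib)
  qed
  have scl: "lin_ext s f (scale c x) = s c (lin_ext s f x)" for c x
    using assms keys_scale[of c x]
    by (simp add: lin_ext_superset[of s "Poly_Mapping.keys x"] vs.scale_sum_right)
  show ?thesis
    by (simp add: Vector_Spaces.linear_iff add scl vector_space_scale assms)
qed

context
  fixes s :: "'k::field \<Rightarrow> 'e::ab_group_add \<Rightarrow> 'e"
  assumes vs: "vector_space s"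
begin

interpretation vs: vector_space s by (rule vs)
interpretation vector_space_pair scale s
  by (simp add: vector_space_pair_def vs vector_space_scale)

lemma lin_ext_add: "lin_ext s f (x + y) = lin_ext s f x + lin_ext s f y"
  by (rule linear_add[OF linear_lin_ext[OF vs]])

lemma lin_ext_diff: "lin_ext s f (x - y) = lin_ext s f x - lin_ext s f y"
  by (rule linear_diff[OF linear_lin_ext[OF vs]])

lemma lin_ext_scale: "lin_ext s f (scale c x) = s c (lin_ext s f x)"
  by (rule linear_scale[OF linear_lin_ext[OF vs]])

lemma lin_ext_sum: "lin_ext s f (sum g A) = (\<Sum>a\<in>A. lin_ext s f (g a))"
  by (rule linear_sum[OF linear_lin_ext[OF vs]])

lemma lin_ext_single: "lin_ext s f (Poly_Mapping.single p c) = s c (f p)"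
  by (cases "c = 0") (simp_all add: lin_ext_def)

lemma lin_ext_fun_add: "lin_ext s (\<lambda>p. f p + g p) z = lin_ext s f z + lin_ext s g z"
  by (simp add: lin_ext_def vs.scale_right_distrib sum.distrib)

lemma lin_ext_fun_scale: "lin_ext s (\<lambda>p. s c (f p)) z = s c (lin_ext s f z)"
  by (simp add: lin_ext_def vs.scale_sum_right mult.commute)

lemma lin_ext_fun_zero: "lin_ext s (\<lambda>p. 0) z = 0"
  by (simp add: lin_ext_def)

lemma lin_ext_fun_sum: "lin_ext s (\<lambda>p. \<Sum>a\<in>A. f a p) z = (\<Sum>a\<in>A. lin_ext s (f a) z)"
  unfolding lin_ext_def vs.scale_sum_right by (rule sum.swap)

lemma lin_ext_swap:
  "lin_ext s (\<lambda>a. lin_ext s (f a) y) x = lin_ext s (\<lambda>b. lin_ext s (\<lambda>a. f a b) x) y"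
  unfolding lin_ext_def vs.scale_sum_right
  by (subst sum.swap) (simp add: mult.commute)

lemma lin_ext_zero: "lin_ext s f 0 = 0"
  by (simp add: lin_ext_def)

end

lemma lin_ext_cong:
  assumes "\<And>p. p \<in> Poly_Mapping.keys z \<Longrightarrow> f p = g p"
  shows "lin_ext s f z = lin_ext s g z"
  using assms by (simp add: lin_ext_def)

lemma lin_ext_linear:
  assumes "Vector_Spaces.linear s1 s2 L"
  shows "L (lin_ext s1 f z) = lin_ext s2 (\<lambda>p. L (f p)) z"
proof -
  interpret Vector_Spaces.linear s1 s2 L by fact
  show ?thesis by (simp add: lin_ext_def sum scale)
qed

lemma lin_ext_unit: "lin_ext scale (\<lambda>p. Poly_Mapping.single p 1) z = z"
proof (rule poly_mapping_eqI)
  fix p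
  have "(\<Sum>q\<in>Poly_Mapping.keys z. Poly_Mapping.lookup z q when q = p) = Poly_Mapping.lookup z p"
    by (cases "p \<in> Poly_Mapping.keys z") (auto simp: when_def in_keys_iff)
  then show "Poly_Mapping.lookup (lin_ext scale (\<lambda>p. Poly_Mapping.single p 1) z) p = Poly_Mapping.lookup z p"
    by (simp add: lin_ext_def lookup_sum lookup_single)
qed

lemma linear_eq_lin_ext:
  assumes "Vector_Spaces.linear scale s L"
  shows "L z = lin_ext s (\<lambda>p. L (Poly_Mapping.single p 1)) z"
  using lin_ext_linear[OF assms, of "\<lambda>p. Poly_Mapping.single p 1" z] by (simp add: lin_ext_unit)

lemma lin_ext_comp:
  assumes "vector_space s"
  shows "lin_ext s f (lin_ext scale g z) = lin_ext s (\<lambda>p. lin_ext s f (g p)) z"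
  by (rule lin_ext_linear[OF linear_lin_ext[OF assms]])

lemma keys_lin_ext:
  "Poly_Mapping.keys (lin_ext scale f z) \<subseteq> (\<Union>p\<in>Poly_Mapping.keys z. Poly_Mapping.keys (f p))"
  unfolding lin_ext_def by (rule order_trans[OF keys_sum]) (intro UN_mono order_refl keys_scale)

lemmas lin_ext_sc = vector_space_scale[THEN lin_ext_add] vector_space_scale[THEN lin_ext_scale]
  vector_space_scale[THEN lin_ext_single] vector_space_scale[THEN lin_ext_fun_zero]

lemmas lin_ext_k = vector_space_times[THEN lin_ext_add] vector_space_times[THEN lin_ext_scale]
  vector_space_times[THEN lin_ext_single] vector_space_times[THEN lin_ext_fun_zero]

section \<open>The operations of the free algebra as linear extensions\<close>

lemma free_mult_lin_ext:
  "free_mult x y = lin_ext scale (\<lambda>u. lin_ext scale (\<lambda>w. word (u @ w)) y) x"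
  by (simp add: free_mult_def lin_ext_def word_def
      sc.scale_sum_right)

lemma free_tensor_lin_ext:
  "free_tensor x y = lin_ext scale (\<lambda>u. lin_ext scale (\<lambda>w. Poly_Mapping.single (u, w) 1) y) x"
  by (simp add: free_tensor_def lin_ext_def
      sc.scale_sum_right)

lemma free_comult_lin_ext: "free_comult \<Omega> v t = lin_ext scale (comult_word \<Omega> v t)"
  by (rule ext) (simp add: free_comult_def lin_ext_def)

lemma tensor_form_lin_ext:
  "tensor_form \<Omega> t B X Y =
     lin_ext (*) (\<lambda>p. lin_ext (*) (\<lambda>q. t powi (2 * bracket \<Omega> (zdeg (fst p)) (zdeg (snd p)))
        * B (word (fst p)) (word (fst q)) * B (word (snd p)) (word (snd q))) Y) X"
  unfolding tensor_form_def lin_ext_def sum_distrib_left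
  by (intro sum.cong refl) (simp add: case_prod_unfold sum_distrib_left algebra_simps)

lemma lin_ext_word: "vector_space s \<Longrightarrow> lin_ext s f (word w) = f w"
  by (simp add: word_def lin_ext_single vector_space.vector_space_assms(4))

lemma free_mult_word [simp]: "free_mult (word u) (word w) = word (u @ w)"
  by (simp add: free_mult_lin_ext lin_ext_word vector_space_scale)

lemma free_tensor_word [simp]: "free_tensor (word u) (word w) = Poly_Mapping.single (u, w) 1"
  by (simp add: free_tensor_lin_ext lin_ext_word vector_space_scale)

lemma free_comult_word [simp]: "free_comult \<Omega> v t (word u) = comult_word \<Omega> v t u"
  by (simp add: free_comult_lin_ext lin_ext_word vector_space_scale)

lemma lin_ext_free_tensor:
  assumes "vector_space s"
  shows "lin_ext s f (free_tensor x y) = lin_ext s (\<lambda>u. lin_ext s (\<lambda>w. f (u, w)) y) x"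
  by (simp add: free_tensor_lin_ext lin_ext_comp assms lin_ext_single vector_space.vector_space_assms(4)[OF assms])

lemma lin_ext_free_mult:
  assumes "vector_space s"
  shows "lin_ext s f (free_mult x y) = lin_ext s (\<lambda>u. lin_ext s (\<lambda>w. f (u @ w)) y) x"
  by (simp add: free_mult_lin_ext lin_ext_comp assms lin_ext_word)

section \<open>Bilinear forms on degrees of words\<close>

lemma zdeg_Nil [simp]: "zdeg [] = (\<lambda>_. 0)"
  by (simp add: to_Z_def deg_def)

lemma zdeg_Cons: "zdeg (i # u) = (\<lambda>j. basis_vec i j + zdeg u j)"
  by (auto simp: to_Z_def deg_def basis_vec_def)

lemma zdeg_single [simp]: "zdeg [i] = basis_vec i"
  by (simp add: zdeg_Cons)

lemma zdeg_append: "zdeg (u @ w) = (\<lambda>j. zdeg u j + zdeg w j)"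
  by (auto simp: to_Z_def deg_def)

lemma angle_add:
  "angle \<Omega> (\<lambda>i. \<mu> i + \<mu>' i) \<nu> = angle \<Omega> \<mu> \<nu> + angle \<Omega> \<mu>' \<nu>"
  "angle \<Omega> \<mu> (\<lambda>i. \<nu> i + \<nu>' i) = angle \<Omega> \<mu> \<nu> + angle \<Omega> \<mu> \<nu>'"
  by (simp_all add: angle_def algebra_simps sum.distrib)

lemma angle_zero [simp]: "angle \<Omega> (\<lambda>_. 0) \<nu> = 0" "angle \<Omega> \<mu> (\<lambda>_. 0) = 0"
  by (simp_all add: angle_def)

lemma bracket_add:
  "bracket \<Omega> (\<lambda>i. \<mu> i + \<mu>' i) \<nu> = bracket \<Omega> \<mu> \<nu> + bracket \<Omega> \<mu>' \<nu>"
  "bracket \<Omega> \<mu> (\<lambda>i. \<nu> i + \<nu>' i) = bracket \<Omega> \<mu> \<nu> + bracket \<Omega> \<mu> \<nu>'"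
proof -
  have "(\<mu> i + \<mu>' i) * \<nu> j * c = \<mu> i * \<nu> j * c + \<mu>' i * \<nu> j * c"
    "\<mu> i * (\<nu> j + \<nu>' j) * c = \<mu> i * \<nu> j * c + \<mu> i * \<nu>' j * c" for i j c
    by (simp_all add: algebra_simps)
  then show
    "bracket \<Omega> (\<lambda>i. \<mu> i + \<mu>' i) \<nu> = bracket \<Omega> \<mu> \<nu> + bracket \<Omega> \<mu>' \<nu>"
    "bracket \<Omega> \<mu> (\<lambda>i. \<nu> i + \<nu>' i) = bracket \<Omega> \<mu> \<nu> + bracket \<Omega> \<mu> \<nu>'"
    by (simp_all only: bracket_def sum.distrib)
qed

lemma bracket_zero [simp]: "bracket \<Omega> (\<lambda>_. 0) \<nu> = 0" "bracket \<Omega> \<mu> (\<lambda>_. 0) = 0"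
  by (simp_all add: bracket_def)

text \<open>The diagonal part of \<open>bracket\<close> is symmetric in the two arguments and
  cancels from the difference. The right-hand side has the shape of the exponent of \<open>t\<close>
  in the twisted multiplication, which is how the deformation by \<open>bracket\<close> can absorb
  it.\<close>

lemma bracket_antisym:
  "bracket \<Omega> \<mu> \<nu> - bracket \<Omega> \<nu> \<mu> = angle \<Omega> \<nu> \<mu> - angle \<Omega> \<mu> \<nu>"
proof -
  define d where "d i j = 2 * (if i = j then \<Omega> i i else 0)" for i j
  have eq: "bracket \<Omega> \<mu> \<nu> = (\<Sum>i\<in>UNIV. \<Sum>j\<in>UNIV. \<mu> i * \<nu> j * d i j) - angle \<Omega> \<mu> \<nu>" for \<mu> \<nu>
    by (simp add: bracket_def angle_def d_def right_diff_distrib sum_subtractf)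
  have "(\<Sum>i\<in>UNIV. \<Sum>j\<in>UNIV. \<mu> i * \<nu> j * d i j) = (\<Sum>i\<in>UNIV. \<Sum>j\<in>UNIV. \<nu> i * \<mu> j * d i j)"
    by (subst sum.swap) (auto intro!: sum.cong simp: d_def)
  then show ?thesis by (simp add: eq)
qed

lemma dot_commute: "dot \<Omega> \<mu> \<nu> = dot \<Omega> \<nu> \<mu>"
  by (simp add: dot_def)

lemma dot_add:
  "dot \<Omega> (\<lambda>i. \<mu> i + \<mu>' i) \<nu> = dot \<Omega> \<mu> \<nu> + dot \<Omega> \<mu>' \<nu>"
  "dot \<Omega> \<mu> (\<lambda>i. \<nu> i + \<nu>' i) = dot \<Omega> \<mu> \<nu> + dot \<Omega> \<mu> \<nu>'"
  by (simp_all add: dot_def angle_add)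

lemma dot_zero [simp]: "dot \<Omega> (\<lambda>_. 0) \<nu> = 0" "dot \<Omega> \<mu> (\<lambda>_. 0) = 0"
  by (simp_all add: dot_def)

primrec tau :: "('i::finite \<Rightarrow> 'i \<Rightarrow> int) \<Rightarrow> 'i list \<Rightarrow> int" where
  "tau \<Omega> [] = 0"
| "tau \<Omega> (i # w) = bracket \<Omega> (basis_vec i) (zdeg w) + tau \<Omega> w"

text \<open>A pair of positions in \<open>u @ w\<close> lies inside \<open>u\<close>, inside
  \<open>w\<close>, or has one member in each; by bilinearity the pairs of the last kind add up to
  one bracket of degrees.\<close>

lemma tau_append: "tau \<Omega> (u @ w) = tau \<Omega> u + tau \<Omega> w + bracket \<Omega> (zdeg u) (zdeg w)"
  by (induction u) (simp_all add: zdeg_Cons zdeg_append bracket_add)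

section \<open>The comultiplication on words\<close>

text \<open>The scalar that arises when \<open>1 \<otimes> \<theta>\<^sub>i\<close> moves past \<open>y \<otimes> 1\<close>.\<close>

definition braid :: "('i::finite \<Rightarrow> 'i \<Rightarrow> int) \<Rightarrow> 'k::field \<Rightarrow> 'k \<Rightarrow> 'i list \<Rightarrow> 'i \<Rightarrow> 'k" where
  "braid \<Omega> v t y i = v powi (- dot \<Omega> (zdeg y) (basis_vec i))
     * t powi (angle \<Omega> (zdeg y) (basis_vec i) - angle \<Omega> (basis_vec i) (zdeg y))"

lemma twisted_mult_lin_ext:
  "twisted_mult \<Omega> v t X Y = lin_ext scale (\<lambda>p. lin_ext scale (\<lambda>q.
     Poly_Mapping.single (fst p @ fst q, snd p @ snd q)
       (v powi (- dot \<Omega> (zdeg (fst q)) (zdeg (snd p)))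
        * t powi (angle \<Omega> (zdeg (fst q)) (zdeg (snd p)) - angle \<Omega> (zdeg (snd p)) (zdeg (fst q))))) Y) X"
  unfolding twisted_mult_def lin_ext_def sc.scale_sum_right
  by (intro sum.cong refl) (simp add: case_prod_unfold algebra_simps)

text \<open>Of the two summands of the coproduct of a letter, only
  \<open>1 \<otimes> \<theta>\<^sub>i\<close> has to pass the first factor of what follows, so only
  it picks up a scalar. This recursion replaces \<open>twisted_mult\<close> in all later inductions
  on words.\<close>

lemma comult_word_Cons:
  "comult_word \<Omega> v t (i # w) = lin_ext scale (\<lambda>p. Poly_Mapping.single (i # fst p, snd p) 1
     + Poly_Mapping.single (fst p, i # snd p) (braid \<Omega> v t (fst p) i)) (comult_word \<Omega> v t w)"
  by (simp add: twisted_mult_lin_ext lin_ext_sc braid_def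
      vector_space_scale[THEN lin_ext_fun_add])

declare comult_word.simps(2) [simp del]

lemma lin_ext_comult_word_Cons:
  assumes "vector_space s"
  shows "lin_ext s f (comult_word \<Omega> v t (i # w)) = lin_ext s (\<lambda>p. f (i # fst p, snd p)
     + s (braid \<Omega> v t (fst p) i) (f (fst p, i # snd p))) (comult_word \<Omega> v t w)"
proof -
  interpret vector_space s by fact
  show ?thesis
    by (simp add: comult_word_Cons lin_ext_comp assms assms[THEN lin_ext_add] assms[THEN lin_ext_single])
qed

lemma deg_comult_word:
  fixes v t :: "'k::field"
  shows "p \<in> Poly_Mapping.keys (comult_word \<Omega> v t u) \<Longrightarrow> deg u = (\<lambda>i. deg (fst p) i + deg (snd p) i)"
proof (induction u arbitrary: p)
  case Nil
  then show ?case by (simp split: if_splits add: deg_def)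
next
  case (Cons i u)
  have "p \<in> (\<Union>q\<in>Poly_Mapping.keys (comult_word \<Omega> v t u).
      Poly_Mapping.keys (Poly_Mapping.single (i # fst q, snd q) (1::'k)
        + Poly_Mapping.single (fst q, i # snd q) (braid \<Omega> v t (fst q) i)))"
    by (rule subsetD[OF keys_lin_ext Cons.prems[unfolded comult_word_Cons]])
  then obtain q where q: "q \<in> Poly_Mapping.keys (comult_word \<Omega> v t u)"
    and "p \<in> Poly_Mapping.keys (Poly_Mapping.single (i # fst q, snd q) (1::'k)
        + Poly_Mapping.single (fst q, i # snd q) (braid \<Omega> v t (fst q) i))"
    by blast
  then have "p = (i # fst q, snd q) \<or> p = (fst q, i # snd q)"
    by (auto dest!: subsetD[OF keys_add] split: if_splits)
  moreover have "deg u = (\<lambda>i. deg (fst q) i + deg (snd q) i)"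
    by (rule Cons.IH[OF q])
  ultimately show ?case by (auto simp: deg_def fun_eq_iff)
qed

lemma zdeg_comult_word:
  "p \<in> Poly_Mapping.keys (comult_word \<Omega> v t u) \<Longrightarrow> zdeg u = (\<lambda>i. zdeg (fst p) i + zdeg (snd p) i)"
  using deg_comult_word[of p \<Omega> v t u] by (auto simp: to_Z_def)

text \<open>Found by solving the intertwining condition for the coefficients: rescaling
  \<open>u\<close> by its \<open>tau\<close>, and both factors of every term \<open>p\<close> by
  theirs, has to turn the coproduct for \<open>t\<close> into the one for 1, weighted by
  \<open>t\<close> to minus the bracket of the two factors.\<close>

definition twist_exp :: "('i::finite \<Rightarrow> 'i \<Rightarrow> int) \<Rightarrow> 'i list \<Rightarrow> 'i list \<times> 'i list \<Rightarrow> int" where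
  "twist_exp \<Omega> u p = tau \<Omega> u - tau \<Omega> (fst p) - tau \<Omega> (snd p) - bracket \<Omega> (zdeg (fst p)) (zdeg (snd p))"

text \<open>By induction on the word. A new letter that joins the first factor leaves the exponent
  unchanged. One that joins the second factor changes it by a difference of two brackets, which by
  \<open>bracket_antisym\<close> is the exponent of \<open>t\<close> in
  \<open>braid\<close>.\<close>

lemma comult_word_twist:
  assumes t: "t \<noteq> 0"
  shows "comult_word \<Omega> v t u =
    lin_ext scale (\<lambda>p. Poly_Mapping.single p (t powi twist_exp \<Omega> u p)) (comult_word \<Omega> v 1 u)"
proof (induction u)
  case Nil
  then show ?case by (simp add: lin_ext_sc twist_exp_def)
next
  case (Cons i u)
  let ?C = "comult_word \<Omega> v 1 u"
  have "comult_word \<Omega> v t (i # u) = lin_ext scale (\<lambda>p. scale (t powi twist_exp \<Omega> u p)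
     (Poly_Mapping.single (i # fst p, snd p) 1
      + Poly_Mapping.single (fst p, i # snd p) (braid \<Omega> v t (fst p) i))) ?C"
    by (subst comult_word_Cons, subst Cons.IH)
      (simp add: lin_ext_comp vector_space_scale lin_ext_sc)
  also have "\<dots> = lin_ext scale (\<lambda>p.
      Poly_Mapping.single (i # fst p, snd p) (t powi twist_exp \<Omega> (i # u) (i # fst p, snd p))
      + scale (braid \<Omega> v 1 (fst p) i)
         (Poly_Mapping.single (fst p, i # snd p) (t powi twist_exp \<Omega> (i # u) (fst p, i # snd p)))) ?C"
  proof (rule lin_ext_cong)
    fix p assume p: "p \<in> Poly_Mapping.keys ?C"
    note z = zdeg_comult_word[OF p]
    have e1: "twist_exp \<Omega> (i # u) (i # fst p, snd p) = twist_exp \<Omega> u p"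
      by (simp add: twist_exp_def z bracket_add zdeg_Cons)
    have e2: "twist_exp \<Omega> (i # u) (fst p, i # snd p) = twist_exp \<Omega> u p +
        (angle \<Omega> (zdeg (fst p)) (basis_vec i) - angle \<Omega> (basis_vec i) (zdeg (fst p)))"
      using bracket_antisym[of \<Omega> "basis_vec i" "zdeg (fst p)"]
      by (simp add: twist_exp_def z bracket_add zdeg_Cons)
    show "scale (t powi twist_exp \<Omega> u p)
     (Poly_Mapping.single (i # fst p, snd p) 1
      + Poly_Mapping.single (fst p, i # snd p) (braid \<Omega> v t (fst p) i)) =
      Poly_Mapping.single (i # fst p, snd p) (t powi twist_exp \<Omega> (i # u) (i # fst p, snd p))
      + scale (braid \<Omega> v 1 (fst p) i)
         (Poly_Mapping.single (fst p, i # snd p) (t powi twist_exp \<Omega> (i # u) (fst p, i # snd p)))"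
      using t by (simp add: e1 e2 power_int_add sc.scale_right_distrib braid_def mult_ac)
  qed
  also have "\<dots> = lin_ext scale (\<lambda>p. Poly_Mapping.single p (t powi twist_exp \<Omega> (i # u) p))
      (comult_word \<Omega> v 1 (i # u))"
    by (subst lin_ext_comult_word_Cons[OF vector_space_scale]) (rule refl)
  finally show ?case .
qed

section \<open>Lusztig's form on words\<close>

text \<open>\<open>skew j u\<close> is the second factor of the part of the comultiplication of \<open>u\<close> (for \<open>t = 1\<close>)
  whose first factor is \<open>\<theta>\<^sub>j\<close>.\<close>

primrec skew :: "('i::finite \<Rightarrow> 'i \<Rightarrow> int) \<Rightarrow> 'k::field \<Rightarrow> 'i \<Rightarrow> 'i list \<Rightarrow> ('i list \<Rightarrow>\<^sub>0 'k)" where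
  "skew \<Omega> v j [] = 0"
| "skew \<Omega> v j (i # u) = (if i = j then word u else 0)
     + scale (v powi (- dot \<Omega> (basis_vec i) (basis_vec j)))
         (lin_ext scale (\<lambda>a. word (i # a)) (skew \<Omega> v j u))"

definition theta_norm :: "('i::finite \<Rightarrow> 'i \<Rightarrow> int) \<Rightarrow> 'k::field \<Rightarrow> 'i \<Rightarrow> 'k" where
  "theta_norm \<Omega> v j = inverse (1 - v_at \<Omega> v j powi (-2))"

text \<open>The recursion is forced by \<open>(u, \<theta>\<^sub>j w) = (r(u), \<theta>\<^sub>j
  \<otimes> w)\<close>: a letter has to be orthogonal to every other word, so only the terms of
  \<open>r(u)\<close> with first factor \<open>\<theta>\<^sub>j\<close> survive, and
  \<open>skew\<close> collects them. Symmetry is lost in this definition and has to be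
  recovered.\<close>

fun word_form :: "('i::finite \<Rightarrow> 'i \<Rightarrow> int) \<Rightarrow> 'k::field \<Rightarrow> 'i list \<Rightarrow> 'i list \<Rightarrow> 'k" where
  "word_form \<Omega> v u [] = (if u = [] then 1 else 0)"
| "word_form \<Omega> v u (j # w) =
     theta_norm \<Omega> v j * lin_ext (*) (\<lambda>a. word_form \<Omega> v a w) (skew \<Omega> v j u)"

lemma deg_skew:
  fixes v :: "'k::field"
  shows "a \<in> Poly_Mapping.keys (skew \<Omega> v j u) \<Longrightarrow> deg u = deg (j # a)"
proof (induction u arbitrary: a)
  case Nil
  then show ?case by simp
next
  case (Cons i u)
  let ?D = "lin_ext scale (\<lambda>a. word (i # a)) (skew \<Omega> v j u)"
  from Cons.prems have "a \<in> Poly_Mapping.keys (if i = j then word u else (0 :: _ \<Rightarrow>\<^sub>0 'k)) \<or>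
      a \<in> Poly_Mapping.keys ?D"
    unfolding skew.simps by (auto dest!: subsetD[OF keys_add] subsetD[OF keys_scale])
  then consider "i = j" "a = u" | b where "b \<in> Poly_Mapping.keys (skew \<Omega> v j u)" "a = i # b"
    by (auto dest!: subsetD[OF keys_lin_ext] simp: word_def split: if_splits)
  then show ?case
  proof cases
    case 2
    from Cons.IH[OF 2(1)] show ?thesis by (auto simp: 2 deg_def fun_eq_iff)
  qed simp
qed

lemma length_eq_sum_deg: "length u = (\<Sum>i\<in>UNIV. deg u (i::'i::finite))"
  unfolding deg_def by (rule sum_count_set[symmetric]) auto

lemma length_skew: "a \<in> Poly_Mapping.keys (skew \<Omega> v j u) \<Longrightarrow> length u = Suc (length a)"
  using deg_skew[of a \<Omega> v j u] length_eq_sum_deg[of u] length_eq_sum_deg[of "j # a"] by simp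

lemma word_form_eq_0: "deg u \<noteq> deg w \<Longrightarrow> word_form \<Omega> v u w = 0"
proof (induction w arbitrary: u)
  case Nil
  then show ?case by auto
next
  case (Cons j w)
  have "lin_ext (*) (\<lambda>a. word_form \<Omega> v a w) (skew \<Omega> v j u) = lin_ext (*) (\<lambda>a. 0) (skew \<Omega> v j u)"
  proof (rule lin_ext_cong)
    fix a assume "a \<in> Poly_Mapping.keys (skew \<Omega> v j u)"
    from deg_skew[OF this] Cons.prems have "deg a \<noteq> deg w"
      by (auto simp: deg_def fun_eq_iff split: if_splits)
    then show "word_form \<Omega> v a w = 0" by (rule Cons.IH)
  qed
  then show ?case by (simp add: lin_ext_k)
qed

lemma lin_ext_skew_Cons:
  assumes "vector_space s"
  shows "lin_ext s f (skew \<Omega> v j (i # u)) = (if i = j then f u else 0)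
    + s (v powi (- dot \<Omega> (basis_vec i) (basis_vec j))) (lin_ext s (\<lambda>a. f (i # a)) (skew \<Omega> v j u))"
  by (simp add: lin_ext_add lin_ext_scale lin_ext_comp lin_ext_word lin_ext_zero assms)

text \<open>Peeling a letter from both words gives a diagonal term, present when the letters agree,
  and a cross term in which each letter is extracted from the rest of the other word. Both are
  symmetric, the cross term because \<open>dot\<close> is. The induction is on the total length
  because \<open>skew\<close> returns combinations of words that are not suffixes of the given
  one.\<close>

lemma word_form_commute: "word_form \<Omega> v u w = word_form \<Omega> v w u"
proof (induction "length u + length w" arbitrary: u w rule: less_induct)
  case less
  show ?case
  proof (cases u)
    case Nil
    then show ?thesis by (cases w) (simp_all add: lin_ext_def)
  next
    case u: (Cons i u')
    show ?thesis
    proof (cases w)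
      case Nil
      with u show ?thesis by (simp add: lin_ext_def)
    next
      case w: (Cons j w')
      let ?q = "v powi (- dot \<Omega> (basis_vec i) (basis_vec j))"
      \<comment> \<open>Both expansions reduce to this double sum; extracting \<open>j\<close> on
        one side and \<open>i\<close> on the other can be done in either order.\<close>
      let ?D = "lin_ext (*) (\<lambda>a. lin_ext (*) (\<lambda>b. word_form \<Omega> v a b) (skew \<Omega> v i w')) (skew \<Omega> v j u')"
      have "lin_ext (*) (\<lambda>a. word_form \<Omega> v (i # a) w') (skew \<Omega> v j u')
          = lin_ext (*) (\<lambda>a. theta_norm \<Omega> v i * lin_ext (*) (\<lambda>b. word_form \<Omega> v a b) (skew \<Omega> v i w'))
              (skew \<Omega> v j u')"
      proof (rule lin_ext_cong)
        fix a assume a: "a \<in> Poly_Mapping.keys (skew \<Omega> v j u')"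
        have "word_form \<Omega> v (i # a) w' = word_form \<Omega> v w' (i # a)"
          using length_skew[OF a] by (intro less) (simp add: u w)
        also have "\<dots> = theta_norm \<Omega> v i * lin_ext (*) (\<lambda>b. word_form \<Omega> v a b) (skew \<Omega> v i w')"
        proof -
          have "word_form \<Omega> v b a = word_form \<Omega> v a b" if b: "b \<in> Poly_Mapping.keys (skew \<Omega> v i w')" for b
            using length_skew[OF a] length_skew[OF b] by (intro less) (simp add: u w)
          then show ?thesis by (simp cong: lin_ext_cong)
        qed
        finally show "word_form \<Omega> v (i # a) w' = \<dots>" .
      qed
      then have L: "lin_ext (*) (\<lambda>a. word_form \<Omega> v (i # a) w') (skew \<Omega> v j u') = theta_norm \<Omega> v i * ?D"
        by (simp add: lin_ext_fun_scale[OF vector_space_times])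
      have "lin_ext (*) (\<lambda>b. word_form \<Omega> v (j # b) u') (skew \<Omega> v i w')
          = lin_ext (*) (\<lambda>b. theta_norm \<Omega> v j * lin_ext (*) (\<lambda>a. word_form \<Omega> v a b) (skew \<Omega> v j u'))
              (skew \<Omega> v i w')"
      proof (rule lin_ext_cong)
        fix b assume b: "b \<in> Poly_Mapping.keys (skew \<Omega> v i w')"
        have "word_form \<Omega> v (j # b) u' = word_form \<Omega> v u' (j # b)"
          using length_skew[OF b] by (intro less) (simp add: u w)
        then show "word_form \<Omega> v (j # b) u'
            = theta_norm \<Omega> v j * lin_ext (*) (\<lambda>a. word_form \<Omega> v a b) (skew \<Omega> v j u')"
          by simp
      qed
      then have R: "lin_ext (*) (\<lambda>b. word_form \<Omega> v (j # b) u') (skew \<Omega> v i w') = theta_norm \<Omega> v j * ?D"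
        by (simp add: lin_ext_fun_scale[OF vector_space_times]
            lin_ext_swap[OF vector_space_times, of _ "skew \<Omega> v j u'" "skew \<Omega> v i w'"])
      have "word_form \<Omega> v u w = theta_norm \<Omega> v j * ((if i = j then word_form \<Omega> v u' w' else 0)
          + ?q * (theta_norm \<Omega> v i * ?D))"
        by (simp only: u w word_form.simps lin_ext_skew_Cons[OF vector_space_times] L)
      moreover have "word_form \<Omega> v w u = theta_norm \<Omega> v i * ((if i = j then word_form \<Omega> v w' u' else 0)
          + ?q * (theta_norm \<Omega> v j * ?D))"
        by (simp only: u w word_form.simps lin_ext_skew_Cons[OF vector_space_times] R
            dot_commute[of \<Omega> "basis_vec j"] eq_commute[of j i])
      moreover have "word_form \<Omega> v u' w' = word_form \<Omega> v w' u'"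
        by (rule less) (simp add: u w)
      ultimately show ?thesis by (simp add: algebra_simps)
    qed
  qed
qed

lemma braid_Cons:
  assumes "v \<noteq> 0"
  shows "braid \<Omega> v 1 (j # a) i = v powi (- dot \<Omega> (basis_vec j) (basis_vec i)) * braid \<Omega> v 1 a i"
  using assms by (simp add: braid_def zdeg_Cons dot_add power_int_add[symmetric])

lemma braid_Nil [simp]: "braid \<Omega> v t [] i = 1"
  by (simp add: braid_def)

lemma zdeg_cong: "deg a = deg b \<Longrightarrow> zdeg a = zdeg b"
  by simp

text \<open>An instance of coassociativity, tested against an arbitrary functional \<open>f\<close>:
  of the threefold coproduct only the terms with leftmost factor \<open>\<theta>\<^sub>j\<close> are
  kept. Extracting \<open>j\<close> and then splitting the rest agrees with splitting first and
  extracting \<open>j\<close> from the first factor.\<close>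

lemma skew_comult_word:
  fixes v :: "'k::field"
  assumes v: "v \<noteq> 0"
  shows "lin_ext (*) (\<lambda>a. lin_ext (*) f (comult_word \<Omega> v 1 a)) (skew \<Omega> v j u)
    = lin_ext (*) (\<lambda>p. lin_ext (*) (\<lambda>a. f (a, snd p)) (skew \<Omega> v j (fst p))) (comult_word \<Omega> v 1 u)"
proof (induction u arbitrary: f)
  case Nil
  then show ?case by (simp add: lin_ext_k lin_ext_zero[OF vector_space_times])
next
  case (Cons i u)
  let ?q = "v powi (- dot \<Omega> (basis_vec i) (basis_vec j))"
  let ?C = "comult_word \<Omega> v 1"
  let ?S = "skew \<Omega> v j"
  note kadd = lin_ext_fun_add[OF vector_space_times] and kscale = lin_ext_fun_scale[OF vector_space_times]
  note CC = lin_ext_comult_word_Cons[OF vector_space_times]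
  have "lin_ext (*) (\<lambda>a. lin_ext (*) f (?C a)) (?S (i # u))
     = (if i = j then lin_ext (*) f (?C u) else 0)
       + ?q * lin_ext (*) (\<lambda>a. lin_ext (*) f (?C (i # a))) (?S u)"
    by (rule lin_ext_skew_Cons[OF vector_space_times])
  also have "lin_ext (*) (\<lambda>a. lin_ext (*) f (?C (i # a))) (?S u)
     = lin_ext (*) (\<lambda>p. lin_ext (*) (\<lambda>a. f (i # a, snd p) + braid \<Omega> v 1 a i * f (a, i # snd p))
         (?S (fst p))) (?C u)"
    by (simp add: CC Cons.IH)
  also have "(if i = j then lin_ext (*) f (?C u) else 0) + ?q * \<dots>
     = lin_ext (*) (\<lambda>p. (if i = j then f p else 0) + ?q * (lin_ext (*) (\<lambda>a. f (i # a, snd p) + braid \<Omega> v 1 a i * f (a, i # snd p))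
         (?S (fst p)))) (?C u)"
    by (simp add: kadd kscale lin_ext_k)
  also have "\<dots> = lin_ext (*) (\<lambda>p. lin_ext (*) (\<lambda>a. f (a, snd p)) (?S (i # fst p))
      + braid \<Omega> v 1 (fst p) i * lin_ext (*) (\<lambda>a. f (a, i # snd p)) (?S (fst p))) (?C u)"
  proof (rule lin_ext_cong)
    fix p
    have "?q * lin_ext (*) (\<lambda>a. braid \<Omega> v 1 a i * f (a, i # snd p)) (?S (fst p))
        = lin_ext (*) (\<lambda>a. ?q * (braid \<Omega> v 1 a i * f (a, i # snd p))) (?S (fst p))"
      by (simp add: kscale)
    also have "\<dots> = lin_ext (*) (\<lambda>a. braid \<Omega> v 1 (fst p) i * f (a, i # snd p)) (?S (fst p))"
    proof (rule lin_ext_cong)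
      fix a assume "a \<in> Poly_Mapping.keys (?S (fst p))"
      \<comment> \<open>\<open>braid\<close> sees only the degree, so \<open>fst p\<close> may be
        replaced by \<open>j # a\<close>. The factor \<open>?q\<close> supplied by
        \<open>skew\<close> is exactly the cost of moving \<open>i\<close> past the extra letter
        \<open>j\<close>.\<close>
      from zdeg_cong[OF deg_skew[OF this]]
      have "braid \<Omega> v 1 (fst p) i = braid \<Omega> v 1 (j # a) i"
        by (simp add: braid_def)
      then show "?q * (braid \<Omega> v 1 a i * f (a, i # snd p)) = braid \<Omega> v 1 (fst p) i * f (a, i # snd p)"
        by (simp add: braid_Cons[OF v] dot_commute[of \<Omega> "basis_vec i"])
    qed
    also have "\<dots> = braid \<Omega> v 1 (fst p) i * lin_ext (*) (\<lambda>a. f (a, i # snd p)) (?S (fst p))"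
      by (simp add: kscale)
    finally show "(if i = j then f p else 0) + ?q * (lin_ext (*) (\<lambda>a. f (i # a, snd p) + braid \<Omega> v 1 a i * f (a, i # snd p)) (?S (fst p)))
      = lin_ext (*) (\<lambda>a. f (a, snd p)) (?S (i # fst p))
      + braid \<Omega> v 1 (fst p) i * lin_ext (*) (\<lambda>a. f (a, i # snd p)) (?S (fst p))"
      by (simp add: kadd lin_ext_skew_Cons[OF vector_space_times] distrib_left del: skew.simps)
  qed
  also have "\<dots> = lin_ext (*) (\<lambda>p. lin_ext (*) (\<lambda>a. f (a, snd p)) (?S (fst p))) (?C (i # u))"
    by (simp add: CC)
  finally show ?case .
qed

text \<open>The counit law for the first factor: a letter that joins the first factor makes it
  nonempty and kills the term, and a letter that passes an empty first factor costs no
  scalar.\<close>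

lemma comult_word_counit:
  "lin_ext (*) (\<lambda>p. (if fst p = [] then 1 else 0) * f (snd p)) (comult_word \<Omega> v t u) = f u"
proof (induction u arbitrary: f)
  case Nil
  then show ?case by (simp add: lin_ext_k)
next
  case (Cons i u)
  have "lin_ext (*) (\<lambda>p. (if fst p = [] then 1 else 0) * f (snd p)) (comult_word \<Omega> v t (i # u))
      = lin_ext (*) (\<lambda>p. (if fst p = [] then 1 else 0) * f (i # snd p)) (comult_word \<Omega> v t u)"
    unfolding lin_ext_comult_word_Cons[OF vector_space_times] by (rule lin_ext_cong) auto
  then show ?case by (simp only: Cons.IH[of "\<lambda>w. f (i # w)"])
qed

text \<open>For parameter 1 this is the multiplicativity axiom of the form on words, the weight of
  the tensor form being 1. In the induction on \<open>y\<close> the leading letter is extracted from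
  \<open>u\<close>, and \<open>skew_comult_word\<close> moves the extraction into the first factor,
  where the recursion reassembles \<open>j # y\<close>. The empty word is the counit law.\<close>

lemma word_form_append:
  assumes v: "v \<noteq> 0"
  shows "word_form \<Omega> v u (y @ z) =
    lin_ext (*) (\<lambda>p. word_form \<Omega> v (fst p) y * word_form \<Omega> v (snd p) z) (comult_word \<Omega> v 1 u)"
proof (induction y arbitrary: u)
  case Nil
  then show ?case by (simp add: comult_word_counit[of "\<lambda>w. word_form \<Omega> v w z"])
next
  case (Cons j y)
  have "word_form \<Omega> v u ((j # y) @ z) = theta_norm \<Omega> v j *
     lin_ext (*) (\<lambda>a. lin_ext (*) (\<lambda>p. word_form \<Omega> v (fst p) y * word_form \<Omega> v (snd p) z)
       (comult_word \<Omega> v 1 a)) (skew \<Omega> v j u)"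
    by (simp add: Cons.IH)
  also have "\<dots> = theta_norm \<Omega> v j * lin_ext (*) (\<lambda>p. lin_ext (*)
      (\<lambda>a. word_form \<Omega> v (snd p) z * word_form \<Omega> v a y) (skew \<Omega> v j (fst p))) (comult_word \<Omega> v 1 u)"
    by (simp add: skew_comult_word[OF v] mult.commute)
  also have "\<dots> = lin_ext (*) (\<lambda>p. theta_norm \<Omega> v j * (word_form \<Omega> v (snd p) z *
      lin_ext (*) (\<lambda>a. word_form \<Omega> v a y) (skew \<Omega> v j (fst p)))) (comult_word \<Omega> v 1 u)"
    by (simp only: lin_ext_fun_scale[OF vector_space_times])
  finally show ?case by (simp add: mult_ac)
qed

section \<open>The bilinear form\<close>

text \<open>The form for parameters \<open>(v, t)\<close> is the form for \<open>(v, 1)\<close> pulled back along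
  \<open>w \<mapsto> t powi tau w \<cdot> w\<close>.\<close>

definition twisted_form ::
    "('i::finite \<Rightarrow> 'i \<Rightarrow> int) \<Rightarrow> 'k::field \<Rightarrow> 'k \<Rightarrow> 'i list \<Rightarrow> 'i list \<Rightarrow> 'k" where
  "twisted_form \<Omega> v t u w = t powi (tau \<Omega> u + tau \<Omega> w) * word_form \<Omega> v u w"

definition explicit_form ::
    "('i::finite \<Rightarrow> 'i \<Rightarrow> int) \<Rightarrow> 'k::field \<Rightarrow> 'k \<Rightarrow> ('i list \<Rightarrow>\<^sub>0 'k) \<Rightarrow> ('i list \<Rightarrow>\<^sub>0 'k) \<Rightarrow> 'k" where
  "explicit_form \<Omega> v t x y = lin_ext (*) (\<lambda>u. lin_ext (*) (twisted_form \<Omega> v t u) y) x"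

lemma explicit_form_word [simp]:
  "explicit_form \<Omega> v t (word u) (word w) = twisted_form \<Omega> v t u w"
  by (simp add: explicit_form_def lin_ext_word vector_space_times)

lemma twisted_form_commute: "twisted_form \<Omega> v t u w = twisted_form \<Omega> v t w u"
  by (simp add: twisted_form_def word_form_commute[of \<Omega> v u] add.commute)

lemma twisted_form_eq_0: "deg u \<noteq> deg w \<Longrightarrow> twisted_form \<Omega> v t u w = 0"
  by (simp add: twisted_form_def word_form_eq_0)

text \<open>Explains the weight of the tensor form: one copy of the bracket comes from
  \<open>tau\<close> of the concatenation \<open>y @ z\<close>, the other from \<open>tau u\<close>
  through the exponent that relates the two coproducts.\<close>

lemma twisted_form_append:
  assumes "v \<noteq> 0" "t \<noteq> 0"
  shows "twisted_form \<Omega> v t u (y @ z) = lin_ext (*) (\<lambda>p. t powi (2 * bracket \<Omega> (zdeg (fst p)) (zdeg (snd p)))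
     * twisted_form \<Omega> v t (fst p) y * twisted_form \<Omega> v t (snd p) z) (comult_word \<Omega> v t u)"
proof -
  have "twisted_form \<Omega> v t u (y @ z) = lin_ext (*) (\<lambda>p. t powi (tau \<Omega> u + tau \<Omega> (y @ z)) *
     (word_form \<Omega> v (fst p) y * word_form \<Omega> v (snd p) z)) (comult_word \<Omega> v 1 u)"
    by (simp only: twisted_form_def word_form_append[OF assms(1)] lin_ext_fun_scale[OF vector_space_times])
  also have "\<dots> = lin_ext (*) (\<lambda>p. t powi twist_exp \<Omega> u p * (t powi (2 * bracket \<Omega> (zdeg (fst p)) (zdeg (snd p)))
     * twisted_form \<Omega> v t (fst p) y * twisted_form \<Omega> v t (snd p) z)) (comult_word \<Omega> v 1 u)"
  proof (rule lin_ext_cong)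
    fix p
    \<comment> \<open>The exponents agree only when the two factors of \<open>p\<close> have the
      degrees of \<open>y\<close> and \<open>z\<close>. Otherwise one of the values of
      \<open>word_form\<close> is zero on both sides.\<close>
    show "t powi (tau \<Omega> u + tau \<Omega> (y @ z)) * (word_form \<Omega> v (fst p) y * word_form \<Omega> v (snd p) z)
      = t powi twist_exp \<Omega> u p * (t powi (2 * bracket \<Omega> (zdeg (fst p)) (zdeg (snd p)))
     * twisted_form \<Omega> v t (fst p) y * twisted_form \<Omega> v t (snd p) z)"
    proof (cases "deg (fst p) = deg y \<and> deg (snd p) = deg z")
      case True
      then have z: "zdeg (fst p) = zdeg y" "zdeg (snd p) = zdeg z" by simp_all
      have "tau \<Omega> u + tau \<Omega> (y @ z) = twist_exp \<Omega> u p + 2 * bracket \<Omega> (zdeg (fst p)) (zdeg (snd p))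
         + (tau \<Omega> (fst p) + tau \<Omega> y) + (tau \<Omega> (snd p) + tau \<Omega> z)"
        by (simp add: twist_exp_def tau_append z)
      moreover have "t powi (m + n) = t powi m * t powi n" for m n
        using assms(2) by (simp add: power_int_add)
      ultimately show ?thesis
        by (simp only: twisted_form_def mult_ac)
    qed (auto simp: twisted_form_def word_form_eq_0)
  qed
  also have "\<dots> = lin_ext (*) (\<lambda>p. t powi (2 * bracket \<Omega> (zdeg (fst p)) (zdeg (snd p)))
     * twisted_form \<Omega> v t (fst p) y * twisted_form \<Omega> v t (snd p) z) (comult_word \<Omega> v t u)"
    by (subst comult_word_twist[OF assms(2)])
      (simp add: lin_ext_comp[OF vector_space_times] lin_ext_k)
  finally show ?thesis .
qed

lemma explicit_form_commute: "explicit_form \<Omega> v t x y = explicit_form \<Omega> v t y x"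
  unfolding explicit_form_def
  by (subst lin_ext_swap[OF vector_space_times]) (simp add: twisted_form_commute[of \<Omega> v t])

text \<open>The weight in \<open>tensor_form\<close> reads off the degrees of the left argument
  only. Nonzero terms pair factors of equal degrees, so it could equally be read off the right
  one.\<close>

lemma tensor_form_explicit_commute:
  "tensor_form \<Omega> t (explicit_form \<Omega> v t) X Y = tensor_form \<Omega> t (explicit_form \<Omega> v t) Y X"
proof -
  have "t powi (2 * bracket \<Omega> (zdeg (fst p)) (zdeg (snd p)))
      * twisted_form \<Omega> v t (fst p) (fst q) * twisted_form \<Omega> v t (snd p) (snd q)
    = t powi (2 * bracket \<Omega> (zdeg (fst q)) (zdeg (snd q)))
      * twisted_form \<Omega> v t (fst q) (fst p) * twisted_form \<Omega> v t (snd q) (snd p)" for p q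
  proof (cases "deg (fst p) = deg (fst q) \<and> deg (snd p) = deg (snd q)")
    case True
    then show ?thesis by (simp add: twisted_form_commute[of \<Omega> v t "fst p"] twisted_form_commute[of \<Omega> v t "snd p"])
  qed (metis mult_zero_left mult_zero_right twisted_form_eq_0)
  then show ?thesis
    unfolding tensor_form_lin_ext explicit_form_word
    by (subst lin_ext_swap[OF vector_space_times]) (simp only:)
qed

lemma explicit_form_free_mult:
  assumes "v \<noteq> 0" "t \<noteq> 0"
  shows "explicit_form \<Omega> v t x (free_mult y z)
    = tensor_form \<Omega> t (explicit_form \<Omega> v t) (free_comult \<Omega> v t x) (free_tensor y z)"
proof -
  let ?g = "\<lambda>p a b. t powi (2 * bracket \<Omega> (zdeg (fst p)) (zdeg (snd p)))
     * twisted_form \<Omega> v t (fst p) a * twisted_form \<Omega> v t (snd p) b"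
  note k = vector_space_times
  have "explicit_form \<Omega> v t x (free_mult y z) = lin_ext (*) (\<lambda>u. lin_ext (*) (\<lambda>a. lin_ext (*)
      (\<lambda>b. lin_ext (*) (\<lambda>p. ?g p a b) (comult_word \<Omega> v t u)) z) y) x"
    by (simp add: explicit_form_def lin_ext_free_mult[OF k] twisted_form_append[OF assms])
  also have "\<dots> = lin_ext (*) (\<lambda>u. lin_ext (*) (\<lambda>a. lin_ext (*)
      (\<lambda>p. lin_ext (*) (\<lambda>b. ?g p a b) z) (comult_word \<Omega> v t u)) y) x"
    by (subst lin_ext_swap[OF k]) (rule refl)
  also have "\<dots> = lin_ext (*) (\<lambda>u. lin_ext (*) (\<lambda>p. lin_ext (*)
      (\<lambda>a. lin_ext (*) (\<lambda>b. ?g p a b) z) y) (comult_word \<Omega> v t u)) x"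
    by (subst lin_ext_swap[OF k]) (rule refl)
  finally show ?thesis
    by (simp add: tensor_form_lin_ext free_comult_lin_ext lin_ext_comp[OF k] lin_ext_free_tensor[OF k])
qed

text \<open>Existence of the form. Of the two multiplicativity axioms only the one for the second
  argument needs an argument; the other follows by symmetry of the form and of its tensor
  square.\<close>

lemma is_form_explicit:
  assumes "v \<noteq> 0" "t \<noteq> 0"
  shows "is_form \<Omega> v t (explicit_form \<Omega> v t)"
proof -
  have l: "Vector_Spaces.linear scale (*) (\<lambda>x. explicit_form \<Omega> v t x y)" for y
    unfolding explicit_form_def by (rule linear_lin_ext[OF vector_space_times])
  have r: "Vector_Spaces.linear scale (*) (explicit_form \<Omega> v t y)" for y
    using l[of y] by (simp add: explicit_form_commute[of \<Omega> v t y, abs_def])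
  have m: "explicit_form \<Omega> v t (free_mult x x') y
     = tensor_form \<Omega> t (explicit_form \<Omega> v t) (free_tensor x x') (free_comult \<Omega> v t y)" for x x' y
    by (simp add: explicit_form_commute[of \<Omega> v t _ y] explicit_form_free_mult[OF assms]
        tensor_form_explicit_commute[of \<Omega> t v "free_tensor x x'"])
  have g: "word_form \<Omega> v [i] [j] = (if i = j then theta_norm \<Omega> v j else 0)" for i j
    by (simp add: lin_ext_word[OF vector_space_times] lin_ext_k lin_ext_zero[OF vector_space_times] lin_ext_zero[OF vector_space_scale])
  show ?thesis
    unfolding is_form_def
    by (intro conjI allI; (rule l r explicit_form_commute explicit_form_free_mult[OF assms] m
        | simp add: twisted_form_def g theta_norm_def del: word_form.simps(2)))
qed

text \<open>Peeling the first letter of the second argument leaves pairings of arbitrary words with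
  a single letter. Peeling the first argument in turn reduces these to the prescribed values on
  generators and to the orthogonality of generators to 1, which is not among the axioms and is
  derived from them.\<close>

lemma is_form_eq_on_words:
  assumes B: "is_form \<Omega> v t B" and B': "is_form \<Omega> v t B'"
  shows "B (word u) (word w) = B' (word u) (word w)"
proof -
  have split: "C (word u) (word (i # w)) = tensor_form \<Omega> t C (comult_word \<Omega> v t u) (Poly_Mapping.single ([i], w) 1)"
    and split': "C (word (i # u)) (word w) = tensor_form \<Omega> t C (Poly_Mapping.single ([i], u) 1) (comult_word \<Omega> v t w)"
    and unit: "C (word []) (word []) = 1"
    and gen: "C (word [i]) (word [j]) = (if i = j then theta_norm \<Omega> v i else 0)"
    if "is_form \<Omega> v t C" for C u w i j
    using that unfolding is_form_def theta_norm_def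
    by (metis free_comult_word free_tensor_word free_mult_word append_Cons append_Nil)+
  note tf = tensor_form_lin_ext lin_ext_k lin_ext_comult_word_Cons[OF vector_space_times]
  \<comment> \<open>Since \<open>1 = 1 \<cdot> 1\<close>, pairing
    \<open>\<theta>\<^sub>i \<otimes> 1 + 1 \<otimes> \<theta>\<^sub>i\<close> with
    \<open>1 \<otimes> 1\<close> gives the value twice; a scalar equal to its double is
    zero.\<close>
  have Nil1: "C (word [i]) (word []) = 0" if C: "is_form \<Omega> v t C" for C i
  proof -
    have "C (word [i]) (free_mult (word []) (word []))
        = tensor_form \<Omega> t C (comult_word \<Omega> v t [i]) (Poly_Mapping.single ([], []) 1)"
      using C unfolding is_form_def by (metis free_comult_word free_tensor_word)
    then have "C (word [i]) (word []) = C (word [i]) (word []) + C (word [i]) (word [])"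
      by (simp add: tf unit[OF C] braid_def)
    then show ?thesis by (simp only: add_cancel_right_right)
  qed
  have Nil2: "C (word u) (word []) = (if u = [] then 1 else 0)" if C: "is_form \<Omega> v t C" for C u
  proof (cases u)
    case (Cons i u')
    then show ?thesis
      using split'[OF C, of i u' "[]"] by (simp add: tf Nil1[OF C])
  qed (simp add: unit[OF C])
  \<comment> \<open>Against the coproduct of the letter \<open>j\<close>, the word
    \<open>i # u'\<close> gives two terms. One contains the pairing of \<open>i\<close> with 1 and
    vanishes; the other requires \<open>u'\<close> to be empty.\<close>
  have gen2: "C (word u) (word [j]) = (if u = [j] then theta_norm \<Omega> v j else 0)" if C: "is_form \<Omega> v t C" for C u j
  proof (cases u)
    case Nil
    then show ?thesis
      using Nil1[OF C, of j] C unfolding is_form_def by auto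
  next
    case (Cons i u')
    then show ?thesis
      using split'[OF C, of i u' "[j]"] by (auto simp: tf Nil2[OF C] gen[OF C] braid_def)
  qed
  show ?thesis
  proof (induction w arbitrary: u)
    case Nil
    then show ?case by (simp add: Nil2[OF B] Nil2[OF B'])
  next
    case (Cons j w)
    then show ?case
      using split[OF B, of u j w] split[OF B', of u j w]
      by (simp add: tensor_form_lin_ext lin_ext_k gen2[OF B] gen2[OF B'])
  qed
qed

lemma is_form_unique:
  assumes B: "is_form \<Omega> v t B" and B': "is_form \<Omega> v t B'"
  shows "B = B'"
proof (intro ext)
  fix x y
  have lin: "Vector_Spaces.linear scale (*) (\<lambda>x. C x y)" "Vector_Spaces.linear scale (*) (C x)"
    if "is_form \<Omega> v t C" for C x y
    using that unfolding is_form_def by simp_all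
  have exp: "C x y = lin_ext (*) (\<lambda>u. lin_ext (*) (\<lambda>w. C (word u) (word w)) y) x"
    if C: "is_form \<Omega> v t C" for C
    unfolding word_def linear_eq_lin_ext[OF lin(2)[OF C], symmetric]
    by (rule linear_eq_lin_ext[OF lin(1)[OF C]])
  show "B x y = B' x y"
    unfolding exp[OF B] exp[OF B'] is_form_eq_on_words[OF B B'] ..
qed

lemma the_form_eq:
  assumes "v \<noteq> 0" "t \<noteq> 0"
  shows "the_form \<Omega> v t = explicit_form \<Omega> v t"
  unfolding the_form_def using is_form_explicit[OF assms] is_form_unique by blast

section \<open>The radical\<close>

text \<open>Testing against words suffices by linearity. Membership becomes the vanishing of a
  family of linear functionals indexed by words, the shape in which the vanishing criterion for
  tensors can use it.\<close>

lemma radical_iff: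
  assumes "v \<noteq> 0" "t \<noteq> 0"
  shows "x \<in> radical \<Omega> v t \<longleftrightarrow> (\<forall>w. lin_ext (*) (\<lambda>u. twisted_form \<Omega> v t u w) x = 0)"
proof -
  have eq: "explicit_form \<Omega> v t x y = lin_ext (*) (\<lambda>w. lin_ext (*) (\<lambda>u. twisted_form \<Omega> v t u w) x) y" for y
    unfolding explicit_form_def by (rule lin_ext_swap[OF vector_space_times])
  then have "explicit_form \<Omega> v t x (word w) = lin_ext (*) (\<lambda>u. twisted_form \<Omega> v t u w) x" for w
    by (simp add: lin_ext_word vector_space_times)
  moreover have "explicit_form \<Omega> v t x y = 0"
    if "\<forall>w. lin_ext (*) (\<lambda>u. twisted_form \<Omega> v t u w) x = 0" for y
    using that by (simp add: eq lin_ext_k)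
  ultimately show ?thesis by (auto simp: radical_def the_form_eq[OF assms])
qed

lemma subspace_radical:
  assumes "v \<noteq> 0" "t \<noteq> 0"
  shows "sc.subspace (radical \<Omega> v t)"
  by (auto simp: sc.subspace_def radical_iff[OF assms] lin_ext_k lin_ext_zero[OF vector_space_times])

text \<open>By symmetry the product is moved to the second argument and the coproduct of the test
  word \<open>w\<close> is expanded. After interchanging sums, every term contains the pairing of
  \<open>x\<close> with a word.\<close>

lemma radical_ideal:
  assumes vt: "v \<noteq> 0" "t \<noteq> 0" and x: "x \<in> radical \<Omega> v t"
  shows "free_mult x y \<in> radical \<Omega> v t" "free_mult y x \<in> radical \<Omega> v t"
proof -
  note k = vector_space_times
  let ?T = "twisted_form \<Omega> v t"
  let ?c = "\<lambda>p. t powi (2 * bracket \<Omega> (zdeg (fst p)) (zdeg (snd p)))"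
  have x0: "lin_ext (*) (\<lambda>u. ?T w u) x = 0" for w
    using x by (simp add: radical_iff[OF vt] twisted_form_commute[of \<Omega> v t w])
  have "lin_ext (*) (\<lambda>u. ?T u w) (free_mult x y) = 0" for w
  proof -
    have "lin_ext (*) (\<lambda>u. ?T u w) (free_mult x y)
       = lin_ext (*) (\<lambda>b. lin_ext (*) (\<lambda>a. ?T w (a @ b)) x) y"
      unfolding lin_ext_free_mult[OF k] twisted_form_commute[of \<Omega> v t _ w] by (rule lin_ext_swap[OF k])
    also have "\<dots> = lin_ext (*) (\<lambda>b. lin_ext (*) (\<lambda>p. lin_ext (*) (\<lambda>a. ?c p * ?T (snd p) b * ?T (fst p) a) x)
        (comult_word \<Omega> v t w)) y"
      unfolding twisted_form_append[OF vt] by (subst lin_ext_swap[OF k]) (simp only: mult_ac)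
    also have "\<dots> = 0"
      by (simp only: lin_ext_fun_scale[OF k] x0 mult_zero_right lin_ext_fun_zero[OF k])
    finally show ?thesis .
  qed
  then show "free_mult x y \<in> radical \<Omega> v t" by (simp add: radical_iff[OF vt])
  have "lin_ext (*) (\<lambda>u. ?T u w) (free_mult y x) = 0" for w
  proof -
    have "lin_ext (*) (\<lambda>u. ?T u w) (free_mult y x)
       = lin_ext (*) (\<lambda>a. lin_ext (*) (\<lambda>b. ?T w (a @ b)) x) y"
      unfolding lin_ext_free_mult[OF k] twisted_form_commute[of \<Omega> v t _ w] ..
    also have "\<dots> = lin_ext (*) (\<lambda>a. lin_ext (*) (\<lambda>p. lin_ext (*) (\<lambda>b. ?c p * ?T (fst p) a * ?T (snd p) b) x)
        (comult_word \<Omega> v t w)) y"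
      unfolding twisted_form_append[OF vt] by (subst lin_ext_swap[OF k]) (simp only: mult_ac)
    also have "\<dots> = 0"
      by (simp only: lin_ext_fun_scale[OF k] x0 mult_zero_right lin_ext_fun_zero[OF k])
    finally show ?thesis .
  qed
  then show "free_mult y x \<in> radical \<Omega> v t" by (simp add: radical_iff[OF vt])
qed

definition hpart :: "('i \<Rightarrow> nat) \<Rightarrow> ('i list \<Rightarrow>\<^sub>0 'k::field) \<Rightarrow> ('i list \<Rightarrow>\<^sub>0 'k)" where
  "hpart \<nu> = lin_ext scale (\<lambda>w. if deg w = \<nu> then word w else 0)"

text \<open>Words of different degrees are orthogonal, so pairing the part of degree
  \<open>\<nu>\<close> with a word gives either the pairing with all of \<open>x\<close> or zero. It
  is this that makes homogeneous components in the quotient unique.\<close>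

lemma hpart_radical:
  assumes vt: "v \<noteq> 0" "t \<noteq> 0" and x: "x \<in> radical \<Omega> v t"
  shows "hpart \<nu> x \<in> radical \<Omega> v t"
proof -
  have "lin_ext (*) (\<lambda>u. twisted_form \<Omega> v t u w) (hpart \<nu> x) = 0" for w
  proof -
    have "lin_ext (*) (\<lambda>u. twisted_form \<Omega> v t u w) (hpart \<nu> x)
        = lin_ext (*) (\<lambda>u. (if deg w = \<nu> then 1 else 0) * twisted_form \<Omega> v t u w) x"
      unfolding hpart_def lin_ext_comp[OF vector_space_times]
      by (intro lin_ext_cong)
        (auto simp: lin_ext_word vector_space_times lin_ext_zero[OF vector_space_times] twisted_form_eq_0)
    also have "\<dots> = 0"
      using x by (simp only: lin_ext_fun_scale[OF vector_space_times]) (simp add: radical_iff[OF vt])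
    finally show ?thesis .
  qed
  then show ?thesis by (simp add: radical_iff[OF vt])
qed

definition twist :: "('i::finite \<Rightarrow> 'i \<Rightarrow> int) \<Rightarrow> 'k::field \<Rightarrow> ('i list \<Rightarrow>\<^sub>0 'k) \<Rightarrow> ('i list \<Rightarrow>\<^sub>0 'k)" where
  "twist \<Omega> t = lin_ext scale (\<lambda>w. Poly_Mapping.single w (t powi tau \<Omega> w))"

text \<open>Pairing with a fixed word \<open>w\<close> changes under the rescaling by the nonzero
  factor \<open>t powi tau \<Omega> w\<close> only, which does not affect vanishing.\<close>

lemma radical_twist:
  assumes vt: "v \<noteq> 0" "t \<noteq> 0"
  shows "twist \<Omega> t x \<in> radical \<Omega> v 1 \<longleftrightarrow> x \<in> radical \<Omega> v t"
proof -
  have "lin_ext (*) (\<lambda>u. twisted_form \<Omega> v t u w) x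
      = t powi tau \<Omega> w * lin_ext (*) (\<lambda>u. twisted_form \<Omega> v 1 u w) (twist \<Omega> t x)" for w
  proof -
    have "twisted_form \<Omega> v t u w = t powi tau \<Omega> w * (t powi tau \<Omega> u * twisted_form \<Omega> v 1 u w)" for u
      using vt by (simp add: twisted_form_def power_int_add)
    then show ?thesis
      by (simp add: twist_def lin_ext_comp[OF vector_space_times] lin_ext_k lin_ext_fun_scale[OF vector_space_times])
  qed
  then show ?thesis using vt by (simp add: radical_iff)
qed

text \<open>Pairing \<open>x\<close> with \<open>y @ z\<close> gives the weighted pairing of its
  coproduct with \<open>y\<close> and \<open>z\<close>. In every nonzero term the weight is
  determined by the degrees of \<open>y\<close> and \<open>z\<close>, so it is a common nonzero
  factor and can be cancelled.\<close>

lemma radical_comult: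
  assumes vt: "v \<noteq> 0" "t \<noteq> 0" and x: "x \<in> radical \<Omega> v t"
  shows "lin_ext (*) (\<lambda>p. twisted_form \<Omega> v t (fst p) y * twisted_form \<Omega> v t (snd p) z) (free_comult \<Omega> v t x) = 0"
proof -
  let ?T = "twisted_form \<Omega> v t"
  let ?e = "t powi (2 * bracket \<Omega> (zdeg y) (zdeg z))"
  note k = vector_space_times
  have eq: "t powi (2 * bracket \<Omega> (zdeg (fst p)) (zdeg (snd p))) * ?T (fst p) y * ?T (snd p) z
      = ?e * (?T (fst p) y * ?T (snd p) z)" for p
    by (cases "deg (fst p) = deg y \<and> deg (snd p) = deg z") (auto simp: twisted_form_eq_0)
  have "0 = lin_ext (*) (\<lambda>u. ?T u (y @ z)) x"
    using x by (simp add: radical_iff[OF vt])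
  also have "\<dots> = ?e * lin_ext (*) (\<lambda>p. ?T (fst p) y * ?T (snd p) z) (free_comult \<Omega> v t x)"
    by (simp add: twisted_form_append[OF vt] eq free_comult_lin_ext lin_ext_comp[OF k] lin_ext_fun_scale[OF k])
  finally show ?thesis using vt by simp
qed

section \<open>Module records presented by vector space types\<close>

text \<open>The spaces of the statement are records whose elements are cosets. A linear surjection \<open>q\<close>
  from a vector space that is a type moves all computations to representatives.\<close>

locale presents =
  fixes s :: "'k::field \<Rightarrow> 'e::ab_group_add \<Rightarrow> 'e" and q :: "'e \<Rightarrow> 'u"
    and U :: "('k, 'u, 'm) module_scheme"
  assumes vs: "vector_space s"
    and carrier: "carrier U = range q"
    and add: "q x \<oplus>\<^bsub>U\<^esub> q y = q (x + y)"
    and zero: "\<zero>\<^bsub>U\<^esub> = q 0"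
    and smult: "c \<odot>\<^bsub>U\<^esub> q x = q (s c x)"
begin

sublocale vs: vector_space s by (rule vs)

lemma abelian_monoid: "abelian_monoid U"
  by (rule abelian_monoidI) (auto simp: carrier add zero add_ac)

sublocale mon: abelian_monoid U by (rule abelian_monoid)

lemma finsum_q: "(\<Oplus>\<^bsub>U\<^esub>a\<in>A. q (f a)) = q (sum f A)"
proof (induction A rule: infinite_finite_induct)
  case (insert a A)
  then show ?case by (simp add: mon.finsum_insert carrier add)
qed (simp_all add: zero)

lemma q_eq_iff: "q x = q y \<longleftrightarrow> q (x - y) = q 0"
proof
  assume "q x = q y"
  then have "q x \<oplus>\<^bsub>U\<^esub> q (- y) = q y \<oplus>\<^bsub>U\<^esub> q (- y)" by simp
  then show "q (x - y) = q 0" by (simp add: add)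
next
  assume "q (x - y) = q 0"
  then have "q (x - y) \<oplus>\<^bsub>U\<^esub> q y = q 0 \<oplus>\<^bsub>U\<^esub> q y" by simp
  then show "q x = q y" by (simp add: add)
qed

lemma subspace_kernel: "vs.subspace {x. q x = q 0}"
proof (unfold vs.subspace_def, intro conjI ballI allI)
  fix x y assume "x \<in> {x. q x = q 0}" "y \<in> {x. q x = q 0}"
  then have "q x \<oplus>\<^bsub>U\<^esub> q y = q 0 \<oplus>\<^bsub>U\<^esub> q 0" by simp
  then show "x + y \<in> {x. q x = q 0}" by (simp add: add)
next
  fix c x assume "x \<in> {x. q x = q 0}"
  then have "c \<odot>\<^bsub>U\<^esub> q x = c \<odot>\<^bsub>U\<^esub> q 0" by simp
  then show "s c x \<in> {x. q x = q 0}" by (simp add: smult)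
qed simp

lemma q_sum_cong:
  assumes "\<And>p. p \<in> A \<Longrightarrow> q (f p) = q (g p)"
  shows "q (sum f A) = q (sum g A)"
proof -
  have "(\<Oplus>\<^bsub>U\<^esub>p\<in>A. q (f p)) = (\<Oplus>\<^bsub>U\<^esub>p\<in>A. q (g p))"
    using assms by (intro mon.finsum_cong) (auto simp: carrier simp_implies_def)
  then show ?thesis by (simp add: finsum_q)
qed

end

section \<open>Cosets of a subspace and the quotient record\<close>

definition coset :: "'e::plus set \<Rightarrow> 'e \<Rightarrow> 'e set" where
  "coset N x = (\<lambda>h. h + x) ` N"

lemma a_r_coset_eq: "add M = (+) \<Longrightarrow> N +>\<^bsub>M\<^esub> x = coset N x"
  by (auto simp: a_r_coset_def' coset_def)

context vector_space
begin

lemma mem_coset_iff: "subspace N \<Longrightarrow> y \<in> coset N x \<longleftrightarrow> y - x \<in> N"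
  by (force simp: coset_def)

lemma mem_coset_self: "subspace N \<Longrightarrow> x \<in> coset N x"
  by (simp add: mem_coset_iff subspace_0)

lemma coset_eq_iff: "subspace N \<Longrightarrow> coset N x = coset N y \<longleftrightarrow> x - y \<in> N"
proof
  assume N: "subspace N" and "coset N x = coset N y"
  then show "x - y \<in> N" using mem_coset_self[OF N, of x] mem_coset_iff[OF N] by simp
next
  assume N: "subspace N" and xy: "x - y \<in> N"
  have "z - x \<in> N \<longleftrightarrow> z - y \<in> N" for z
    using subspace_add[OF N _ xy, of "z - x"] subspace_diff[OF N _ xy, of "z - y"]
    by (auto simp: algebra_simps)
  then show "coset N x = coset N y" by (auto simp: mem_coset_iff[OF N])
qed

lemma coset_add:
  assumes "subspace N" "add M = (+)"
  shows "coset N x <+>\<^bsub>M\<^esub> coset N y = coset N (x + y)"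
proof -
  have "\<exists>a b. h + (x + y) = (a + x) + (b + y) \<and> a \<in> N \<and> b \<in> N" if "h \<in> N" for h
    using that subspace_0[OF assms(1)] by (intro exI[of _ h] exI[of _ 0]) (simp add: algebra_simps)
  moreover have "(a + x) + (b + y) = (a + b) + (x + y)" for a b by (simp add: algebra_simps)
  ultimately show ?thesis
    using subspace_add[OF assms(1)]
    by (fastforce simp: set_add_def' coset_def assms(2) image_iff)
qed

lemma coset_smult:
  assumes "subspace N"
  shows "(\<Union>y\<in>coset N x. coset N (c *s y)) = coset N (c *s x)"
proof -
  have "coset N (c *s y) = coset N (c *s x)" if "y \<in> coset N x" for y
    using that subspace_scale[OF assms, of "y - x" c]
    by (simp add: mem_coset_iff[OF assms] coset_eq_iff[OF assms] scale_right_diff_distrib)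
  moreover have "coset N x \<noteq> {}" using mem_coset_self[OF assms, of x] by blast
  ultimately show ?thesis by (intro SUP_eq_const)
qed

end

lemma QuotM_simps [simp]:
  "carrier (M QuotM N) = a_rcosets\<^bsub>M\<^esub> N"
  "mult (M QuotM N) = rcoset_mult M N"
  "one (M QuotM N) = N +>\<^bsub>M\<^esub> \<one>\<^bsub>M\<^esub>"
  "zero (M QuotM N) = N"
  "add (M QuotM N) = set_add M"
  "smult (M QuotM N) = (\<lambda>c X. \<Union>x\<in>X. N +>\<^bsub>M\<^esub> (c \<odot>\<^bsub>M\<^esub> x))"
  by (simp_all add: quot_space_def ring.defs module.defs FactRing_def)

lemma coset_zero: "coset N (0::'e::ab_group_add) = N"
  by (simp add: coset_def)

section \<open>Tensor products\<close>

lemma free_space_simps [simp]: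
  "carrier (free_space S) = {z. Poly_Mapping.keys z \<subseteq> S}"
  "add (free_space S) = (+)" "zero (free_space S) = 0" "smult (free_space S) = scale"
  by (simp_all add: free_space_def)

abbreviation pr :: "'a \<Rightarrow> 'b \<Rightarrow> ('a \<times> 'b \<Rightarrow>\<^sub>0 'k::field)" where
  "pr x y \<equiv> Poly_Mapping.single (x, y) 1"

definition bilinear_on ::
    "('k::field, 'a, 'm) module_scheme \<Rightarrow> ('k, 'b, 'n) module_scheme \<Rightarrow> ('k, 'u, 'o) module_scheme
       \<Rightarrow> ('a \<Rightarrow> 'b \<Rightarrow> 'u) \<Rightarrow> bool" where
  "bilinear_on V W U \<beta> \<longleftrightarrow>
     (\<forall>x\<in>carrier V. \<forall>y\<in>carrier W. \<beta> x y \<in> carrier U) \<and>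
     (\<forall>x\<in>carrier V. \<forall>x'\<in>carrier V. \<forall>y\<in>carrier W. \<beta> (x \<oplus>\<^bsub>V\<^esub> x') y = \<beta> x y \<oplus>\<^bsub>U\<^esub> \<beta> x' y) \<and>
     (\<forall>x\<in>carrier V. \<forall>y\<in>carrier W. \<forall>y'\<in>carrier W. \<beta> x (y \<oplus>\<^bsub>W\<^esub> y') = \<beta> x y \<oplus>\<^bsub>U\<^esub> \<beta> x y') \<and>
     (\<forall>c. \<forall>x\<in>carrier V. \<forall>y\<in>carrier W. \<beta> (c \<odot>\<^bsub>V\<^esub> x) y = c \<odot>\<^bsub>U\<^esub> \<beta> x y) \<and>
     (\<forall>c. \<forall>x\<in>carrier V. \<forall>y\<in>carrier W. \<beta> x (c \<odot>\<^bsub>W\<^esub> y) = c \<odot>\<^bsub>U\<^esub> \<beta> x y)"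

locale tensor_pair =
  V: presents sV qV V + W: presents sW qW W
  for sV :: "'k::field \<Rightarrow> 'e::ab_group_add \<Rightarrow> 'e" and qV :: "'e \<Rightarrow> 'a" and V :: "('k, 'a, 'm) module_scheme"
    and sW :: "'k \<Rightarrow> 'f::ab_group_add \<Rightarrow> 'f" and qW :: "'f \<Rightarrow> 'b" and W :: "('k, 'b, 'n) module_scheme"
begin

abbreviation "S \<equiv> carrier V \<times> carrier W"
abbreviation "K \<equiv> tensor_kernel V W"
abbreviation "T \<equiv> tensor V W"
abbreviation "cs \<equiv> coset K"

lemma subspace_supp: "sc.subspace {z. Poly_Mapping.keys z \<subseteq> A}"
  unfolding sc.subspace_def by (auto dest!: subsetD[OF keys_add] subsetD[OF keys_scale])

lemma subspace_K: "sc.subspace K"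
  by (simp add: tensor_kernel_def)

lemma closed:
  "x \<in> carrier V \<Longrightarrow> x' \<in> carrier V \<Longrightarrow> x \<oplus>\<^bsub>V\<^esub> x' \<in> carrier V"
  "x \<in> carrier V \<Longrightarrow> c \<odot>\<^bsub>V\<^esub> x \<in> carrier V"
  "y \<in> carrier W \<Longrightarrow> y' \<in> carrier W \<Longrightarrow> y \<oplus>\<^bsub>W\<^esub> y' \<in> carrier W"
  "y \<in> carrier W \<Longrightarrow> c \<odot>\<^bsub>W\<^esub> y \<in> carrier W"
  by (auto simp: V.carrier W.carrier V.add W.add V.smult W.smult)

lemma relators_supp: "tensor_relators V W \<subseteq> {z. Poly_Mapping.keys z \<subseteq> S}"
proof -
  define Z where "Z = {z :: 'a \<times> 'b \<Rightarrow>\<^sub>0 'k. Poly_Mapping.keys z \<subseteq> S}"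
  have "sc.subspace Z" unfolding Z_def by (rule subspace_supp)
  note diff = sc.subspace_diff[OF this]
  have "Poly_Mapping.single (x, y) c \<in> Z" if "x \<in> carrier V" "y \<in> carrier W" for x y c
    using that by (simp add: Z_def)
  then show ?thesis
    unfolding tensor_relators_def Z_def[symmetric] by (auto intro!: diff simp: closed)
qed

text \<open>Needed because a tensor is a full coset: all its representatives stay supported on pairs
  of carrier elements, the only place where a bilinear map is controlled.\<close>

lemma K_supp: "K \<subseteq> {z. Poly_Mapping.keys z \<subseteq> S}"
  unfolding tensor_kernel_def by (rule sc.span_minimal[OF relators_supp subspace_supp])

lemma
  shows tensor_carrier: "carrier T = cs ` {z. Poly_Mapping.keys z \<subseteq> S}"
    and tensor_add: "cs x \<oplus>\<^bsub>T\<^esub> cs y = cs (x + y)"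
    and tensor_zero: "\<zero>\<^bsub>T\<^esub> = cs 0"
    and tensor_smult: "c \<odot>\<^bsub>T\<^esub> cs x = cs (scale c x)"
  by (simp_all add: tensor_def sc.coset_add subspace_K sc.coset_smult a_r_coset_eq coset_zero A_RCOSETS_def')
    (auto simp: a_r_coset_eq)

lemma pure_eq: "pure V W x y = cs (pr x y)"
  by (simp add: pure_def a_r_coset_eq)

lemma cs_eq_iff: "cs x = cs y \<longleftrightarrow> x - y \<in> K"
  by (rule sc.coset_eq_iff[OF subspace_K])

lemma
  shows pr_add_left: "cs (pr (qV (x + x')) (qW y)) = cs (pr (qV x) (qW y) + pr (qV x') (qW y))"
    and pr_add_right: "cs (pr (qV x) (qW (y + y'))) = cs (pr (qV x) (qW y) + pr (qV x) (qW y'))"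
    and pr_scale_left: "cs (pr (qV (sV c x)) (qW y)) = cs (scale c (pr (qV x) (qW y)))"
    and pr_scale_right: "cs (pr (qV x) (qW (sW c y))) = cs (scale c (pr (qV x) (qW y)))"
proof -
  have r: "z \<in> K" if "z \<in> tensor_relators V W" for z
    using that by (simp add: tensor_kernel_def sc.span_base)
  have c: "qV x \<in> carrier V" "qW y \<in> carrier W" for x y
    by (simp_all add: V.carrier W.carrier)
  note [intro] = c
  show "cs (pr (qV (x + x')) (qW y)) = cs (pr (qV x) (qW y) + pr (qV x') (qW y))"
    unfolding cs_eq_iff V.add[symmetric] diff_diff_add[symmetric]
    by (rule r, unfold tensor_relators_def, intro UnI1) blast
  show "cs (pr (qV x) (qW (y + y'))) = cs (pr (qV x) (qW y) + pr (qV x) (qW y'))"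
    unfolding cs_eq_iff W.add[symmetric] diff_diff_add[symmetric]
    by (rule r, unfold tensor_relators_def, rule UnI1, rule UnI1, rule UnI2) blast
  show "cs (pr (qV (sV c x)) (qW y)) = cs (scale c (pr (qV x) (qW y)))"
    unfolding cs_eq_iff V.smult[symmetric] scale_single mult_1_right
    by (rule r, unfold tensor_relators_def, rule UnI1, rule UnI2) blast
  show "cs (pr (qV x) (qW (sW c y))) = cs (scale c (pr (qV x) (qW y)))"
    unfolding cs_eq_iff W.smult[symmetric] scale_single mult_1_right
    by (rule r, unfold tensor_relators_def, rule UnI2) blast
qed

text \<open>The universal property of the tensor product. The combinations whose value represents
  zero form a subspace; bilinearity puts the relators into it, hence also their span, so the value
  is constant on cosets and \<open>the_elem\<close> finds it. The function \<open>b\<close> chooses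
  representatives of the values of \<open>\<beta>\<close>, so that the extension can be computed in
  a vector space that is a type.\<close>

lemma lift_coset:
  assumes U: "presents s q U" and \<beta>: "bilinear_on V W U \<beta>"
    and b: "\<And>x y. q (b (qV x) (qW y)) = \<beta> (qV x) (qW y)"
    and z: "Poly_Mapping.keys z \<subseteq> S"
  shows "tensor_lift U \<beta> (cs z) = q (lin_ext s (\<lambda>p. b (fst p) (snd p)) z)"
proof -
  interpret U: presents s q U by (rule U)
  let ?L = "lin_ext s (\<lambda>p. b (fst p) (snd p))"
  interpret L: Vector_Spaces.linear scale s ?L by (rule linear_lin_ext[OF U.vs])
  have \<beta>q: "\<beta> x y = q (b x y)" if "x \<in> carrier V" "y \<in> carrier W" for x y
    using that by (auto simp: V.carrier W.carrier b)
  have ev: "(\<Oplus>\<^bsub>U\<^esub>p\<in>Poly_Mapping.keys z. Poly_Mapping.lookup z p \<odot>\<^bsub>U\<^esub> \<beta> (fst p) (snd p)) = q (?L z)"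
    if "Poly_Mapping.keys z \<subseteq> S" for z
  proof -
    have "(\<Oplus>\<^bsub>U\<^esub>p\<in>Poly_Mapping.keys z. Poly_Mapping.lookup z p \<odot>\<^bsub>U\<^esub> \<beta> (fst p) (snd p))
      = (\<Oplus>\<^bsub>U\<^esub>p\<in>Poly_Mapping.keys z. q (s (Poly_Mapping.lookup z p) (b (fst p) (snd p))))"
      using that by (intro U.mon.finsum_cong) (auto simp: simp_implies_def U.carrier U.smult \<beta>q)
    then show ?thesis by (simp add: U.finsum_q lin_ext_def)
  qed
  let ?N = "{z. q (?L z) = q 0}"
  have sub: "sc.subspace ?N"
    using L.subspace_linear_preimage[OF U.subspace_kernel] by simp
  have Ls: "?L (Poly_Mapping.single p c) = s c (b (fst p) (snd p))" for p c
    by (rule lin_ext_single[OF U.vs])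
  have "tensor_relators V W \<subseteq> ?N"
  proof -
    have "q (b (x \<oplus>\<^bsub>V\<^esub> x') y - b x y - b x' y) = q 0" if "x \<in> carrier V" "x' \<in> carrier V" "y \<in> carrier W" for x x' y
    proof -
      have "q (b (x \<oplus>\<^bsub>V\<^esub> x') y) = q (b x y + b x' y)"
        using \<beta> that closed unfolding bilinear_on_def by (simp add: \<beta>q U.add[symmetric])
      then show ?thesis by (simp add: U.q_eq_iff[of "b (x \<oplus>\<^bsub>V\<^esub> x') y"] diff_diff_add)
    qed
    moreover have "q (b x (y \<oplus>\<^bsub>W\<^esub> y') - b x y - b x y') = q 0" if "x \<in> carrier V" "y \<in> carrier W" "y' \<in> carrier W" for x y y'
    proof -
      have "q (b x (y \<oplus>\<^bsub>W\<^esub> y')) = q (b x y + b x y')"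
        using \<beta> that closed unfolding bilinear_on_def by (simp add: \<beta>q U.add[symmetric])
      then show ?thesis by (simp add: U.q_eq_iff[of "b x (y \<oplus>\<^bsub>W\<^esub> y')"] diff_diff_add)
    qed
    moreover have "q (b (c \<odot>\<^bsub>V\<^esub> x) y - s c (b x y)) = q 0" if "x \<in> carrier V" "y \<in> carrier W" for c x y
    proof -
      have "q (b (c \<odot>\<^bsub>V\<^esub> x) y) = q (s c (b x y))"
        using \<beta> that closed unfolding bilinear_on_def by (simp add: \<beta>q U.smult[symmetric])
      then show ?thesis by (simp add: U.q_eq_iff[of "b (c \<odot>\<^bsub>V\<^esub> x) y"])
    qed
    moreover have "q (b x (c \<odot>\<^bsub>W\<^esub> y) - s c (b x y)) = q 0" if "x \<in> carrier V" "y \<in> carrier W" for c x y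
    proof -
      have "q (b x (c \<odot>\<^bsub>W\<^esub> y)) = q (s c (b x y))"
        using \<beta> that closed unfolding bilinear_on_def by (simp add: \<beta>q U.smult[symmetric])
      then show ?thesis by (simp add: U.q_eq_iff[of "b x (c \<odot>\<^bsub>W\<^esub> y)"])
    qed
    ultimately show ?thesis
      unfolding tensor_relators_def by (auto simp: L.diff Ls)
  qed
  then have KN: "K \<subseteq> ?N" unfolding tensor_kernel_def by (rule sc.span_minimal[OF _ sub])
  have "(\<Oplus>\<^bsub>U\<^esub>p\<in>Poly_Mapping.keys x. Poly_Mapping.lookup x p \<odot>\<^bsub>U\<^esub> \<beta> (fst p) (snd p)) = q (?L z)"
    if x: "x \<in> cs z" for x
  proof -
    have d: "x - z \<in> K" using x by (simp add: sc.mem_coset_iff[OF subspace_K])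
    then have "Poly_Mapping.keys (x - z + z) \<subseteq> S"
      using K_supp z keys_add[of "x - z" z] by blast
    then have "Poly_Mapping.keys x \<subseteq> S" by simp
    moreover have "q (?L x) = q (?L z)"
      using d KN by (subst U.q_eq_iff) (auto simp: L.diff)
    ultimately show ?thesis by (simp add: ev)
  qed
  then have "(\<lambda>x. \<Oplus>\<^bsub>U\<^esub>p\<in>Poly_Mapping.keys x. Poly_Mapping.lookup x p \<odot>\<^bsub>U\<^esub> \<beta> (fst p) (snd p)) ` cs z
      = (\<lambda>x. q (?L z)) ` cs z"
    by (intro image_cong) auto
  moreover have "cs z \<noteq> {}" using sc.mem_coset_self[OF subspace_K, of z] by blast
  ultimately show ?thesis unfolding tensor_lift_def by (simp add: image_constant_conv)
qed

lemma cs_sum_cong: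
  assumes "\<And>a. a \<in> A \<Longrightarrow> cs (f a) = cs (g a)"
  shows "cs (sum f A) = cs (sum g A)"
  using assms unfolding cs_eq_iff sum_subtractf[symmetric] by (rule sc.subspace_sum[OF subspace_K])

lemma cs_scale_cong: "cs x = cs y \<Longrightarrow> cs (scale c x) = cs (scale c y)"
  unfolding cs_eq_iff sc.scale_right_diff_distrib[symmetric] by (rule sc.subspace_scale[OF subspace_K])

lemma cs_add_cong: "cs x = cs y \<Longrightarrow> cs x' = cs y' \<Longrightarrow> cs (x + x') = cs (y + y')"
  by (metis tensor_add)

lemma keys_pr_sum:
  "Poly_Mapping.keys (\<Sum>a\<in>A. scale (k a) (pr (qV (x a)) (qW (y a)))) \<subseteq> S"
  using keys_sum by (rule order_trans) (auto simp: V.carrier W.carrier split: if_splits)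

text \<open>The form of the universal property used in computations: \<open>c\<close> may choose
  representatives of the values separately for each index, with no uniform choice on pairs. The
  uniform choice that \<open>lift_coset\<close> asks for is made by \<open>SOME\<close>.\<close>

lemma lift_sum:
  assumes U: "presents s q U" and \<beta>: "bilinear_on V W U \<beta>"
    and c: "\<And>a. a \<in> A \<Longrightarrow> q (c a) = \<beta> (qV (x a)) (qW (y a))"
  shows "tensor_lift U \<beta> (cs (\<Sum>a\<in>A. scale (k a) (pr (qV (x a)) (qW (y a))))) = q (\<Sum>a\<in>A. s (k a) (c a))"
proof -
  interpret U: presents s q U by (rule U)
  define b where "b x y = (SOME e. q e = \<beta> x y)" for x y
  have b: "q (b (qV x) (qW y)) = \<beta> (qV x) (qW y)" for x y
  proof -
    have "\<beta> (qV x) (qW y) \<in> range q"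
      using \<beta> by (auto simp: bilinear_on_def V.carrier W.carrier U.carrier)
    then obtain e where "q e = \<beta> (qV x) (qW y)" by (metis imageE)
    then show ?thesis unfolding b_def by (rule someI)
  qed
  have "q (s (k a) (b (qV (x a)) (qW (y a)))) = q (s (k a) (c a))" if "a \<in> A" for a
    unfolding U.smult[symmetric] b c[OF that] ..
  then show ?thesis
    unfolding lift_coset[OF U \<beta> b keys_pr_sum]
    by (simp add: lin_ext_sum[OF U.vs] lin_ext_single[OF U.vs]) (rule U.q_sum_cong)
qed

lemma pr_zero_left: "pr (qV 0) (qW y) \<in> K"
  using pr_scale_left[of 0 0 y] by (simp add: cs_eq_iff)

lemma pr_zero_right: "pr (qV x) (qW 0) \<in> K"
  using pr_scale_right[of x 0 0] by (simp add: cs_eq_iff)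

lemma pr_sum_right: "cs (pr (qV x) (qW (\<Sum>a\<in>A. sW (k a) (c a)))) = cs (\<Sum>a\<in>A. scale (k a) (pr (qV x) (qW (c a))))"
proof (induction A rule: infinite_finite_induct)
  case (insert a A)
  show ?case
    unfolding sum.insert[OF insert.hyps] pr_add_right by (intro cs_add_cong pr_scale_right insert.IH)
qed (use pr_zero_right[of x] in \<open>simp_all add: cs_eq_iff\<close>)

lemma pr_sum_left: "cs (pr (qV (\<Sum>a\<in>A. sV (k a) (c a))) (qW y)) = cs (\<Sum>a\<in>A. scale (k a) (pr (qV (c a)) (qW y)))"
proof (induction A rule: infinite_finite_induct)
  case (insert a A)
  show ?case
    unfolding sum.insert[OF insert.hyps] pr_add_left by (intro cs_add_cong pr_scale_left insert.IH)
qed (use pr_zero_left[of y] in \<open>simp_all add: cs_eq_iff\<close>)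

text \<open>Only surjectivity has to be derived: the range of \<open>h\<close> is closed under sums
  and scalars, and pure tensors span.\<close>

lemma presents_tensorI:
  assumes vs: "vector_space s"
    and add: "\<And>x y. h x \<oplus>\<^bsub>T\<^esub> h y = h (x + y)" and zero: "\<zero>\<^bsub>T\<^esub> = h 0"
    and smult: "\<And>c x. c \<odot>\<^bsub>T\<^esub> h x = h (s c x)"
    and sub: "range h \<subseteq> carrier T"
    and gen: "\<And>x y. cs (pr (qV x) (qW y)) \<in> range h"
  shows "presents s h T"
proof (rule presents.intro[OF vs _ add zero smult], rule equalityI[OF _ sub])
  have sum: "cs (sum f A) \<in> range h" if "\<And>a. a \<in> A \<Longrightarrow> cs (f a) \<in> range h" for f :: "'a \<times> 'b \<Rightarrow> _" and A
    using that
  proof (induction A rule: infinite_finite_induct)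
    case (insert a A)
    have "cs (f a) \<in> range h" "cs (sum f A) \<in> range h"
      by (rule insert.prems, simp, rule insert.IH, rule insert.prems, simp)
    then obtain x y where "cs (f a) = h x" "cs (sum f A) = h y" by (elim imageE)
    then have "cs (sum f (insert a A)) = h (x + y)"
      using insert.hyps by (simp add: tensor_add[symmetric] add)
    then show ?case by simp
  qed (simp_all add: tensor_zero[symmetric] zero)
  have "cs z \<in> range h" if z: "Poly_Mapping.keys z \<subseteq> S" for z
  proof -
    have "cs (scale (Poly_Mapping.lookup z p) (Poly_Mapping.single p 1)) \<in> range h" if p: "p \<in> S" for p
    proof -
      obtain a b where "p = (qV a, qW b)" using p by (auto simp: V.carrier W.carrier)
      then obtain x where "cs (Poly_Mapping.single p 1) = h x" using gen[of a b] by blast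
      then have "cs (scale (Poly_Mapping.lookup z p) (Poly_Mapping.single p 1)) = h (s (Poly_Mapping.lookup z p) x)"
        by (simp only: tensor_smult[symmetric] smult)
      then show ?thesis by simp
    qed
    with z have "cs (\<Sum>p\<in>Poly_Mapping.keys z. scale (Poly_Mapping.lookup z p) (Poly_Mapping.single p 1)) \<in> range h"
      by (intro sum) blast
    then show ?thesis using lin_ext_unit[of z] by (simp add: lin_ext_def)
  qed
  then show "carrier T \<subseteq> range h" unfolding tensor_carrier by blast
qed

text \<open>A tensor that all functionals \<open>f y\<close> contract to zero vanishes: solving one of the
  contracted equations for a coefficient eliminates one summand.\<close>

lemma tensor_zero_criterion:
  assumes "finite A" and lin: "\<And>y. Vector_Spaces.linear sV (*) (f y)"
    and sep: "\<And>x. (\<And>y. f y x = 0) \<Longrightarrow> qV x = qV 0"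
    and "\<And>y. qW (\<Sum>a\<in>A. sW (f y (x a)) (c a)) = qW 0"
  shows "(\<Sum>a\<in>A. pr (qV (x a)) (qW (c a))) \<in> K"
  using assms(1,4)
proof (induction A arbitrary: x rule: finite_induct)
  case empty
  show ?case using sc.subspace_0[OF subspace_K] by simp
next
  case (insert a0 A)
  note Kadd = sc.subspace_add[OF subspace_K] and Kdiff = sc.subspace_diff[OF subspace_K]
  show ?case
  proof (cases "\<forall>y. f y (x a0) = 0")
    case True
    then have "pr (qV (x a0)) (qW (c a0)) \<in> K"
      using sep[of "x a0"] pr_zero_left by simp
    moreover have "(\<Sum>a\<in>A. pr (qV (x a)) (qW (c a))) \<in> K"
      using insert.prems insert.hyps True by (intro insert.IH) simp
    ultimately show ?thesis using insert.hyps by (simp add: Kadd)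
  next
    case False
    then obtain y0 where y0: "f y0 (x a0) \<noteq> 0" by blast
    \<comment> \<open>Dividing the equation for \<open>y0\<close> by the coefficient of
      \<open>c a0\<close> shows that \<open>?d\<close> represents zero, so \<open>c a0\<close> can
      be replaced by minus the sum of the \<open>l a\<close> times \<open>c a\<close>. Collecting
      the tensors by \<open>c a\<close> produces the new left factors \<open>x' a\<close>.\<close>
    define l where "l a = f y0 (x a) / f y0 (x a0)" for a
    define x' where "x' a = x a - sV (l a) (x a0)" for a
    let ?d = "c a0 + (\<Sum>a\<in>A. sW (l a) (c a))"
    note kern = W.subspace_kernel
    have prem: "sW (f y (x a0)) (c a0) + (\<Sum>a\<in>A. sW (f y (x a)) (c a)) \<in> {z. qW z = qW 0}" for y
      using insert.prems[of y] insert.hyps by simp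
    have "sW (inverse (f y0 (x a0))) (sW (f y0 (x a0)) (c a0) + (\<Sum>a\<in>A. sW (f y0 (x a)) (c a))) = ?d"
      using y0 by (simp add: l_def W.vs.scale_right_distrib W.vs.scale_sum_right divide_inverse mult.commute)
    then have d: "?d \<in> {z. qW z = qW 0}"
      using W.vs.subspace_scale[OF kern prem[of y0], of "inverse (f y0 (x a0))"] by simp
    \<comment> \<open>The shorter sum still satisfies all contracted equations: each is the old one
      minus a multiple of \<open>?d\<close>.\<close>
    have "qW (\<Sum>a\<in>A. sW (f y (x' a)) (c a)) = qW 0" for y
    proof -
      interpret f: Vector_Spaces.linear sV "(*)" "f y" by (rule lin)
      have "(\<Sum>a\<in>A. sW (f y (x' a)) (c a)) =
        (sW (f y (x a0)) (c a0) + (\<Sum>a\<in>A. sW (f y (x a)) (c a))) - sW (f y (x a0)) ?d"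
        by (simp add: x'_def f.diff f.scale W.vs.scale_left_diff_distrib sum_subtractf
            W.vs.scale_right_distrib W.vs.scale_sum_right mult.commute)
      also have "\<dots> \<in> {z. qW z = qW 0}"
        by (intro W.vs.subspace_diff[OF kern] W.vs.subspace_scale[OF kern] prem d)
      finally show ?thesis by simp
    qed
    then have IH: "(\<Sum>a\<in>A. pr (qV (x' a)) (qW (c a))) \<in> K" by (rule insert.IH)
    let ?B = "pr (qV (x a0)) (qW (c a0))" and ?D = "pr (qV (x a0)) (qW ?d)"
      and ?L = "\<Sum>a\<in>A. scale (l a) (pr (qV (x a0)) (qW (c a)))"
      and ?X = "\<Sum>a\<in>A. pr (qV (x a)) (qW (c a))" and ?X' = "\<Sum>a\<in>A. pr (qV (x' a)) (qW (c a))"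
    have 1: "?D - (?B + ?L) \<in> K"
      unfolding cs_eq_iff[symmetric] pr_add_right by (intro cs_add_cong pr_sum_right refl)
    have 2: "?D \<in> K" using d pr_zero_right by simp
    have "cs ?X' = cs (\<Sum>a\<in>A. pr (qV (x a)) (qW (c a)) + scale (- l a) (pr (qV (x a0)) (qW (c a))))"
    proof (rule cs_sum_cong)
      fix a
      have "x' a = x a + sV (- l a) (x a0)" by (simp add: x'_def)
      then show "cs (pr (qV (x' a)) (qW (c a))) =
          cs (pr (qV (x a)) (qW (c a)) + scale (- l a) (pr (qV (x a0)) (qW (c a))))"
        by (simp only: pr_add_left) (intro cs_add_cong pr_scale_left refl)
    qed
    then have 3: "?X' - (?X - ?L) \<in> K"
      unfolding cs_eq_iff by (simp add: single_uminus sum_subtractf)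
    \<comment> \<open>The two summands collapse to \<open>?B + ?L\<close> and
      \<open>?X - ?L\<close>, so the whole is the original sum \<open>?B + ?X\<close>.\<close>
    have "(?D - (?D - (?B + ?L))) + (?X' - (?X' - (?X - ?L))) \<in> K"
      by (intro Kadd Kdiff 1 2 3 IH)
    then show ?thesis using insert.hyps by (simp add: algebra_simps)
  qed
qed

end

section \<open>Tensor products of two quotients of the space of words\<close>

locale word_tensor = tensor_pair scale qV V scale qW W
  for qV :: "('i list \<Rightarrow>\<^sub>0 'k::field) \<Rightarrow> 'a" and V :: "('k, 'a, 'm) module_scheme"
    and qW :: "('i list \<Rightarrow>\<^sub>0 'k) \<Rightarrow> 'b" and W :: "('k, 'b, 'n) module_scheme"
begin

text \<open>Tensors of classes are presented by combinations of pairs of words, so that the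
  operations on the tensor square of the free algebra can be transported to the tensor product of
  the quotients.\<close>

definition qT :: "('i list \<times> 'i list \<Rightarrow>\<^sub>0 'k) \<Rightarrow> ('a \<times> 'b \<Rightarrow>\<^sub>0 'k) set" where
  "qT z = cs (lin_ext scale (\<lambda>p. pr (qV (word (fst p))) (qW (word (snd p)))) z)"

lemma lin_ext_as_sum: "x = (\<Sum>u\<in>Poly_Mapping.keys x. scale (Poly_Mapping.lookup x u) (word u))"
  using lin_ext_unit[of x] by (simp add: lin_ext_def word_def)

lemma pure_q: "pure V W (qV x) (qW y) = qT (free_tensor x y)"
proof -
  have "cs (pr (qV x) (qW y)) = cs (\<Sum>u\<in>Poly_Mapping.keys x. scale (Poly_Mapping.lookup x u) (pr (qV (word u)) (qW y)))"
    by (subst (1) lin_ext_as_sum) (rule pr_sum_left)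
  also have "\<dots> = cs (\<Sum>u\<in>Poly_Mapping.keys x. scale (Poly_Mapping.lookup x u)
      (\<Sum>w\<in>Poly_Mapping.keys y. scale (Poly_Mapping.lookup y w) (pr (qV (word u)) (qW (word w)))))"
    by (intro cs_sum_cong cs_scale_cong, subst (1) lin_ext_as_sum[of y]) (rule pr_sum_right)
  also have "\<dots> = qT (free_tensor x y)"
    unfolding qT_def lin_ext_free_tensor[OF vector_space_scale] by (simp add: lin_ext_def)
  finally show ?thesis by (simp add: pure_eq)
qed

lemma presents_qT: "presents scale qT T"
proof (rule presents_tensorI)
  show "vector_space (scale :: 'k \<Rightarrow> ('i list \<times> 'i list \<Rightarrow>\<^sub>0 'k) \<Rightarrow> _)" by (rule vector_space_scale)
  show "qT x \<oplus>\<^bsub>T\<^esub> qT y = qT (x + y)" for x y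
    by (simp add: qT_def tensor_add lin_ext_sc)
  show "\<zero>\<^bsub>T\<^esub> = qT 0" by (simp add: qT_def tensor_zero lin_ext_zero[OF vector_space_scale])
  show "c \<odot>\<^bsub>T\<^esub> qT x = qT (scale c x)" for c x
    by (simp add: qT_def tensor_smult lin_ext_sc)
  show "range qT \<subseteq> carrier T"
    unfolding qT_def tensor_carrier lin_ext_def
    by (intro image_subsetI imageI CollectI keys_pr_sum)
  show "cs (pr (qV x) (qW y)) \<in> range qT" for x y
    by (simp add: pure_eq[symmetric] pure_q)
qed

lemma lift_qT:
  assumes U: "presents s q U" and \<beta>: "bilinear_on V W U \<beta>"
    and c: "\<And>p. p \<in> Poly_Mapping.keys z \<Longrightarrow> q (c p) = \<beta> (qV (word (fst p))) (qW (word (snd p)))"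
  shows "tensor_lift U \<beta> (qT z) = q (lin_ext s c z)"
  unfolding qT_def lin_ext_def by (rule lift_sum[OF U \<beta>]) (rule c)

text \<open>If functionals detect the kernels of both projections, their products detect the kernel
  on the tensor product. For fixed \<open>y\<close>, the equations for all \<open>y'\<close> say
  that the contraction by \<open>f\<close> vanishes in \<open>W\<close>, which is what the general
  criterion asks for.\<close>

lemma qT_zero_criterion:
  assumes sepV: "\<And>x. (\<And>y. lin_ext (*) (\<lambda>u. f u y) x = 0) \<Longrightarrow> qV x = qV 0"
    and sepW: "\<And>x. (\<And>y. lin_ext (*) (\<lambda>u. g u y) x = 0) \<Longrightarrow> qW x = qW 0"
    and z: "\<And>y y'. lin_ext (*) (\<lambda>p. f (fst p) y * g (snd p) y') z = 0"
  shows "qT z = qT 0"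
proof -
  let ?c = "\<lambda>p. scale (Poly_Mapping.lookup z p) (word (snd p))"
  have "(\<Sum>p\<in>Poly_Mapping.keys z. pr (qV (word (fst p))) (qW (?c p))) \<in> K"
  proof (rule tensor_zero_criterion[where f = "\<lambda>y. lin_ext (*) (\<lambda>u. f u y)"])
    fix y
    show "qW (\<Sum>p\<in>Poly_Mapping.keys z. scale (lin_ext (*) (\<lambda>u. f u y) (word (fst p))) (?c p)) = qW 0"
    proof (rule sepW)
      fix y'
      have "lin_ext (*) (\<lambda>u. g u y') (\<Sum>p\<in>Poly_Mapping.keys z. scale (lin_ext (*) (\<lambda>u. f u y) (word (fst p))) (?c p))
        = lin_ext (*) (\<lambda>p. f (fst p) y * g (snd p) y') z"
        by (simp add: lin_ext_sum[OF vector_space_times] lin_ext_k lin_ext_word[OF vector_space_times] lin_ext_def[of _ _ z] mult_ac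
            del: sc.scale_scale)
      then show "lin_ext (*) (\<lambda>u. g u y') (\<Sum>p\<in>Poly_Mapping.keys z. scale (lin_ext (*) (\<lambda>u. f u y) (word (fst p))) (?c p)) = 0"
        using z by simp
    qed
  qed (use sepV in \<open>auto intro: linear_lin_ext[OF vector_space_times]\<close>)
  then have "cs (\<Sum>p\<in>Poly_Mapping.keys z. pr (qV (word (fst p))) (qW (?c p))) = cs 0"
    by (simp add: cs_eq_iff)
  moreover have "cs (\<Sum>p\<in>Poly_Mapping.keys z. pr (qV (word (fst p))) (qW (?c p))) = qT z"
    unfolding qT_def lin_ext_def by (intro cs_sum_cong pr_scale_right)
  ultimately show ?thesis by (simp add: qT_def lin_ext_zero[OF vector_space_scale])
qed

end

section \<open>The quotient of the free algebra by the radical\<close>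

lemma free_alg_simps [simp]:
  "carrier free_alg = UNIV" "mult free_alg = free_mult" "one free_alg = word []"
  "zero free_alg = 0" "add free_alg = (+)" "smult free_alg = scale"
  by (simp_all add: free_alg_def)

lemma lin_ext_word_eq: "lin_ext scale word x = x"
  using lin_ext_unit[of x] by (simp add: word_def[abs_def])

lemma
  shows free_mult_add_left: "free_mult (x + x') y = free_mult x y + free_mult x' y"
    and free_mult_add_right: "free_mult x (y + y') = free_mult x y + free_mult x y'"
    and free_mult_scale_left: "free_mult (scale c x) y = scale c (free_mult x y)"
    and free_mult_scale_right: "free_mult x (scale c y) = scale c (free_mult x y)"
  by (simp_all add: free_mult_lin_ext lin_ext_sc lin_ext_fun_add[OF vector_space_scale]
      lin_ext_fun_scale[OF vector_space_scale])

lemma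
  shows free_tensor_add_left: "free_tensor (x + x') y = free_tensor x y + free_tensor x' y"
    and free_tensor_add_right: "free_tensor x (y + y') = free_tensor x y + free_tensor x y'"
    and free_tensor_scale_left: "free_tensor (scale c x) y = scale c (free_tensor x y)"
    and free_tensor_scale_right: "free_tensor x (scale c y) = scale c (free_tensor x y)"
  by (simp_all add: free_tensor_lin_ext lin_ext_sc lin_ext_fun_add[OF vector_space_scale]
      lin_ext_fun_scale[OF vector_space_scale])

lemma free_mult_diff:
  "free_mult x y - free_mult x' y' = free_mult (x - x') y + free_mult x' (y - y')"
proof -
  have "free_mult (x - x' + x') y = free_mult (x - x') y + free_mult x' y"
    by (rule free_mult_add_left)
  moreover have "free_mult x' (y - y' + y') = free_mult x' (y - y') + free_mult x' y'"
    by (rule free_mult_add_right)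
  ultimately show ?thesis by (simp add: algebra_simps)
qed

locale form_params =
  fixes \<Omega> :: "'i::finite \<Rightarrow> 'i \<Rightarrow> int" and v t :: "'k::field"
  assumes v_nz: "v \<noteq> 0" and t_nz: "t \<noteq> 0"
begin

lemmas nz = v_nz t_nz

abbreviation "I \<equiv> radical \<Omega> v t"
abbreviation "cl \<equiv> fclass \<Omega> v t"
abbreviation "F \<equiv> falg \<Omega> v t"

lemma subspace_I: "sc.subspace I"
  by (rule subspace_radical[OF nz])

lemma cl_coset: "cl = coset I"
  by (rule ext) (simp add: fclass_def a_r_coset_eq)

lemma cl_eq_iff: "cl x = cl y \<longleftrightarrow> x - y \<in> I"
  by (simp add: cl_coset sc.coset_eq_iff[OF subspace_I])

lemma mem_cl_iff: "y \<in> cl x \<longleftrightarrow> y - x \<in> I"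
  by (simp add: cl_coset sc.mem_coset_iff[OF subspace_I])

lemma presents_cl: "presents scale cl F"
proof (rule presents.intro)
  show "vector_space (scale :: 'k \<Rightarrow> ('i list \<Rightarrow>\<^sub>0 'k) \<Rightarrow> _)" by (rule vector_space_scale)
  show "carrier F = range cl"
    by (auto simp: falg_def A_RCOSETS_def' fclass_def)
  show "cl x \<oplus>\<^bsub>F\<^esub> cl y = cl (x + y)" for x y
    by (simp add: falg_def cl_coset sc.coset_add[OF subspace_I])
  show "\<zero>\<^bsub>F\<^esub> = cl 0"
    by (simp add: falg_def cl_coset coset_zero)
  show "c \<odot>\<^bsub>F\<^esub> cl x = cl (scale c x)" for c x
    by (simp add: falg_def cl_coset sc.coset_smult[OF subspace_I] a_r_coset_eq)
qed

lemma one_F: "\<one>\<^bsub>F\<^esub> = cl (word [])"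
  by (simp add: falg_def fclass_def)

text \<open>The product of cosets is a union over representatives; it is a single coset because the
  radical is a two-sided ideal.\<close>

lemma mult_F: "cl x \<otimes>\<^bsub>F\<^esub> cl y = cl (free_mult x y)"
proof -
  have "cl (free_mult a b) = cl (free_mult x y)" if "a \<in> cl x" "b \<in> cl y" for a b
    using that
    by (simp add: mem_cl_iff cl_eq_iff free_mult_diff sc.subspace_add[OF subspace_I] radical_ideal[OF nz])
  moreover have "x \<in> cl x" "y \<in> cl y" by (simp_all add: mem_cl_iff sc.subspace_0[OF subspace_I])
  ultimately have "(\<Union>a\<in>cl x. \<Union>b\<in>cl y. cl (free_mult a b)) = cl (free_mult x y)" by blast
  then show ?thesis by (simp add: falg_def rcoset_mult_def fclass_def)
qed

lemma cl_eq_0I: "(\<And>y. lin_ext (*) (\<lambda>u. twisted_form \<Omega> v t u y) x = 0) \<Longrightarrow> cl x = cl 0"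
  by (simp add: cl_eq_iff radical_iff[OF nz])

sublocale F: presents scale cl F by (rule presents_cl)
sublocale FF: word_tensor cl F cl F by unfold_locales

text \<open>Two representatives differ by an element of the radical, whose coproduct pairs to zero
  with all pairs of words and so dies in the tensor square. Hence \<open>the_elem\<close> is applied
  to a singleton.\<close>

lemma fcomult_cl: "fcomult \<Omega> v t (cl x) = FF.qT (free_comult \<Omega> v t x)"
proof -
  interpret T: presents scale FF.qT "tensor F F" by (rule FF.presents_qT)
  have val: "(\<Oplus>\<^bsub>tensor F F\<^esub>p\<in>Poly_Mapping.keys z. Poly_Mapping.lookup z p \<odot>\<^bsub>tensor F F\<^esub>
      pure F F (cl (word (fst p))) (cl (word (snd p)))) = FF.qT z" for z
  proof -
    have "(\<Oplus>\<^bsub>tensor F F\<^esub>p\<in>Poly_Mapping.keys z. Poly_Mapping.lookup z p \<odot>\<^bsub>tensor F F\<^esub>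
      pure F F (cl (word (fst p))) (cl (word (snd p)))) =
      FF.qT (lin_ext scale (\<lambda>p. Poly_Mapping.single p 1) z)"
      by (simp only: FF.pure_q free_tensor_word T.smult T.finsum_q lin_ext_def prod.collapse)
    then show ?thesis by (simp only: lin_ext_unit)
  qed
  have "FF.qT (free_comult \<Omega> v t y) = FF.qT (free_comult \<Omega> v t x)" if "y \<in> cl x" for y
  proof -
    have yx: "y - x \<in> I" using that by (simp add: mem_cl_iff)
    have "FF.qT (free_comult \<Omega> v t (y - x)) = FF.qT 0"
      by (rule FF.qT_zero_criterion[where f = "twisted_form \<Omega> v t" and g = "twisted_form \<Omega> v t"])
        (rule cl_eq_0I, assumption, rule cl_eq_0I, assumption, rule radical_comult[OF nz yx])
    then show ?thesis
      by (subst T.q_eq_iff) (simp add: free_comult_lin_ext lin_ext_diff[OF vector_space_scale])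
  qed
  moreover have "x \<in> cl x" by (simp add: mem_cl_iff sc.subspace_0[OF subspace_I])
  ultimately have "(\<lambda>y. FF.qT (free_comult \<Omega> v t y)) ` cl x = {FF.qT (free_comult \<Omega> v t x)}" by blast
  then show ?thesis by (simp add: fcomult_def Let_def val)
qed

end

section \<open>Change of the base field\<close>

locale field_hom =
  fixes emb :: "'k::field \<Rightarrow> 'l::field"
  assumes emb_add: "emb (a + b) = emb a + emb b"
    and emb_mult: "emb (a * b) = emb a * emb b"
    and emb_1 [simp]: "emb 1 = 1"
begin

lemma emb_0 [simp]: "emb 0 = 0"
  using emb_add[of 0 0] by (simp only: add_0_right add_cancel_right_right)

lemma emb_minus: "emb (- a) = - emb a"
  using emb_add[of a "- a"] by (simp add: eq_neg_iff_add_eq_0 add.commute)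

lemma emb_diff: "emb (a - b) = emb a - emb b"
  using emb_add[of a "- b"] by (simp add: emb_minus)

lemma emb_inverse: "emb (inverse a) = inverse (emb a)"
proof (cases "a = 0")
  case False
  then have "emb a * emb (inverse a) = 1" by (simp flip: emb_mult)
  then show ?thesis by (metis inverse_unique)
qed simp

lemma emb_power: "emb (a ^ n) = emb a ^ n"
  by (induction n) (simp_all add: emb_mult)

lemma emb_powi: "emb (a powi n) = emb a powi n"
  by (simp add: power_int_def emb_power emb_inverse)

lemma emb_nz: "a \<noteq> 0 \<Longrightarrow> emb a \<noteq> 0"
  by (metis emb_1 emb_mult mult_zero_left right_inverse zero_neq_one emb_0)

definition mapc :: "('b \<Rightarrow>\<^sub>0 'k) \<Rightarrow> ('b \<Rightarrow>\<^sub>0 'l)" where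
  "mapc z = Poly_Mapping.map emb z"

lemma lookup_mapc [simp]: "Poly_Mapping.lookup (mapc z) p = emb (Poly_Mapping.lookup z p)"
  by (simp add: mapc_def Poly_Mapping.map.rep_eq when_def)

lemma keys_mapc: "Poly_Mapping.keys (mapc z) \<subseteq> Poly_Mapping.keys z"
  by (auto simp: in_keys_iff)

lemma mapc_add: "mapc (x + y) = mapc x + mapc y"
  by (rule poly_mapping_eqI) (simp add: lookup_add emb_add)

lemma mapc_scale: "mapc (scale c x) = scale (emb c) (mapc x)"
  by (rule poly_mapping_eqI) (simp add: emb_mult)

lemma mapc_single [simp]: "mapc (Poly_Mapping.single p c) = Poly_Mapping.single p (emb c)"
  by (rule poly_mapping_eqI) (simp add: lookup_single when_def)

lemma mapc_word [simp]: "mapc (word w) = word w"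
  by (simp add: word_def)

lemma mapc_0 [simp]: "mapc 0 = 0"
  by (rule poly_mapping_eqI) simp

lemma vector_space_restrict:
  assumes "vector_space s"
  shows "vector_space (\<lambda>a. s (emb a))"
proof -
  interpret vector_space s by fact
  show ?thesis
    by unfold_locales (simp_all add: scale_right_distrib scale_left_distrib emb_add emb_mult)
qed

lemma lin_ext_mapc:
  assumes "vector_space s"
  shows "lin_ext s f (mapc z) = lin_ext (\<lambda>a. s (emb a)) f z"
  by (subst lin_ext_superset[OF assms _ keys_mapc]) (simp_all add: lin_ext_def)

lemma linear_mapc: "Vector_Spaces.linear scale (\<lambda>a. scale (emb a)) mapc"
  by (simp add: Vector_Spaces.linear_iff vector_space_scale vector_space_restrict mapc_add mapc_scale)

lemma mapc_lin_ext: "mapc (lin_ext scale f z) = lin_ext scale (\<lambda>p. mapc (f p)) (mapc z)"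
  by (simp add: lin_ext_linear[OF linear_mapc] lin_ext_mapc[OF vector_space_scale])

lemma linear_emb: "Vector_Spaces.linear (*) (\<lambda>a c. emb a * c) emb"
  by (simp add: Vector_Spaces.linear_iff vector_space_times vector_space_restrict emb_add emb_mult)

lemma emb_lin_ext: "emb (lin_ext (*) f z) = lin_ext (*) (\<lambda>p. emb (f p)) (mapc z)"
  by (simp add: lin_ext_linear[OF linear_emb] lin_ext_mapc[OF vector_space_times])

lemma mapc_free_mult: "mapc (free_mult x y) = free_mult (mapc x) (mapc y)"
  by (simp add: free_mult_lin_ext mapc_lin_ext)

lemma mapc_comult_word: "mapc (comult_word \<Omega> v t u) = comult_word \<Omega> (emb v) (emb t) u"
  by (induction u) (simp_all add: comult_word_Cons mapc_lin_ext mapc_add braid_def emb_mult emb_powi)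

lemma mapc_skew: "mapc (skew \<Omega> v j u) = skew \<Omega> (emb v) j u"
  by (induction u) (simp_all add: mapc_lin_ext mapc_add mapc_scale emb_powi)

lemma emb_theta_norm: "emb (theta_norm \<Omega> v j) = theta_norm \<Omega> (emb v) j"
  by (simp add: theta_norm_def v_at_def emb_inverse emb_diff emb_powi)

lemma emb_word_form: "emb (word_form \<Omega> v u w) = word_form \<Omega> (emb v) u w"
  by (induction w arbitrary: u) (simp_all add: emb_mult emb_theta_norm emb_lin_ext mapc_skew)

text \<open>The values on words are built from the parameters by field operations alone, so a field
  embedding changes only the parameters.\<close>

lemma emb_twisted_form: "emb (twisted_form \<Omega> v t u w) = twisted_form \<Omega> (emb v) (emb t) u w"
  by (simp add: twisted_form_def emb_mult emb_powi emb_word_form)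

end

lemma field_module_simps [simp]:
  "carrier field_module = UNIV" "add field_module = (+)" "zero field_module = 0"
  "smult field_module = (*)"
  by (simp_all add: field_module_def)

lemma restrict_scalars_simps [simp]:
  "carrier (restrict_scalars emb M) = carrier M" "add (restrict_scalars emb M) = add M"
  "zero (restrict_scalars emb M) = zero M" "smult (restrict_scalars emb M) = (\<lambda>c. smult M (emb c))"
  by (simp_all add: restrict_scalars_def ring.defs module.defs)

lemma (in field_hom) presents_restrict:
  assumes "presents s q U"
  shows "presents (\<lambda>a. s (emb a)) q (restrict_scalars emb U)"
proof -
  interpret presents s q U by fact
  show ?thesis
    by (rule presents.intro) (simp_all add: vector_space_restrict vs carrier add zero smult)
qed

lemma presents_field: "presents (*) (\<lambda>x. x) field_module"
  by (rule presents.intro) (simp_all add: vector_space_times)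

lemma (in tensor_pair) bilinear_onI:
  assumes U: "presents s q U"
    and g: "\<And>x y. \<beta> (qV x) (qW y) = q (g x y)"
    and "\<And>x x' y. g (x + x') y = g x y + g x' y" "\<And>x y y'. g x (y + y') = g x y + g x y'"
    and "\<And>c x y. g (sV c x) y = s c (g x y)" "\<And>c x y. g x (sW c y) = s c (g x y)"
  shows "bilinear_on V W U \<beta>"
proof -
  interpret U: presents s q U by fact
  show ?thesis
    unfolding bilinear_on_def V.carrier W.carrier
    by (auto simp: V.add W.add V.smult W.smult U.add U.smult U.carrier g assms(3-))
qed

section \<open>Extension of scalars\<close>

locale base_change = field_hom emb + L: form_params \<Omega> v t
  for emb :: "'k::field \<Rightarrow> 'l::field" and \<Omega> :: "'i::finite \<Rightarrow> 'i \<Rightarrow> int" and v t :: 'k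
begin

abbreviation "R \<equiv> restrict_scalars emb field_module :: ('k, 'l) module"
abbreviation "L \<equiv> falg \<Omega> v t"
abbreviation "D \<equiv> ext_alg emb L"

lemma presents_R: "presents (\<lambda>a c. emb a * c) (\<lambda>x. x) R"
  by (rule presents_restrict[OF presents_field])

sublocale R: presents "\<lambda>a c. emb a * c" "\<lambda>x. x" R by (rule presents_R)
sublocale LR: tensor_pair scale L.cl L "\<lambda>a c. emb a * c" "\<lambda>x. x" R by unfold_locales

text \<open>Presents the extended algebra by the free algebra over the larger field: the coefficient
  of a word becomes the second factor of a pure tensor.\<close>

definition scal_ext :: "('i list \<Rightarrow>\<^sub>0 'l) \<Rightarrow> (('i list \<Rightarrow>\<^sub>0 'k) set \<times> 'l \<Rightarrow>\<^sub>0 'k) set" where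
  "scal_ext x = LR.cs (\<Sum>w\<in>Poly_Mapping.keys x. pr (L.cl (word w)) (Poly_Mapping.lookup x w))"

lemma ext_superset:
  assumes "finite A" "Poly_Mapping.keys x \<subseteq> A"
  shows "scal_ext x = LR.cs (\<Sum>w\<in>A. pr (L.cl (word w)) (Poly_Mapping.lookup x w))"
proof -
  have "LR.cs (\<Sum>w\<in>A. pr (L.cl (word w)) (Poly_Mapping.lookup x w)) =
    LR.cs (\<Sum>w\<in>A. if w \<in> Poly_Mapping.keys x then pr (L.cl (word w)) (Poly_Mapping.lookup x w) else 0)"
    by (rule LR.cs_sum_cong) (auto simp: in_keys_iff LR.cs_eq_iff LR.pr_zero_right
        sc.subspace_0[OF LR.subspace_K])
  also have "\<dots> = scal_ext x"
    using assms by (simp add: scal_ext_def sum.If_cases Int_absorb1)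
  finally show ?thesis by simp
qed

lemma ext_add: "LR.cs (\<Sum>w\<in>Poly_Mapping.keys x \<union> Poly_Mapping.keys y. pr (L.cl (word w)) (Poly_Mapping.lookup x w)
    + pr (L.cl (word w)) (Poly_Mapping.lookup y w)) = scal_ext (x + y)"
  by (subst ext_superset[OF _ keys_add]) (auto intro!: LR.cs_sum_cong simp: lookup_add LR.pr_add_right)

lemma ext_scale_emb: "LR.cs (scale k (\<Sum>w\<in>Poly_Mapping.keys x. pr (L.cl (word w)) (Poly_Mapping.lookup x w)))
    = scal_ext (scale (emb k) x)"
  by (subst ext_superset[OF _ keys_scale])
    (auto intro!: LR.cs_sum_cong simp: sc.scale_sum_right LR.pr_scale_right simp del: scale_single)

lemma pure_ext: "LR.cs (pr (L.cl a) d) = scal_ext (scale d (mapc a))"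
proof -
  have "LR.cs (pr (L.cl a) d) = LR.cs (\<Sum>w\<in>Poly_Mapping.keys a. scale (Poly_Mapping.lookup a w) (pr (L.cl (word w)) d))"
    by (subst (1) L.FF.lin_ext_as_sum) (rule LR.pr_sum_left)
  also have "\<dots> = LR.cs (\<Sum>w\<in>Poly_Mapping.keys a. pr (L.cl (word w)) (emb (Poly_Mapping.lookup a w) * d))"
    by (intro LR.cs_sum_cong LR.pr_scale_right[symmetric])
  also have "\<dots> = scal_ext (scale d (mapc a))"
    by (subst ext_superset[of "Poly_Mapping.keys a", OF _ order_trans[OF keys_scale keys_mapc]])
      (simp_all add: mult.commute)
  finally show ?thesis .
qed

abbreviation "s' \<equiv> (\<lambda>a. scale (emb a) :: ('x \<Rightarrow>\<^sub>0 'l) \<Rightarrow> _)"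

text \<open>The tensor product is formed over the small field, so here scalars act through
  \<open>emb\<close>. The action of the larger field belongs to the record \<open>D\<close> and is
  treated separately.\<close>

lemma presents_ext_T: "presents s' scal_ext LR.T"
proof (rule LR.presents_tensorI)
  show "vector_space (\<lambda>a. scale (emb a) :: ('x \<Rightarrow>\<^sub>0 'l) \<Rightarrow> _)"
    by (rule vector_space_restrict[OF vector_space_scale])
  show "scal_ext x \<oplus>\<^bsub>LR.T\<^esub> scal_ext y = scal_ext (x + y)" for x y
  proof -
    let ?A = "Poly_Mapping.keys x \<union> Poly_Mapping.keys y"
    show ?thesis
      by (simp add: ext_superset[of ?A x] ext_superset[of ?A y] LR.tensor_add sum.distrib[symmetric] ext_add)
  qed
  show "\<zero>\<^bsub>LR.T\<^esub> = scal_ext 0" by (simp add: scal_ext_def LR.tensor_zero)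
  show "c \<odot>\<^bsub>LR.T\<^esub> scal_ext x = scal_ext (scale (emb c) x)" for c x
    by (subst ext_scale_emb[symmetric]) (simp only: scal_ext_def LR.tensor_smult)
  have "Poly_Mapping.keys (\<Sum>w\<in>Poly_Mapping.keys x. pr (L.cl (word w)) (Poly_Mapping.lookup x w)) \<subseteq> LR.S" for x :: "'i list \<Rightarrow>\<^sub>0 'l"
    using LR.keys_pr_sum[of "\<lambda>_. 1" word "Poly_Mapping.lookup x" "Poly_Mapping.keys x"] by simp
  then show "range scal_ext \<subseteq> carrier LR.T"
    unfolding scal_ext_def LR.tensor_carrier by (intro image_subsetI imageI CollectI)
  show "LR.cs (pr (L.cl x) y) \<in> range scal_ext" for x y
    by (simp add: pure_ext)
qed

lemma D_simps:
  "carrier D = carrier LR.T" "add D = add LR.T" "zero D = zero LR.T"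
  "one D = ext_pure emb L \<one>\<^bsub>L\<^esub> 1"
  "smult D = (\<lambda>c. tensor_lift LR.T (\<lambda>x d. ext_pure emb L x (c * d)))"
  "mult D = (\<lambda>X Y. tensor_lift LR.T
     (\<lambda>x c. tensor_lift LR.T (\<lambda>y d. ext_pure emb L (x \<otimes>\<^bsub>L\<^esub> y) (c * d)) Y) X)"
  by (simp_all add: ext_alg_def Let_def)

lemma ext_pure_cl: "ext_pure emb L (L.cl a) d = scal_ext (scale d (mapc a))"
  unfolding ext_pure_def LR.pure_eq pure_ext ..

lemma lift_ext:
  assumes U: "presents s q U" and \<beta>: "bilinear_on L R U \<beta>"
    and c: "\<And>w. w \<in> Poly_Mapping.keys x \<Longrightarrow> q (c w) = \<beta> (L.cl (word w)) (Poly_Mapping.lookup x w)"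
  shows "tensor_lift U \<beta> (scal_ext x) = q (\<Sum>w\<in>Poly_Mapping.keys x. c w)"
proof -
  interpret U: presents s q U by (rule U)
  show ?thesis
    using LR.lift_sum[OF U \<beta>, of "Poly_Mapping.keys x" c word "Poly_Mapping.lookup x" "\<lambda>_. 1"] c
    by (simp add: scal_ext_def)
qed

lemma sum_scale_word:
  "(\<Sum>w\<in>Poly_Mapping.keys x. scale (Poly_Mapping.lookup x w) (f w)) = lin_ext scale f x"
  by (simp add: lin_ext_def)

lemma smult_D: "c \<odot>\<^bsub>D\<^esub> scal_ext x = scal_ext (scale c x)"
proof -
  have "bilinear_on L R LR.T (\<lambda>x d. ext_pure emb L x (c * d))"
    by (rule LR.bilinear_onI[OF presents_ext_T, where g = "\<lambda>a d. scale (c * d) (mapc a)"])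
      (simp_all add: ext_pure_cl mapc_add mapc_scale sc.scale_right_distrib sc.scale_left_distrib
        distrib_left mult_ac)
  then have "c \<odot>\<^bsub>D\<^esub> scal_ext x = scal_ext (\<Sum>w\<in>Poly_Mapping.keys x. scale c (scale (Poly_Mapping.lookup x w) (word w)))"
    unfolding D_simps by (rule lift_ext[OF presents_ext_T]) (simp add: ext_pure_cl)
  then show ?thesis
    by (simp only: sc.scale_sum_right[symmetric] sum_scale_word lin_ext_word_eq)
qed

lemma presents_ext: "presents scale scal_ext D"
proof -
  interpret T: presents s' scal_ext LR.T by (rule presents_ext_T)
  show ?thesis
    by (rule presents.intro) (simp_all add: vector_space_scale smult_D, simp_all add: D_simps T.carrier T.add T.zero)
qed

lemma one_D: "\<one>\<^bsub>D\<^esub> = scal_ext (word [])"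
  by (simp add: D_simps L.one_F ext_pure_cl)

text \<open>The product is given by nested lifts and is evaluated from the inside out: the inner one
  with a class and a scalar fixed on the left, then the outer one with the computed value as its
  bilinear map.\<close>

lemma mult_D: "scal_ext x \<otimes>\<^bsub>D\<^esub> scal_ext y = scal_ext (free_mult x y)"
proof -
  have inner: "tensor_lift LR.T (\<lambda>Y d. ext_pure emb L (L.cl a \<otimes>\<^bsub>L\<^esub> Y) (c * d)) (scal_ext y)
      = scal_ext (scale c (free_mult (mapc a) y))" for a c
  proof -
    have "bilinear_on L R LR.T (\<lambda>Y d. ext_pure emb L (L.cl a \<otimes>\<^bsub>L\<^esub> Y) (c * d))"
      by (rule LR.bilinear_onI[OF presents_ext_T, where g = "\<lambda>b d. scale (c * d) (mapc (free_mult a b))"])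
        (simp_all add: ext_pure_cl L.mult_F mapc_add mapc_scale sc.scale_right_distrib sc.scale_left_distrib
          distrib_left mult_ac free_mult_add_right free_mult_scale_right)
    then have "tensor_lift LR.T (\<lambda>Y d. ext_pure emb L (L.cl a \<otimes>\<^bsub>L\<^esub> Y) (c * d)) (scal_ext y)
      = scal_ext (\<Sum>w\<in>Poly_Mapping.keys y. scale c (free_mult (mapc a) (scale (Poly_Mapping.lookup y w) (word w))))"
      by (rule lift_ext[OF presents_ext_T])
        (simp add: ext_pure_cl L.mult_F mapc_free_mult free_mult_scale_right)
    also have "(\<Sum>w\<in>Poly_Mapping.keys y. scale c (free_mult (mapc a) (scale (Poly_Mapping.lookup y w) (word w))))
       = scale c (free_mult (mapc a) y)"
      by (simp only: sc.scale_sum_right[symmetric] free_mult_scale_right sum_scale_word)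
        (simp add: free_mult_lin_ext lin_ext_swap[OF vector_space_scale, of _ y] lin_ext_word[OF vector_space_scale])
    finally show ?thesis .
  qed
  have "bilinear_on L R LR.T (\<lambda>X c. tensor_lift LR.T (\<lambda>Y d. ext_pure emb L (X \<otimes>\<^bsub>L\<^esub> Y) (c * d)) (scal_ext y))"
    by (rule LR.bilinear_onI[OF presents_ext_T, where g = "\<lambda>a c. scale c (free_mult (mapc a) y)"])
      (simp_all add: inner mapc_add mapc_scale sc.scale_right_distrib sc.scale_left_distrib
        mult_ac free_mult_add_left free_mult_scale_left)
  then have "scal_ext x \<otimes>\<^bsub>D\<^esub> scal_ext y = scal_ext (\<Sum>w\<in>Poly_Mapping.keys x. scale (Poly_Mapping.lookup x w) (free_mult (word w) y))"
    unfolding D_simps by (rule lift_ext[OF presents_ext_T]) (simp add: inner)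
  then show ?thesis
    by (simp add: sum_scale_word free_mult_lin_ext lin_ext_word[OF vector_space_scale])
qed

text \<open>The radical commutes with extension of scalars. In one direction, pairing with words
  over the small field gives functionals that separate classes, and the vanishing criterion applies
  with the larger field as second factor. In the other, pairing with a word extends to a map on the
  tensor product, so it is determined by the tensor.\<close>

lemma ext_eq_0_iff: "scal_ext x = scal_ext 0 \<longleftrightarrow> x \<in> radical \<Omega> (emb v) (emb t)"
proof -
  let ?f = "\<lambda>y. lin_ext (*) (\<lambda>u. twisted_form \<Omega> v t u y)"
  have nz: "emb v \<noteq> 0" "emb t \<noteq> 0" using L.nz emb_nz by auto
  have sum: "(\<Sum>w\<in>Poly_Mapping.keys x. emb (?f y (word w)) * Poly_Mapping.lookup x w)
      = lin_ext (*) (\<lambda>u. twisted_form \<Omega> (emb v) (emb t) u y) x" for y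
    by (simp add: lin_ext_word[OF vector_space_times] emb_twisted_form lin_ext_def[of _ _ x] mult.commute)
  show ?thesis
  proof
    assume x: "x \<in> radical \<Omega> (emb v) (emb t)"
    have "(\<Sum>w\<in>Poly_Mapping.keys x. pr (L.cl (word w)) (Poly_Mapping.lookup x w)) \<in> LR.K"
    proof (rule LR.tensor_zero_criterion[where f = ?f])
      show "(\<Sum>w\<in>Poly_Mapping.keys x. emb (?f y (word w)) * Poly_Mapping.lookup x w) = 0" for y
        using x by (simp only: sum radical_iff[OF nz])
      show "L.cl z = L.cl 0" if "\<And>y. ?f y z = 0" for z
        using that by (rule L.cl_eq_0I)
    qed (simp_all add: linear_lin_ext[OF vector_space_times])
    then show "scal_ext x = scal_ext 0" by (simp add: scal_ext_def LR.cs_eq_iff)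
  next
    assume x: "scal_ext x = scal_ext 0"
    have "lin_ext (*) (\<lambda>u. twisted_form \<Omega> (emb v) (emb t) u y) x = 0" for y
    proof -
      \<comment> \<open>The pairing is read off from a chosen representative; another choice differs
        by an element of the radical, on which the pairing vanishes.\<close>
      define \<beta> where "\<beta> X c = emb (?f y (SOME a. L.cl a = X)) * c" for X c
      have \<beta>: "\<beta> (L.cl a) c = emb (?f y a) * c" for a c
      proof -
        have "L.cl (SOME b. L.cl b = L.cl a) = L.cl a" by (rule someI) (rule refl)
        then have "?f y ((SOME b. L.cl b = L.cl a) - a) = 0"
          by (simp add: L.cl_eq_iff radical_iff[OF L.nz])
        then show ?thesis by (simp add: \<beta>_def lin_ext_diff[OF vector_space_times])
      qed
      have bil: "bilinear_on L R R \<beta>"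
        by (rule LR.bilinear_onI[OF presents_R, where g = "\<lambda>a c. emb (?f y a) * c"])
          (simp_all add: \<beta> lin_ext_k emb_add emb_mult algebra_simps)
      have "tensor_lift R \<beta> (scal_ext z) = lin_ext (*) (\<lambda>u. twisted_form \<Omega> (emb v) (emb t) u y) z" for z
        by (subst lift_ext[OF presents_R bil, where c = "\<lambda>w. emb (?f y (word w)) * Poly_Mapping.lookup z w"])
          (simp_all add: \<beta> lin_ext_word[OF vector_space_times] emb_twisted_form lin_ext_def[of _ _ z] mult.commute)
      from this[of x] this[of 0] show ?thesis by (simp add: x lin_ext_zero[OF vector_space_times])
    qed
    then show "x \<in> radical \<Omega> (emb v) (emb t)" by (simp add: radical_iff[OF nz])
  qed
qed

sublocale D: presents scale scal_ext D by (rule presents_ext)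
sublocale DD: word_tensor scal_ext D scal_ext D by unfold_locales

text \<open>The inner lift sends a pure tensor of classes to the same tensor after extension; the
  outer one inserts the scalar. On representatives the result is the coproduct of the free algebra
  for the image parameters.\<close>

lemma ext_comult: "ext_comult emb L (fcomult \<Omega> v t) (scal_ext x) = DD.qT (free_comult \<Omega> (emb v) (emb t) x)"
proof -
  let ?TK = "restrict_scalars emb DD.T"
  interpret T: presents scale DD.qT DD.T by (rule DD.presents_qT)
  have TK: "presents s' DD.qT ?TK" by (rule presents_restrict[OF DD.presents_qT])
  have inner: "tensor_lift ?TK (\<lambda>A B. pure D D (ext_pure emb L A 1) (ext_pure emb L B 1)) (fcomult \<Omega> v t (L.cl a))
      = DD.qT (mapc (free_comult \<Omega> v t a))" for a
  proof -
    have bil: "bilinear_on L L ?TK (\<lambda>A B. pure D D (ext_pure emb L A 1) (ext_pure emb L B 1))"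
      by (rule L.FF.bilinear_onI[OF TK, where g = "\<lambda>a b. free_tensor (mapc a) (mapc b)"])
        (simp_all add: ext_pure_cl DD.pure_q mapc_add mapc_scale free_tensor_add_left free_tensor_add_right
          free_tensor_scale_left free_tensor_scale_right)
    show ?thesis
      unfolding L.fcomult_cl
      by (subst L.FF.lift_qT[OF TK bil, where c = "\<lambda>p. Poly_Mapping.single p 1"])
        (simp_all add: ext_pure_cl DD.pure_q lin_ext_mapc[OF vector_space_scale, symmetric] lin_ext_unit)
  qed
  have "bilinear_on L R ?TK (\<lambda>X c. c \<odot>\<^bsub>DD.T\<^esub>
     tensor_lift ?TK (\<lambda>A B. pure D D (ext_pure emb L A 1) (ext_pure emb L B 1)) (fcomult \<Omega> v t X))"
    by (rule LR.bilinear_onI[OF TK, where g = "\<lambda>a c. scale c (mapc (free_comult \<Omega> v t a))"])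
      (simp_all add: inner T.smult free_comult_lin_ext lin_ext_sc mapc_add mapc_scale sc.scale_right_distrib
        sc.scale_left_distrib mult_ac)
  then have "ext_comult emb L (fcomult \<Omega> v t) (scal_ext x) = DD.qT (\<Sum>w\<in>Poly_Mapping.keys x.
      scale (Poly_Mapping.lookup x w) (comult_word \<Omega> (emb v) (emb t) w))"
    unfolding ext_comult_def Let_def
    by (rule lift_ext[OF TK]) (simp add: inner T.smult mapc_comult_word)
  then show ?thesis by (simp add: sum_scale_word free_comult_lin_ext)
qed

end

section \<open>Homogeneous components\<close>

lemma lookup_hpart:
  "Poly_Mapping.lookup (hpart \<nu> x) w = (if deg w = \<nu> then Poly_Mapping.lookup x w else 0)"
proof -
  have "Poly_Mapping.lookup (hpart \<nu> x) w
      = (\<Sum>u\<in>Poly_Mapping.keys x. if u = w then (if deg w = \<nu> then Poly_Mapping.lookup x w else 0) else 0)"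
    unfolding hpart_def lin_ext_def lookup_sum
    by (rule sum.cong) (auto simp: word_def lookup_single when_def)
  then show ?thesis by (simp add: in_keys_iff)
qed

lemma keys_hpart: "Poly_Mapping.keys (hpart \<nu> x) \<subseteq> {w. deg w = \<nu>}"
  by (auto simp: in_keys_iff lookup_hpart split: if_splits)

lemma hpart_homogeneous:
  "Poly_Mapping.keys x \<subseteq> {w. deg w = \<mu>} \<Longrightarrow> hpart \<nu> x = (if \<nu> = \<mu> then x else 0)"
  by (rule poly_mapping_eqI) (auto simp: lookup_hpart in_keys_iff)

lemma hpart_eq_0: "\<nu> \<notin> deg ` Poly_Mapping.keys x \<Longrightarrow> hpart \<nu> x = 0"
  by (rule poly_mapping_eqI) (auto simp: lookup_hpart in_keys_iff)

lemma sum_hpart: "(\<Sum>\<nu>\<in>deg ` Poly_Mapping.keys x. hpart \<nu> x) = x"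
  by (rule poly_mapping_eqI) (auto simp: lookup_sum lookup_hpart in_keys_iff)

lemma lin_ext_hpart:
  assumes "vector_space s"
  shows "lin_ext s f (hpart \<nu> x) = lin_ext s (\<lambda>w. if deg w = \<nu> then f w else 0) x"
  unfolding hpart_def lin_ext_comp[OF assms]
  by (rule lin_ext_cong) (simp add: lin_ext_word lin_ext_zero assms)

context base_change
begin

abbreviation "G \<equiv> ext_grading emb L (fgrading \<Omega> v t)"

text \<open>The grading requires just one representative with homogeneous first factors. Such a
  representative is rewritten pair by pair, moving each scalar into the coefficients of a
  homogeneous combination of words.\<close>

lemma G_eq: "G \<nu> = scal_ext ` {x. Poly_Mapping.keys x \<subseteq> {w. deg w = \<nu>}}"
proof
  show "scal_ext ` {x. Poly_Mapping.keys x \<subseteq> {w. deg w = \<nu>}} \<subseteq> G \<nu>"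
  proof (rule image_subsetI)
    fix x :: "'i list \<Rightarrow>\<^sub>0 'l" assume x: "x \<in> {x. Poly_Mapping.keys x \<subseteq> {w. deg w = \<nu>}}"
    let ?z = "\<Sum>w\<in>Poly_Mapping.keys x. pr (L.cl (word w)) (Poly_Mapping.lookup x w) :: _ \<Rightarrow>\<^sub>0 'k"
    have "?z \<in> scal_ext x" unfolding scal_ext_def by (rule sc.mem_coset_self[OF LR.subspace_K])
    moreover have "L.cl (word w) \<in> fgrading \<Omega> v t \<nu>" if "w \<in> Poly_Mapping.keys x" for w
      using x that unfolding fgrading_def by (intro imageI) (auto simp: word_def)
    then have "Poly_Mapping.keys ?z \<subseteq> fgrading \<Omega> v t \<nu> \<times> UNIV"
      by (intro order_trans[OF keys_sum]) auto
    ultimately show "scal_ext x \<in> G \<nu>" by (auto simp: ext_grading_def D.carrier)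
  qed
  show "G \<nu> \<subseteq> scal_ext ` {x. Poly_Mapping.keys x \<subseteq> {w. deg w = \<nu>}}"
  proof
    interpret T: presents s' scal_ext LR.T by (rule presents_ext_T)
    fix X assume "X \<in> G \<nu>"
    then obtain z where X: "X \<in> carrier LR.T" and z: "z \<in> X" "Poly_Mapping.keys z \<subseteq> fgrading \<Omega> v t \<nu> \<times> UNIV"
      unfolding ext_grading_def by (auto simp: D_simps)
    from X obtain z' where "X = LR.cs z'" by (auto simp: LR.tensor_carrier)
    with z(1) have Xz: "X = LR.cs z"
      by (metis LR.subspace_K sc.coset_eq_iff sc.mem_coset_iff)
    have "\<exists>b. LR.cs (Poly_Mapping.single p 1) = scal_ext b \<and> Poly_Mapping.keys b \<subseteq> {w. deg w = \<nu>}"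
      if p: "p \<in> Poly_Mapping.keys z" for p
    proof -
      from p z(2) obtain a where "fst p = L.cl a" "\<forall>w\<in>Poly_Mapping.keys a. deg w = \<nu>"
        unfolding fgrading_def by auto
      then show ?thesis
        using pure_ext[of a "snd p"] keys_scale[of "snd p" "mapc a"] keys_mapc[of a]
        by (intro exI[of _ "scale (snd p) (mapc a)"]) (cases p, auto)
    qed
    then obtain b where b: "\<And>p. p \<in> Poly_Mapping.keys z \<Longrightarrow> LR.cs (Poly_Mapping.single p 1) = scal_ext (b p)"
      "\<And>p. p \<in> Poly_Mapping.keys z \<Longrightarrow> Poly_Mapping.keys (b p) \<subseteq> {w. deg w = \<nu>}"
      by metis
    let ?x = "\<Sum>p\<in>Poly_Mapping.keys z. scale (emb (Poly_Mapping.lookup z p)) (b p)"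
    have "LR.cs (sum f A) = scal_ext (sum g A)" if "\<And>a. a \<in> A \<Longrightarrow> LR.cs (f a) = scal_ext (g a)" for f :: "_ \<Rightarrow> _ \<Rightarrow>\<^sub>0 'k" and g and A :: "(('i list \<Rightarrow>\<^sub>0 'k) set \<times> 'l) set"
      using that
    proof (induction A rule: infinite_finite_induct)
      case (insert a A)
      then show ?case by (simp add: LR.tensor_add[symmetric] T.add[symmetric])
    qed (simp_all add: T.zero[symmetric] LR.tensor_zero)
    then have "LR.cs (\<Sum>p\<in>Poly_Mapping.keys z. scale (Poly_Mapping.lookup z p) (Poly_Mapping.single p 1)) = scal_ext ?x"
      using b(1) by (simp add: LR.tensor_smult[symmetric] T.smult[symmetric] del: scale_single)
    then have "X = scal_ext ?x"
      using lin_ext_unit[of z] by (simp add: lin_ext_def Xz)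
    moreover have "?x \<in> {x. Poly_Mapping.keys x \<subseteq> {w. deg w = \<nu>}}"
      using b(2) by (intro sc.subspace_sum[OF LR.subspace_supp] sc.subspace_scale[OF LR.subspace_supp]) auto
    ultimately show "X \<in> scal_ext ` {x. Poly_Mapping.keys x \<subseteq> {w. deg w = \<nu>}}"
      by (rule image_eqI)
  qed
qed

text \<open>\<open>component\<close> is a description, so a decomposition must exist and be unique.
  Existence comes from splitting a representative by degree, uniqueness from the homogeneity of the
  radical.\<close>

lemma component_ext: "component D G (scal_ext x) = (\<lambda>\<nu>. scal_ext (hpart \<nu> x))"
  unfolding component_def
proof (rule the_equality)
  let ?d = "\<lambda>\<nu>. scal_ext (hpart \<nu> x)"
  let ?N = "{\<nu>. ?d \<nu> \<noteq> \<zero>\<^bsub>D\<^esub>}"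
  have sub: "?N \<subseteq> deg ` Poly_Mapping.keys x"
    using hpart_eq_0[of _ x] by (auto simp: D.zero)
  \<comment> \<open>A nonzero homogeneous part of \<open>x\<close> may lie in the radical; such
    degrees are absent from \<open>?N\<close>, and dropping them does not change the class.\<close>
  have "scal_ext (\<Sum>\<nu>\<in>deg ` Poly_Mapping.keys x. hpart \<nu> x)
      = scal_ext (\<Sum>\<nu>\<in>deg ` Poly_Mapping.keys x. if \<nu> \<in> ?N then hpart \<nu> x else 0)"
    by (rule D.q_sum_cong) (simp add: D.zero)
  also have "\<dots> = scal_ext (\<Sum>\<nu>\<in>?N. hpart \<nu> x)"
    using sub by (simp only: sum.inter_restrict[OF finite_imageI[OF finite_keys], symmetric] Int_absorb1)
  finally have "scal_ext x = (\<Oplus>\<^bsub>D\<^esub>\<nu>\<in>?N. ?d \<nu>)"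
    by (simp only: D.finsum_q sum_hpart)
  then show "(\<forall>\<nu>. ?d \<nu> \<in> G \<nu>) \<and> finite ?N \<and> scal_ext x = (\<Oplus>\<^bsub>D\<^esub>\<nu>\<in>?N. ?d \<nu>)"
    unfolding G_eq using finite_subset[OF sub]
    by (intro conjI allI imageI CollectI keys_hpart) simp_all
next
  have nz: "emb v \<noteq> 0" "emb t \<noteq> 0" using L.nz emb_nz by auto
  fix d
  assume d: "(\<forall>\<nu>. d \<nu> \<in> G \<nu>) \<and> finite {\<nu>. d \<nu> \<noteq> \<zero>\<^bsub>D\<^esub>} \<and> scal_ext x = (\<Oplus>\<^bsub>D\<^esub>\<nu>\<in>{\<nu>. d \<nu> \<noteq> \<zero>\<^bsub>D\<^esub>}. d \<nu>)"
  define N where "N = {\<nu>. d \<nu> \<noteq> \<zero>\<^bsub>D\<^esub>}"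
  have "\<exists>e. d \<nu> = scal_ext e \<and> Poly_Mapping.keys e \<subseteq> {w. deg w = \<nu>}" for \<nu>
  proof -
    have "d \<nu> \<in> G \<nu>" using d by blast
    then show ?thesis unfolding G_eq by blast
  qed
  then obtain e where e: "\<And>\<nu>. d \<nu> = scal_ext (e \<nu>)" "\<And>\<nu>. Poly_Mapping.keys (e \<nu>) \<subseteq> {w. deg w = \<nu>}"
    by metis
  have "d = (\<lambda>\<nu>. scal_ext (e \<nu>))" by (rule ext) (rule e(1))
  then have "scal_ext x = (\<Oplus>\<^bsub>D\<^esub>\<nu>\<in>N. scal_ext (e \<nu>))"
    using d by (simp add: N_def)
  then have rad: "x - sum e N \<in> radical \<Omega> (emb v) (emb t)"
    by (simp only: D.finsum_q ext_eq_0_iff[symmetric] D.q_eq_iff[symmetric])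
  show "d = (\<lambda>\<mu>. scal_ext (hpart \<mu> x))"
  proof
    fix \<mu>
    \<comment> \<open>Taking the part of degree \<open>\<mu>\<close> of an element of the radical
      stays in the radical and isolates the single candidate \<open>e \<mu>\<close>.\<close>
    have "hpart \<mu> (x - sum e N) = hpart \<mu> x - (\<Sum>\<nu>\<in>N. hpart \<mu> (e \<nu>))"
      by (simp add: hpart_def lin_ext_diff[OF vector_space_scale] lin_ext_sum[OF vector_space_scale])
    also have "(\<Sum>\<nu>\<in>N. hpart \<mu> (e \<nu>)) = (if \<mu> \<in> N then e \<mu> else 0)"
      using d by (simp add: N_def[symmetric] hpart_homogeneous[OF e(2)])
    finally have "hpart \<mu> x - (if \<mu> \<in> N then e \<mu> else 0) \<in> radical \<Omega> (emb v) (emb t)"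
      using hpart_radical[OF nz rad, of \<mu>] by simp
    then have "scal_ext (hpart \<mu> x) = scal_ext (if \<mu> \<in> N then e \<mu> else 0)"
      by (simp only: D.q_eq_iff[of "hpart \<mu> x"] ext_eq_0_iff)
    also have "\<dots> = d \<mu>" using e(1)[of \<mu>] by (auto simp: N_def D.zero)
    finally show "d \<mu> = scal_ext (hpart \<mu> x)" by simp
  qed
qed

text \<open>Serves both the deformed product and the deformed coproduct. The sum over degrees
  present in the quotient is enlarged to all degrees of the representatives; after exchanging sums,
  each pair of words contributes only at its own pair of degrees, so the weight can be attached word
  by word.\<close>

lemma graded_rescale_ext:
  assumes U: "presents s q U"
    and \<beta>: "\<And>x y. \<beta> (scal_ext x) (scal_ext y) = q (lin_ext s (\<lambda>u. lin_ext s (h u) y) x)"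
  shows "graded_rescale D G U c \<beta> (scal_ext x) (scal_ext y)
    = q (lin_ext s (\<lambda>u. lin_ext s (\<lambda>w. s (c (deg u) (deg w)) (h u w)) y) x)"
proof -
  interpret U: presents s q U by (rule U)
  note vs = U.vs
  let ?N = "\<lambda>x. {\<nu>. scal_ext (hpart \<nu> x) \<noteq> scal_ext 0}"
  let ?B = "\<lambda>x. deg ` Poly_Mapping.keys x"
  let ?h = "\<lambda>x y. lin_ext s (\<lambda>u. lin_ext s (h u) y) x"
  let ?F = "\<lambda>p. s (c (fst p) (snd p)) (?h (hpart (fst p) x) (hpart (snd p) y))"
  have deg: "degrees D G (scal_ext x) = ?N x" for x
    by (simp add: degrees_def component_ext D.zero)
  have sub: "?N x \<subseteq> ?B x" for x
    using hpart_eq_0[of _ x] by auto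
  have "graded_rescale D G U c \<beta> (scal_ext x) (scal_ext y) = q (sum ?F (?N x \<times> ?N y))"
    by (simp only: graded_rescale_def deg component_ext \<beta> U.smult U.finsum_q)
  also have "\<dots> = q (\<Sum>p\<in>?B x \<times> ?B y. if p \<in> ?N x \<times> ?N y then ?F p else 0)"
    using sub by (simp only: sum.inter_restrict[OF finite_cartesian_product[OF finite_imageI[OF finite_keys] finite_imageI[OF finite_keys]], symmetric]
      Int_absorb1 Sigma_mono)
  also have "\<dots> = q (sum ?F (?B x \<times> ?B y))"
  \<comment> \<open>A pair of degrees outside the original range has a component that is zero in the
    quotient. The value of \<open>\<beta>\<close> depends on classes only, so it may be computed
    with the representative 0.\<close>
  proof (rule U.q_sum_cong)
    fix p
    show "q (if p \<in> ?N x \<times> ?N y then ?F p else 0) = q (?F p)"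
    proof (cases "p \<in> ?N x \<times> ?N y")
      case False
      then have "scal_ext (hpart (fst p) x) = scal_ext 0 \<or> scal_ext (hpart (snd p) y) = scal_ext 0" by (cases p) auto
      then have "q (?h (hpart (fst p) x) (hpart (snd p) y)) = q 0"
        unfolding \<beta>[symmetric]
      proof
        assume "scal_ext (hpart (fst p) x) = scal_ext 0"
        then show "\<beta> (scal_ext (hpart (fst p) x)) (scal_ext (hpart (snd p) y)) = q 0"
          by (simp add: \<beta> lin_ext_zero[OF vs])
      next
        assume "scal_ext (hpart (snd p) y) = scal_ext 0"
        then show "\<beta> (scal_ext (hpart (fst p) x)) (scal_ext (hpart (snd p) y)) = q 0"
          by (simp add: \<beta> lin_ext_zero[OF vs] lin_ext_fun_zero[OF vs])
      qed
      then have "q (?F p) = q 0" by (simp add: U.smult[symmetric]) (simp add: U.smult)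
      with False show ?thesis by simp
    qed simp
  qed
  also have "sum ?F (?B x \<times> ?B y) = lin_ext s (\<lambda>u. lin_ext s (\<lambda>w. \<Sum>p\<in>?B x \<times> ?B y.
      s (c (fst p) (snd p)) (if deg u = fst p then if deg w = snd p then h u w else 0 else 0)) y) x"
  proof -
    have "?h (hpart \<mu> x) (hpart \<nu> y) = lin_ext s (\<lambda>u. lin_ext s (\<lambda>w. if deg u = \<mu> then if deg w = \<nu> then h u w else 0 else 0) y) x" for \<mu> \<nu>
      unfolding lin_ext_hpart[OF vs] by (rule lin_ext_cong) (simp add: lin_ext_fun_zero[OF vs])
    then show ?thesis by (simp only: lin_ext_fun_sum[OF vs] lin_ext_fun_scale[OF vs])
  qed
  also have "\<dots> = lin_ext s (\<lambda>u. lin_ext s (\<lambda>w. s (c (deg u) (deg w)) (h u w)) y) x"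
  proof (intro lin_ext_cong)
    fix u w assume uw: "u \<in> Poly_Mapping.keys x" "w \<in> Poly_Mapping.keys y"
    have "(\<Sum>p\<in>?B x \<times> ?B y. s (c (fst p) (snd p)) (if deg u = fst p then if deg w = snd p then h u w else 0 else 0))
       = (\<Sum>p\<in>?B x \<times> ?B y. if p = (deg u, deg w) then s (c (deg u) (deg w)) (h u w) else 0)"
      by (rule sum.cong) auto
    then show "(\<Sum>p\<in>?B x \<times> ?B y. s (c (fst p) (snd p)) (if deg u = fst p then if deg w = snd p then h u w else 0 else 0))
       = s (c (deg u) (deg w)) (h u w)"
      using uw by simp
  qed
  finally show ?thesis .
qed

end

section \<open>The isomorphism\<close>

lemma twist_word: "twist \<Omega> t (word w) = Poly_Mapping.single w (t powi tau \<Omega> w)"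
  by (simp add: twist_def lin_ext_word[OF vector_space_scale])

lemma
  shows twist_add: "twist \<Omega> t (x + y) = twist \<Omega> t x + twist \<Omega> t y"
    and twist_diff: "twist \<Omega> t (x - y) = twist \<Omega> t x - twist \<Omega> t y"
    and twist_scale: "twist \<Omega> t (scale c x) = scale c (twist \<Omega> t x)"
  by (simp_all add: twist_def lin_ext_sc lin_ext_diff[OF vector_space_scale])

lemma lin_ext_twist:
  assumes "vector_space s"
  shows "lin_ext s f (twist \<Omega> t x) = lin_ext s (\<lambda>w. s (t powi tau \<Omega> w) (f w)) x"
  by (simp add: twist_def lin_ext_comp lin_ext_single assms)

lemma surj_twist:
  assumes "t \<noteq> 0"
  shows "surj (twist \<Omega> t)"
proof (rule surjI)
  fix x
  show "twist \<Omega> t (lin_ext scale (\<lambda>w. Poly_Mapping.single w (t powi (- tau \<Omega> w))) x) = x"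
    using assms lin_ext_unit[of x]
    by (simp add: twist_def lin_ext_comp[OF vector_space_scale] lin_ext_sc power_int_minus)
qed

text \<open>By \<open>tau_append\<close> the scalar of \<open>u @ w\<close> is that of
  \<open>u\<close> times that of \<open>w\<close> times a power of \<open>t\<close> to the bracket.
  The right-hand side is the deformed product on representatives.\<close>

lemma twist_free_mult:
  assumes "t \<noteq> 0"
  shows "twist \<Omega> t (free_mult x y) = lin_ext scale (\<lambda>u. lin_ext scale
    (\<lambda>w. scale (t powi bracket \<Omega> (zdeg u) (zdeg w)) (word (u @ w))) (twist \<Omega> t y)) (twist \<Omega> t x)"
proof -
  note sc = vector_space_scale
  have "twist \<Omega> t (free_mult x y) = lin_ext scale (\<lambda>u. lin_ext scale
      (\<lambda>w. Poly_Mapping.single (u @ w) (t powi tau \<Omega> (u @ w))) y) x"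
    by (simp add: twist_def lin_ext_free_mult[OF sc])
  then show ?thesis
    using assms
    by (simp add: lin_ext_twist[OF sc] lin_ext_fun_scale[OF sc, symmetric] tau_append power_int_add
        word_def mult_ac)
qed

text \<open>Compared over the coproduct for 1, both sides give a term \<open>p\<close> of the
  coproduct of \<open>w\<close> the exponent \<open>tau\<close> of \<open>w\<close> minus the
  bracket of the factors of \<open>p\<close>; on the right the \<open>tau\<close> of the factors
  cancel against \<open>twist_exp\<close>.\<close>

lemma twist_free_comult:
  assumes "t \<noteq> 0"
  shows "lin_ext scale (\<lambda>p. Poly_Mapping.single p (t powi (- bracket \<Omega> (zdeg (fst p)) (zdeg (snd p)))))
      (free_comult \<Omega> v 1 (twist \<Omega> t x))
    = lin_ext scale (\<lambda>p. free_tensor (twist \<Omega> t (word (fst p))) (twist \<Omega> t (word (snd p)))) (free_comult \<Omega> v t x)"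
proof -
  note sc = vector_space_scale
  have ft: "free_tensor (twist \<Omega> t (word a)) (twist \<Omega> t (word b))
      = Poly_Mapping.single (a, b) (t powi tau \<Omega> a * t powi tau \<Omega> b)" for a b
    by (simp add: twist_word free_tensor_lin_ext lin_ext_sc mult.commute)
  have "lin_ext scale (\<lambda>p. free_tensor (twist \<Omega> t (word (fst p))) (twist \<Omega> t (word (snd p)))) (comult_word \<Omega> v t w)
    = lin_ext scale (\<lambda>p. Poly_Mapping.single p (t powi (tau \<Omega> w - bracket \<Omega> (zdeg (fst p)) (zdeg (snd p))))) (comult_word \<Omega> v 1 w)" for w
    using assms
    by (simp add: comult_word_twist[OF assms, of \<Omega> v] lin_ext_comp[OF sc] lin_ext_sc ft
        power_int_add[symmetric] twist_exp_def)
  then show ?thesis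
    using assms
    by (simp add: free_comult_lin_ext lin_ext_comp[OF sc] lin_ext_twist[OF sc] lin_ext_scale[OF sc]
        lin_ext_fun_scale[OF sc, symmetric] power_int_add[symmetric])
qed

text \<open>Tensor products depend on the vector space structure alone, so those of the deformed
  algebra are literally those of the undeformed one.\<close>

lemma tensor_mult_update:
  "tensor (V\<lparr>mult := m\<rparr>) (W\<lparr>mult := n\<rparr>) = tensor V W"
  "pure (V\<lparr>mult := m\<rparr>) (W\<lparr>mult := n\<rparr>) = pure V W"
  by (simp_all add: tensor_def pure_def[abs_def] tensor_kernel_def tensor_relators_def)

lemma field_hom_Qvt_of: "field_hom Qvt_of"
  by unfold_locales (simp_all add: Qvt_of_def pCons_one mult.commute flip: One_fract_def)

lemma Qv_v_nz: "Qv_v \<noteq> 0"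
  by (simp add: Qv_v_def Zero_fract_def eq_fract)

lemma Qvt_t_nz: "Qvt_t \<noteq> 0"
  by (simp add: Qvt_t_def Zero_fract_def[where 'a = "rat poly fract poly"] eq_fract)

theorem theorem3:
  fixes \<Omega> :: "'i::finite \<Rightarrow> 'i \<Rightarrow> int"
  assumes "datum \<Omega>"
  shows "\<exists>\<phi>. \<phi> \<in> ring_iso (frak_f \<Omega>) (deformed_f \<Omega>) \<and>
    (\<forall>c. \<forall>x\<in>carrier (frak_f \<Omega>). \<phi> (c \<odot>\<^bsub>frak_f \<Omega>\<^esub> x) = c \<odot>\<^bsub>deformed_f \<Omega>\<^esub> \<phi> x) \<and>
    (\<forall>i. \<phi> (frak_theta \<Omega> i) = fvt_theta \<Omega> i) \<and>
    (\<forall>x\<in>carrier (frak_f \<Omega>).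
       tensor_map (deformed_f \<Omega>) (deformed_f \<Omega>) \<phi> \<phi> (frak_r \<Omega> x) = deformed_r1 \<Omega> (\<phi> x))"
proof -
  interpret Q: field_hom Qvt_of by (rule field_hom_Qvt_of)
  have v: "Qvt_of Qv_v = Qvt_v" by (simp add: Qvt_v_def)
  interpret F: form_params \<Omega> Qvt_v Qvt_t
    by unfold_locales (simp_all add: Qvt_t_nz Q.emb_nz[OF Qv_v_nz] flip: v)
  interpret B: base_change Qvt_of \<Omega> Qv_v 1
    by unfold_locales (simp_all add: Qv_v_nz)
  \<comment> \<open>The embedding fixes 1, so the kernel on the target side is the radical for
    parameter 1 over the same field as the source. The two radicals can now be compared by the
    rescaling.\<close>
  note ext_0 = B.ext_eq_0_iff[unfolded v Q.emb_1]
  let ?tw = "twist \<Omega> Qvt_t"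
  define \<phi> where "\<phi> X = the_elem ((\<lambda>x. B.scal_ext (?tw x)) ` X)" for X
  \<comment> \<open>The forward and backward implications give injectivity and well-definedness of
    the induced map.\<close>
  have ker: "B.scal_ext (?tw x) = B.scal_ext (?tw y) \<longleftrightarrow> F.cl x = F.cl y" for x y
    unfolding B.D.q_eq_iff[of "?tw x"] ext_0 twist_diff[symmetric] radical_twist[OF F.nz] F.cl_eq_iff ..
  have \<phi>: "\<phi> (F.cl x) = B.scal_ext (?tw x)" for x
  proof -
    have "B.scal_ext (?tw y) = B.scal_ext (?tw x)" if "y \<in> F.cl x" for y
      using that by (simp add: ker F.cl_eq_iff F.mem_cl_iff)
    moreover have "x \<in> F.cl x" by (simp add: F.mem_cl_iff sc.subspace_0[OF F.subspace_I])
    ultimately have "(\<lambda>x. B.scal_ext (?tw x)) ` F.cl x = {B.scal_ext (?tw x)}" by blast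
    then show ?thesis by (simp add: \<phi>_def)
  qed
  have A: "lusztig_fvt \<Omega> = B.D" by (simp add: lusztig_fvt_def lusztig_f_def)
  have G: "fvt_grading \<Omega> = B.G" by (rule ext) (simp add: fvt_grading_def lusztig_f_def)
  have T: "tensor (deformed_f \<Omega>) (deformed_f \<Omega>) = B.DD.T" "pure (deformed_f \<Omega>) (deformed_f \<Omega>) = pure B.D B.D"
    by (simp_all add: deformed_f_def tensor_mult_update A)
  have odot: "odot \<Omega> (B.scal_ext x) (B.scal_ext y) = B.scal_ext (lin_ext scale (\<lambda>u. lin_ext scale
    (\<lambda>w. scale (Qvt_t powi bracket \<Omega> (zdeg u) (zdeg w)) (word (u @ w))) y) x)" for x y
    unfolding odot_def A G
    by (rule B.graded_rescale_ext[OF B.presents_ext]) (simp add: B.mult_D free_mult_lin_ext)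
  have iso: "\<phi> \<in> ring_iso (frak_f \<Omega>) (deformed_f \<Omega>)"
  proof (rule ring_iso_memI)
    fix X Y assume "X \<in> carrier (frak_f \<Omega>)" "Y \<in> carrier (frak_f \<Omega>)"
    then obtain x y where xy: "X = F.cl x" "Y = F.cl y" by (auto simp: frak_f_def F.F.carrier)
    show "\<phi> (X \<otimes>\<^bsub>frak_f \<Omega>\<^esub> Y) = \<phi> X \<otimes>\<^bsub>deformed_f \<Omega>\<^esub> \<phi> Y"
      by (simp add: xy frak_f_def F.mult_F \<phi> deformed_f_def odot twist_free_mult[OF Qvt_t_nz])
    show "\<phi> (X \<oplus>\<^bsub>frak_f \<Omega>\<^esub> Y) = \<phi> X \<oplus>\<^bsub>deformed_f \<Omega>\<^esub> \<phi> Y"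
      by (simp add: xy frak_f_def F.F.add \<phi> deformed_f_def A B.D.add twist_add)
  next
    fix X assume "X \<in> carrier (frak_f \<Omega>)"
    then show "\<phi> X \<in> carrier (deformed_f \<Omega>)"
      by (auto simp: frak_f_def F.F.carrier \<phi> deformed_f_def A B.D.carrier)
  next
    show "\<phi> \<one>\<^bsub>frak_f \<Omega>\<^esub> = \<one>\<^bsub>deformed_f \<Omega>\<^esub>"
      by (simp add: frak_f_def F.one_F \<phi> deformed_f_def A B.one_D twist_word word_def[symmetric])
  next
    show "bij_betw \<phi> (carrier (frak_f \<Omega>)) (carrier (deformed_f \<Omega>))"
    proof (rule bij_betw_imageI)
      show "inj_on \<phi> (carrier (frak_f \<Omega>))"
        by (rule inj_onI) (auto simp: frak_f_def F.F.carrier \<phi> ker)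
      \<comment> \<open>Every class is hit already on representatives, since the rescaling is
        inverted by the opposite powers of \<open>t\<close>.\<close>
      have "range (\<lambda>x. B.scal_ext (?tw x)) = range B.scal_ext"
        using surj_twist[OF Qvt_t_nz, of \<Omega>] by (metis image_image)
      then show "\<phi> ` carrier (frak_f \<Omega>) = carrier (deformed_f \<Omega>)"
        by (simp add: frak_f_def F.F.carrier deformed_f_def A B.D.carrier image_image \<phi>)
    qed
  qed
  have smult: "\<phi> (c \<odot>\<^bsub>frak_f \<Omega>\<^esub> X) = c \<odot>\<^bsub>deformed_f \<Omega>\<^esub> \<phi> X" if "X \<in> carrier (frak_f \<Omega>)" for c X
    using that by (auto simp: frak_f_def F.F.carrier F.F.smult \<phi> deformed_f_def A B.D.smult twist_scale)
  \<comment> \<open>A single letter contains no pair of positions, so its exponent is 0 and the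
    rescaling fixes the generators.\<close>
  have theta: "\<phi> (frak_theta \<Omega> i) = fvt_theta \<Omega> i" for i
    by (simp add: frak_theta_def fvt_theta_def ftheta_def lusztig_f_def \<phi> B.ext_pure_cl twist_word word_def[symmetric])
  have comult: "tensor_map (deformed_f \<Omega>) (deformed_f \<Omega>) \<phi> \<phi> (frak_r \<Omega> X) = deformed_r1 \<Omega> (\<phi> X)"
    if "X \<in> carrier (frak_f \<Omega>)" for X
  proof -
    from that obtain x where X: "X = F.cl x" by (auto simp: frak_f_def F.F.carrier)
    note qT = B.DD.presents_qT
    have "bilinear_on F.F F.F B.DD.T (\<lambda>x y. pure B.D B.D (\<phi> x) (\<phi> y))"
      by (rule F.FF.bilinear_onI[OF qT, where g = "\<lambda>a b. free_tensor (?tw a) (?tw b)"])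
        (simp_all add: \<phi> B.DD.pure_q twist_add twist_scale free_tensor_add_left free_tensor_add_right
          free_tensor_scale_left free_tensor_scale_right)
    then have l: "tensor_map (deformed_f \<Omega>) (deformed_f \<Omega>) \<phi> \<phi> (frak_r \<Omega> X)
      = B.DD.qT (lin_ext scale (\<lambda>p. free_tensor (?tw (word (fst p))) (?tw (word (snd p)))) (free_comult \<Omega> Qvt_v Qvt_t x))"
      unfolding tensor_map_def T frak_r_def X F.fcomult_cl
      by (rule F.FF.lift_qT[OF qT]) (simp add: \<phi> B.DD.pure_q)
    let ?\<beta> = "graded_rescale B.D B.G B.DD.T (\<lambda>\<mu> \<nu>. Qvt_t powi (- bracket \<Omega> (to_Z \<mu>) (to_Z \<nu>))) (pure B.D B.D)"
    have \<beta>: "?\<beta> (B.scal_ext a) (B.scal_ext b) = B.DD.qT (lin_ext scale (\<lambda>u. lin_ext scale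
      (\<lambda>w. scale (Qvt_t powi (- bracket \<Omega> (zdeg u) (zdeg w))) (Poly_Mapping.single (u, w) 1)) b) a)" for a b
      by (rule B.graded_rescale_ext[OF qT]) (simp add: B.DD.pure_q free_tensor_lin_ext)
    have "bilinear_on B.D B.D B.DD.T ?\<beta>"
      by (rule B.DD.bilinear_onI[OF qT, where g = "\<lambda>a b. lin_ext scale (\<lambda>u. lin_ext scale
          (\<lambda>w. scale (Qvt_t powi (- bracket \<Omega> (zdeg u) (zdeg w))) (Poly_Mapping.single (u, w) 1)) b) a"])
        (simp_all add: \<beta> lin_ext_sc lin_ext_fun_add[OF vector_space_scale] lin_ext_fun_scale[OF vector_space_scale])
    then have r: "deformed_r1 \<Omega> (B.scal_ext y) = B.DD.qT (lin_ext scale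
      (\<lambda>p. Poly_Mapping.single p (Qvt_t powi (- bracket \<Omega> (zdeg (fst p)) (zdeg (snd p))))) (free_comult \<Omega> Qvt_v 1 y))" for y
      unfolding deformed_r1_def Let_def A G fvt_tilde_r1_def lusztig_f_def B.ext_comult v Q.emb_1
      by (rule B.DD.lift_qT[OF qT]) (simp add: \<beta> lin_ext_word[OF vector_space_scale])
    \<comment> \<open>Both sides are images under \<open>B.DD.qT\<close> of combinations of pairs of
      words that agree before any passage to the quotient.\<close>
    show ?thesis
      unfolding l unfolding X \<phi> r twist_free_comult[OF Qvt_t_nz] ..
  qed
  show ?thesis using iso smult theta comult by blast
qed

end
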